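(* Let $G(q)=\sum_{m=2}^\infty\sum_{\Lambda\in\mathcal R^*_m}\frac{e^{-m}}{q-\Lambda}$ for $q\in\mathbb D\cup\mathbb E$. There exist $r>1$ and $g\in B_r$ such that the function $\chi(q,z)=q^{-1}\big(f_g(q,z)-f_g(0,1)\big)$ satisfies $\chi(q,1)=G(q)$ for all $q\in\mathbb D\cup\mathbb E$. As a consequence: i) for all $\Lambda_0\in\mathcal R$, the series $G$ belongs to the space $(q-\Lambda_0)^{-1}\mathcal G_1(\Lambda_0,\mathbb C)$, which is quasianalytic at $\Lambda_0$; ii) for all $\lambda\in\underline{\mathrm{DC}}_2$ and $r'\in\,]1,r[$, the function $\chi$ belongs to the space $\mathcal G^\odot_1(\lambda,B_{r'})$, which is quasianalytic at $\lambda$.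
   Context: $\mathbb D=\{|q|<1\}$, $\mathbb E=\{|q|>1\}$, $\mathbb S^1=\{|q|=1\}$. $\mathcal R^*_m$ is the set of primitive $m$-th roots of unity, $\mathcal R_m$ the set of all $m$-th roots of unity, $\mathcal R=\bigcup_m\mathcal R_m$. $B_r$ is the Banach space of bounded holomorphic functions on $\{|z|<r\}$ vanishing at $0$ (sup norm). The Hadamard product is $(\sum_{n\ge0} A_nz^n)\odot(\sum_{n\ge0} B_nz^n)=\sum_{n\ge0} A_nB_nz^n$. For $g=\sum_{n\ge1}g_nz^n\in B_r$, $f_g(q,z)=\sum_{n\ge1}g_n\frac{z^n}{q^n-1}$ for $q\in\mathbb D\cup\mathbb E$, $|z|<r$; in particular $f_g(0,1)=-g(1)$ is a constant. At $q=0$, $\chi(q,1)$ is understood by continuity. $\chi$ is regarded as a function of $q$ with values in spaces of functions of $z$. **Diophantine points.** $\underline{\mathrm{DC}}_2$ is the set of $e^{2\pi iy}$, $y\in\mathbb R\setminus\mathbb Q$, for which there is $\gamma>0$ with $|y-n/m|\ge\gamma m^{-2}$ for all rationals $n/m$ ($m\ge1$). **Gevrey classes.** For $\lambda\in\mathbb S^1$, $\sigma>0$ and a Banach space $B$, $\mathcal G^+_\sigma(\lambda,B)$ is the space of $B$-valued functions $f$ for which there are an open disk $\Delta\subset\mathbb E$ tangent to $\mathbb S^1$ at $\lambda$ on which $f$ is holomorphic, a formal series $\sum a_nQ^n\in B[[Q]]$ and $c_0,c_1>0$ with $\|f(q)-\sum_{n<N}a_n(q-\lambda)^n\|\le c_0c_1^N\Gamma(1+N\sigma)|q-\lambda|^N$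 for all $N\ge0$, $q\in\Delta$. $\mathcal G_\sigma(\lambda,B)$ is the space of functions $f$ satisfying this both on a disk $\Delta^-\subset\mathbb D$ and on a disk $\Delta^+\subset\mathbb E$ tangent to $\mathbb S^1$ at $\lambda$, with the same series, which is the asymptotic expansion of $f$ at $\lambda$. **Cardioid classes.** $\mathcal G^<_\sigma(\lambda,B)$ (resp. $\mathcal G^>_\sigma(\lambda,B)$) is the space of $B$-valued functions $f$ such that $u\mapsto f(\lambda(1+i(u-1)^2))$ (resp. $u\mapsto f(\lambda(1-i(u-1)^2))$) defines a function of $\mathcal G^+_\sigma(1,B)$. **The functions $\delta^<_\lambda,\delta^>_\lambda$.** Write $\lambda=e^{2\pi i\alpha}$, $\mathbb S^<_\lambda=\{e^{2\pi ix}:x\in\,]\alpha-\frac12,\alpha[\}$, $\mathbb S^>_\lambda=\{e^{2\pi ix}:x\in\,]\alpha,\alpha+\frac12[\}$. For $\bullet\in\{<,>\}$ put $\delta^\bullet_{n,\ell}=\frac1n\sum_{\Lambda\in\mathcal R_n\cap\mathbb S^\bullet_\lambda}\Lambda^{-\ell}$ ($n\ge1$, $0\le\ell\le n-1$) and let $\delta^\bullet_\lambda(q)$ be the power series in $z$ given by $\delta^\bullet_\lambda(q)(z)=\sum_{\ell\ge0,\,n\ge\ell+1}\delta^\bullet_{n,\ell}\,q^\ell z^n$. **The space $\mathcal G^\odot$.** $\mathcal G^\odot_\sigma(\lambda,B_r)$ is the subspace of $\mathcal G_{2\sigma}(\lambda,B_r)$ consisting of the functions $f$ such that $q\mapsto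 f(q)\odot\delta^<_\lambda(q)$ extends to a function of $\mathcal G^<_\sigma(\lambda,B_r)$ and $q\mapsto f(q)\odot\delta^>_\lambda(q)$ extends to a function of $\mathcal G^>_\sigma(\lambda,B_r)$. **Quasianalyticity.** A space of functions is quasianalytic at a point $\lambda$ if all its members admit an asymptotic expansion at $\lambda$ and any two of its members with the same asymptotic expansion at $\lambda$ coincide (for the spaces here: coincide near $\lambda$, on open disks $\Delta^-\subset\mathbb D$ and $\Delta^+\subset\mathbb E$ tangent to $\mathbb S^1$ at $\lambda$). For $(q-\Lambda_0)^{-1}\mathcal G_1(\Lambda_0,\mathbb C)$, the space of functions $f$ with $(q-\Lambda_0)f\in\mathcal G_1(\Lambda_0,\mathbb C)$, the expansion is the Laurent series $(q-\Lambda_0)^{-1}$ times the expansion of $(q-\Lambda_0)f$.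
   Formalization: In ii), χ(q,0)=g(1)/q≠0, so χ is not B_{r'}-valued; proved instead: χ is in G^⊙_1 over bounded holomorphic functions on |z|<r' (no vanishing at 0), χ−g(1)/q is in G^⊙_1(λ,B_{r'}), and the latter space is quasianalytic. *)

theory Defs
  imports "HOL-Complex_Analysis.Complex_Analysis"
begin

text \<open>
  A complex normed space is given by data on an ambient additive group, so that the radius
  \<open>r\<close> of the spaces \<open>B_r\<close> below can be an ordinary variable.
\<close>

record 'v cspace =
  vecs :: "'v set"
  vscale :: "complex \<Rightarrow> 'v \<Rightarrow> 'v"
  vnorm :: "'v \<Rightarrow> real"

definition complex_space :: "complex cspace" where
  "complex_space = \<lparr>vecs = UNIV, vscale = (*), vnorm = cmod\<rparr>"

text \<open>
  Holomorphic functions of \<open>z\<close> on the disk of radius \<open>r\<close> are identified with their Taylor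
  series at 0.  Inclusions between these spaces for different \<open>r\<close> are then set inclusions.
  \<open>B_space r\<close> is the space \<open>B_r\<close>; \<open>H_space r\<close> drops the condition of vanishing at 0, which
  \<open>chi\<close> below does not satisfy: its constant term in \<open>z\<close> is \<open>g(1) / q\<close>.
\<close>

definition sup_norm :: "real \<Rightarrow> complex fps \<Rightarrow> real" where
  "sup_norm r F = (SUP z\<in>ball 0 r. cmod (eval_fps F z))"

definition H_space :: "real \<Rightarrow> complex fps cspace" where
  "H_space r = \<lparr>vecs = {fps_expansion h 0 | h. h holomorphic_on ball 0 r \<and> bounded (h ` ball 0 r)},
                vscale = (\<lambda>c F. fps_const c * F), vnorm = sup_norm r\<rparr>"

definition B_space :: "real \<Rightarrow> complex fps cspace" where
  "B_space r = \<lparr>vecs = {fps_expansion h 0 | h. h holomorphic_on ball 0 r \<and> bounded (h ` ball 0 r)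
                          \<and> h 0 = 0},
                vscale = (\<lambda>c F. fps_const c * F), vnorm = sup_norm r\<rparr>"

lemma vecs_H_space_iff:
  assumes "r > 0"
  shows "F \<in> vecs (H_space r) \<longleftrightarrow>
           fps_conv_radius F \<ge> ereal r \<and> bounded (eval_fps F ` ball 0 r)"
proof
  assume "F \<in> vecs (H_space r)"
  then obtain h where h: "F = fps_expansion h 0" "h holomorphic_on ball 0 r"
      "bounded (h ` ball 0 r)"
    by (auto simp: H_space_def)
  have hol: "h holomorphic_on eball 0 (ereal r)"
    using h(2) by simp
  have rad: "fps_conv_radius F \<ge> ereal r"
    unfolding h(1) using conv_radius_fps_expansion[OF hol] .
  have "eval_fps F z = h z" if "z \<in> ball 0 r" for z
    unfolding h(1) using eval_fps_expansion[OF hol, of z] that by simp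
  hence "eval_fps F ` ball 0 r = h ` ball 0 r" by (intro image_cong) auto
  with rad h(3) show "fps_conv_radius F \<ge> ereal r \<and> bounded (eval_fps F ` ball 0 r)" by simp
next
  assume F: "fps_conv_radius F \<ge> ereal r \<and> bounded (eval_fps F ` ball 0 r)"
  have "ball (0::complex) r \<subseteq> eball 0 (fps_conv_radius F)"
  proof
    fix z :: complex assume "z \<in> ball 0 r"
    hence "ereal (dist 0 z) < ereal r" by simp
    also have "\<dots> \<le> fps_conv_radius F" using F by simp
    finally show "z \<in> eball 0 (fps_conv_radius F)" by (simp add: eball_def)
  qed
  hence "eval_fps F holomorphic_on ball 0 r"
    by (intro holomorphic_intros) auto
  moreover have "fps_expansion (eval_fps F) 0 = F"
  proof -
    have "0 < fps_conv_radius F"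
      using F assms by (metis ereal_less(2) less_le_trans)
    thus ?thesis by (intro fps_expansion_eqI eval_fps_has_fps_expansion)
  qed
  ultimately show "F \<in> vecs (H_space r)" using F
    unfolding H_space_def by (auto intro!: exI[of _ "eval_fps F"])
qed

lemma vecs_B_space_iff: "F \<in> vecs (B_space r) \<longleftrightarrow> F \<in> vecs (H_space r) \<and> fps_nth F 0 = 0"
  by (auto simp: B_space_def H_space_def fps_expansion_def)

definition hadamard :: "complex fps \<Rightarrow> complex fps \<Rightarrow> complex fps"  (infixl "\<odot>" 70) where
  "F \<odot> H = Abs_fps (\<lambda>n. fps_nth F n * fps_nth H n)"


definition vholomorphic_on :: "'v::ab_group_add cspace \<Rightarrow> (complex \<Rightarrow> 'v) \<Rightarrow> complex set \<Rightarrow> bool" where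
  "vholomorphic_on B f S \<longleftrightarrow>
     (\<forall>q\<in>S. f q \<in> vecs B \<and>
        (\<exists>D\<in>vecs B. ((\<lambda>p. vnorm B (vscale B (inverse (p - q)) (f p - f q) - D)) \<longlongrightarrow> 0)
                       (at q within S)))"

text \<open>The open disks tangent to the unit circle at \<open>\<xi>\<close>, outside resp. inside the unit disk.\<close>

definition outer_disks :: "complex \<Rightarrow> complex set set" where
  "outer_disks \<xi> = {ball (of_real (1 + \<rho>) * \<xi>) \<rho> | \<rho>. 0 < \<rho>}"

definition inner_disks :: "complex \<Rightarrow> complex set set" where
  "inner_disks \<xi> = {ball (of_real (1 - \<rho>) * \<xi>) \<rho> | \<rho>. 0 < \<rho> \<and> \<rho> < 1}"

definition coincide_near :: "complex \<Rightarrow> (complex \<Rightarrow> 'v) \<Rightarrow> (complex \<Rightarrow> 'v) \<Rightarrow> bool" where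
  "coincide_near \<xi> f h \<longleftrightarrow>
     (\<exists>\<Delta>m\<in>inner_disks \<xi>. \<exists>\<Delta>p\<in>outer_disks \<xi>. \<forall>q\<in>\<Delta>m \<union> \<Delta>p. f q = h q)"

text \<open>
  Functions of \<open>q\<close> are total functions here; their values matter only on the disks involved.
\<close>

definition gevrey_on ::
    "real \<Rightarrow> complex \<Rightarrow> 'v::ab_group_add cspace \<Rightarrow> complex set \<Rightarrow> (complex \<Rightarrow> 'v) \<Rightarrow> (nat \<Rightarrow> 'v) \<Rightarrow> bool"
  where
  "gevrey_on \<sigma> \<xi> B \<Delta> f a \<longleftrightarrow>
     vholomorphic_on B f \<Delta> \<and> (\<forall>n. a n \<in> vecs B) \<and>
     (\<exists>c0>0. \<exists>c1>0. \<forall>N. \<forall>q\<in>\<Delta>.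
        vnorm B (f q - (\<Sum>n<N. vscale B ((q - \<xi>) ^ n) (a n)))
          \<le> c0 * c1 ^ N * Gamma (1 + real N * \<sigma>) * cmod (q - \<xi>) ^ N)"

definition gevrey_plus :: "real \<Rightarrow> complex \<Rightarrow> 'v::ab_group_add cspace \<Rightarrow> (complex \<Rightarrow> 'v) set" where
  "gevrey_plus \<sigma> \<xi> B = {f. \<exists>a. \<exists>\<Delta>\<in>outer_disks \<xi>. gevrey_on \<sigma> \<xi> B \<Delta> f a}"

definition gevrey_expansion ::
    "real \<Rightarrow> complex \<Rightarrow> 'v::ab_group_add cspace \<Rightarrow> (complex \<Rightarrow> 'v) \<Rightarrow> (nat \<Rightarrow> 'v) \<Rightarrow> bool" where
  "gevrey_expansion \<sigma> \<xi> B f a \<longleftrightarrow>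
     (\<exists>\<Delta>m\<in>inner_disks \<xi>. gevrey_on \<sigma> \<xi> B \<Delta>m f a) \<and>
     (\<exists>\<Delta>p\<in>outer_disks \<xi>. gevrey_on \<sigma> \<xi> B \<Delta>p f a)"

definition gevrey :: "real \<Rightarrow> complex \<Rightarrow> 'v::ab_group_add cspace \<Rightarrow> (complex \<Rightarrow> 'v) set" where
  "gevrey \<sigma> \<xi> B = {f. \<exists>a. gevrey_expansion \<sigma> \<xi> B f a}"

definition gevrey_lt :: "real \<Rightarrow> complex \<Rightarrow> 'v::ab_group_add cspace \<Rightarrow> (complex \<Rightarrow> 'v) set" where
  "gevrey_lt \<sigma> \<xi> B = {f. (\<lambda>u. f (\<xi> * (1 + \<i> * (u - 1)\<^sup>2))) \<in> gevrey_plus \<sigma> 1 B}"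

definition gevrey_gt :: "real \<Rightarrow> complex \<Rightarrow> 'v::ab_group_add cspace \<Rightarrow> (complex \<Rightarrow> 'v) set" where
  "gevrey_gt \<sigma> \<xi> B = {f. (\<lambda>u. f (\<xi> * (1 - \<i> * (u - 1)\<^sup>2))) \<in> gevrey_plus \<sigma> 1 B}"

definition polar_gevrey :: "real \<Rightarrow> complex \<Rightarrow> (complex \<Rightarrow> complex) set" where
  "polar_gevrey \<sigma> \<xi> = {f. (\<lambda>q. (q - \<xi>) * f q) \<in> gevrey \<sigma> \<xi> complex_space}"

definition polar_gevrey_expansion ::
    "real \<Rightarrow> complex \<Rightarrow> (complex \<Rightarrow> complex) \<Rightarrow> complex fls \<Rightarrow> bool" where
  "polar_gevrey_expansion \<sigma> \<xi> f L \<longleftrightarrow>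
     (\<exists>a. gevrey_expansion \<sigma> \<xi> complex_space (\<lambda>q. (q - \<xi>) * f q) a \<and>
          L = fls_X_inv * fps_to_fls (Abs_fps a))"

definition quasianalytic ::
    "complex \<Rightarrow> (complex \<Rightarrow> 'v) set \<Rightarrow> ((complex \<Rightarrow> 'v) \<Rightarrow> 'e \<Rightarrow> bool) \<Rightarrow> bool" where
  "quasianalytic \<xi> \<F> has_exp \<longleftrightarrow>
     (\<forall>f\<in>\<F>. \<exists>a. has_exp f a) \<and>
     (\<forall>f\<in>\<F>. \<forall>h\<in>\<F>. \<forall>a. has_exp f a \<longrightarrow> has_exp h a \<longrightarrow> coincide_near \<xi> f h)"


definition roots_of_unity :: "nat \<Rightarrow> complex set" where
  "roots_of_unity m = {\<Lambda>. \<Lambda> ^ m = 1}"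

definition primitive_roots :: "nat \<Rightarrow> complex set" where
  "primitive_roots m = {\<Lambda>. \<Lambda> ^ m = 1 \<and> (\<forall>k. 0 < k \<and> k < m \<longrightarrow> \<Lambda> ^ k \<noteq> 1)}"

definition all_roots_of_unity :: "complex set" where
  "all_roots_of_unity = (\<Union>m\<in>{1..}. roots_of_unity m)"

definition DC2 :: "complex set" where
  "DC2 = {cis (2 * pi * y) | y. y \<notin> \<rat> \<and>
            (\<exists>\<gamma>>0. \<forall>n::int. \<forall>m::nat. m \<ge> 1 \<longrightarrow> \<bar>y - of_int n / real m\<bar> \<ge> \<gamma> / (real m)\<^sup>2)}"

definition arc_lt :: "complex \<Rightarrow> complex set" where
  "arc_lt \<xi> = {cis (2 * pi * x) | x \<alpha>. \<xi> = cis (2 * pi * \<alpha>) \<and> \<alpha> - 1/2 < x \<and> x < \<alpha>}"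

definition arc_gt :: "complex \<Rightarrow> complex set" where
  "arc_gt \<xi> = {cis (2 * pi * x) | x \<alpha>. \<xi> = cis (2 * pi * \<alpha>) \<and> \<alpha> < x \<and> x < \<alpha> + 1/2}"

definition delta_coeff :: "complex set \<Rightarrow> nat \<Rightarrow> nat \<Rightarrow> complex" where
  "delta_coeff A n l = (1 / of_nat n) * (\<Sum>\<Lambda>\<in>roots_of_unity n \<inter> A. \<Lambda> powi (- int l))"

definition delta :: "complex set \<Rightarrow> complex \<Rightarrow> complex fps" where
  "delta A q = Abs_fps (\<lambda>n. \<Sum>l<n. delta_coeff A n l * q ^ l)"

text \<open>
  ``Extends to a function of \<open>\<G>\<^sup><\<close>'': the function \<open>h\<close> below agrees with the Hadamard product
  on tangent disks and is Gevrey on a cardioid at \<open>\<xi>\<close> that need not contain these disks.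
\<close>

definition gevrey_odot :: "real \<Rightarrow> complex \<Rightarrow> complex fps cspace \<Rightarrow> (complex \<Rightarrow> complex fps) set" where
  "gevrey_odot \<sigma> \<xi> B =
     {f \<in> gevrey (2 * \<sigma>) \<xi> B.
        (\<exists>h\<in>gevrey_lt \<sigma> \<xi> B. coincide_near \<xi> h (\<lambda>q. f q \<odot> delta (arc_lt \<xi>) q)) \<and>
        (\<exists>h\<in>gevrey_gt \<sigma> \<xi> B. coincide_near \<xi> h (\<lambda>q. f q \<odot> delta (arc_gt \<xi>) q))}"


definition f_ser :: "complex fps \<Rightarrow> complex \<Rightarrow> complex fps" where
  "f_ser g q = Abs_fps (\<lambda>n. if n = 0 then 0 else fps_nth g n / (q ^ n - 1))"

text \<open>The value of \<open>chi g\<close> at \<open>q = 0\<close> is meaningless.\<close>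

definition chi :: "complex fps \<Rightarrow> complex \<Rightarrow> complex fps" where
  "chi g q = fps_const (inverse q) * (f_ser g q - fps_const (eval_fps (f_ser g 0) 1))"

definition G_term :: "complex \<Rightarrow> nat \<Rightarrow> complex" where
  "G_term q m = (\<Sum>\<Lambda>\<in>primitive_roots m. of_real (exp (- real m)) / (q - \<Lambda>))"

definition G :: "complex \<Rightarrow> complex" where
  "G q = (\<Sum>m. G_term q (m + 2))"

lemma summable_G_term:
  assumes "cmod q \<noteq> 1"
  shows "summable (\<lambda>m. G_term q (m + 2))"
proof -
  define d where "d = \<bar>cmod q - 1\<bar>"
  have d: "d > 0" using assms by (simp add: d_def)
  have bound: "norm (G_term q (m + 2)) \<le> (real m + 2) * exp (-1) ^ (m + 2) / d" for m
  proof -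
    have "primitive_roots (m + 2) \<subseteq> {z. z ^ (m + 2) = 1}"
      by (auto simp: primitive_roots_def)
    moreover have fin: "finite {z::complex. z ^ (m + 2) = 1}"
      by (rule finite_nth_roots) simp
    ultimately have "card (primitive_roots (m + 2)) \<le> card {z::complex. z ^ (m + 2) = 1}"
      by (intro card_mono)
    hence card: "card (primitive_roots (m + 2)) \<le> m + 2"
      using card_nth_roots[of 1 "m + 2"] by simp
    have "norm (of_real (exp (- real (m + 2))) / (q - \<Lambda>)) \<le> exp (-1) ^ (m + 2) / d"
      if "\<Lambda> \<in> primitive_roots (m + 2)" for \<Lambda>
    proof -
      have "\<Lambda> ^ (m + 2) = 1" using that by (simp add: primitive_roots_def)
      hence "cmod \<Lambda> = 1" using power_eq_1_iff[of \<Lambda> "m + 2"] by simp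
      hence "d \<le> cmod (q - \<Lambda>)" unfolding d_def by (metis norm_triangle_ineq3)
      moreover have "exp (- real (m + 2)) = exp (-1) ^ (m + 2)"
        using exp_of_nat_mult[of "m + 2" "-1::real"] by simp
      moreover have "norm (complex_of_real (exp (- real (m + 2))) / (q - \<Lambda>)) =
                       exp (- real (m + 2)) / cmod (q - \<Lambda>)"
        by (simp add: norm_divide del: of_nat_add)
      ultimately show ?thesis using d by (simp only:) (rule frac_le, auto)
    qed
    hence "norm (G_term q (m + 2)) \<le> of_nat (card (primitive_roots (m + 2))) * (exp (-1) ^ (m + 2) / d)"
      unfolding G_term_def by (intro sum_norm_bound) auto
    also have "\<dots> \<le> (real m + 2) * (exp (-1) ^ (m + 2) / d)"
      using card d by (intro mult_right_mono) auto
    finally show ?thesis by simp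
  qed
  have "summable (\<lambda>m. (real m + 2) * exp (-1) ^ (m + 2) / d)"
  proof -
    have "summable (\<lambda>n. of_nat (Suc n) * exp (-1::real) ^ n)"
      using geometric_deriv_sums[of "exp (-1::real)"] by (simp add: sums_iff)
    hence "summable (\<lambda>m. of_nat (Suc (m + 1)) * exp (-1::real) ^ (m + 1) * (exp (-1) / d))"
      by (intro summable_mult2 summable_ignore_initial_segment)
    thus ?thesis by (simp add: mult_ac add_ac)
  qed
  thus ?thesis by (rule summable_comparison_test'[where N=0]) (use bound in auto)
qed

end

theory Submission
  imports Defs
begin

text \<open>
  Partial fractions of \<open>1 / (q\<^sup>n - 1)\<close> turn the \<open>n\<close>-th coefficient of \<open>chi g\<close> into a sum of simple
  poles \<open>1 / (q - \<Lambda>)\<close> over the \<open>n\<close>-th roots of unity, and Moebius inversion yields the \<open>g\<close> of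
  exponential decay for which \<open>chi g q\<close> at \<open>z = 1\<close> is \<open>G q\<close>.  The factor \<open>\<odot> delta\<close> selects the
  poles on one of the two arcs at \<open>\<xi>\<close>.

  On a disk tangent to the circle at \<open>\<xi>\<close> one has \<open>\<bar>q - \<Lambda>\<bar> \<ge> c \<bar>\<Lambda> - \<xi>\<bar>\<^sup>2\<close>, and \<open>\<bar>\<Lambda> - \<xi>\<bar>\<close> is at least
  \<open>c / n\<close> for a root of unity \<open>\<xi>\<close> and \<open>c / n\<^sup>2\<close> for \<open>\<xi> \<in> DC2\<close>.  The geometric remainders then
  grow like \<open>n\<^sup>N\<close> resp. \<open>n\<^sup>2\<^sup>N\<close>, and summing them against the exponential weights produces
  \<open>N!\<close> resp. \<open>(2N)!\<close>.  In the square root coordinate of the cardioid the poles on the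
  selected arc are at distance \<open>\<ge> c / n\<close> from the base point, which restores \<open>N!\<close>.

  Quasianalyticity in the Gevrey 1 case is Watson's lemma: a null function is \<open>O(exp (-c / \<bar>q - \<xi>\<bar>))\<close>
  on a tangent disk, i.e. \<open>O(exp (-c \<bar>w\<bar>))\<close> on a half plane, and vanishes by the maximum principle.
  For \<open>gevrey_odot\<close> it is applied to each coefficient in \<open>z\<close> on both cardioids.
\<close>

section \<open>Watson's lemma on a tangent disk\<close>

text \<open>The constant term of chi in z is g(1) / q, so chi lies in \<open>H_space\<close> and
  only chi minus this term lies in \<open>B_space\<close>. Both memberships are proved, but
  uniqueness belongs to \<open>B_space\<close>: \<open>delta\<close> has no constant term, so the
  cardioid conditions leave the coefficient of z^0 free, and order 2 on tangent disks alone admits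
  flat functions such as exp (-x^(-1/2)) with x = (q - \<xi>) / \<xi> on an outer disk. All
  memberships are instances of one statement about series with coefficients w_n \<phi>_n(q), where
  w_n r^n is geometrically small and \<phi>_n has geometric Taylor remainders whose constants are
  polynomial in n. The scalar function G is brought into this form by an auxiliary variable z: it is
  the value at z = 1 of the series whose n-th coefficient collects the poles at the primitive n-th
  roots. The radius is r = 2 because the coefficients decay like e^(-n) and 2 / e < 1.\<close>

lemma Im_Ln_bound:
  assumes "0 < Re z" "0 \<le> Im z"
  shows "0 \<le> Im (Ln z) \<and> Im (Ln z) \<le> pi / 2"
proof -
  have z: "z \<noteq> 0" using assms by auto
  have "\<bar>Im (Ln z)\<bar> < pi / 2" using Re_Ln_pos_lt[OF z] assms by simp
  moreover have "0 \<le> Im (Ln z)" using Im_Ln_pos_le[OF z] assms by simp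
  ultimately show ?thesis by simp
qed

text \<open>
  The exponent has real part at most \<open>k \<bar>y\<bar> \<pi> / 2\<close> on the imaginary axis and is bounded on the
  half plane for fixed \<open>R\<close>, but tends to infinity with \<open>R\<close> at each point of the positive axis.
\<close>

lemma half_plane_exponent_imaginary:
  assumes "R \<ge> 1"
  shows "Re (\<i> * of_real y * (Ln (\<i> * of_real y + of_real R) - Ln (\<i> * of_real y + 1)))
           \<le> \<bar>y\<bar> * (pi / 2)"
proof (cases "y \<ge> 0")
  case True
  have a: "0 \<le> Im (Ln (\<i> * of_real y + of_real R))"
    using Im_Ln_bound[of "\<i> * of_real y + of_real R"] assms True by simp
  have b: "Im (Ln (\<i> * of_real y + 1)) \<le> pi / 2"
    using Im_Ln_bound[of "\<i> * of_real y + 1"] True by simp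
  have "Re (\<i> * of_real y * (Ln (\<i> * of_real y + of_real R) - Ln (\<i> * of_real y + 1)))
     = y * (Im (Ln (\<i> * of_real y + 1)) - Im (Ln (\<i> * of_real y + of_real R)))"
    by (simp add: algebra_simps)
  also have "\<dots> \<le> y * (pi / 2)" using a b True by (intro mult_left_mono) auto
  finally show ?thesis using True by simp
next
  case False
  have c: "Im (Ln (cnj z)) = - Im (Ln z)" if "Re z > 0" for z
    using cnj_Ln[of z] that complex_nonpos_Reals_iff by (metis complex_cnj_cancel_iff cnj.simps(2) not_less)
  have "0 \<le> Im (Ln (cnj (\<i> * of_real y + of_real R)))"
    using Im_Ln_bound[of "cnj (\<i> * of_real y + of_real R)"] assms False by simp
  hence a: "Im (Ln (\<i> * of_real y + of_real R)) \<le> 0"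
    using c[of "\<i> * of_real y + of_real R"] assms by simp
  have "Im (Ln (cnj (\<i> * of_real y + 1))) \<le> pi / 2"
    using Im_Ln_bound[of "cnj (\<i> * of_real y + 1)"] False by simp
  hence b: "- Im (Ln (\<i> * of_real y + 1)) \<le> pi / 2"
    using c[of "\<i> * of_real y + 1"] by simp
  have "Re (\<i> * of_real y * (Ln (\<i> * of_real y + of_real R) - Ln (\<i> * of_real y + 1)))
     = (- y) * (Im (Ln (\<i> * of_real y + of_real R)) - Im (Ln (\<i> * of_real y + 1)))"
    by (simp add: algebra_simps)
  also have "\<dots> \<le> (- y) * (pi / 2)" using a b False by (intro mult_left_mono) auto
  finally show ?thesis using False by simp
qed

lemma norm_add_of_real_ge:
  assumes "0 \<le> Re w" "0 \<le> t"
  shows "cmod w \<le> cmod (w + of_real t)"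
proof -
  have "(Re w)\<^sup>2 \<le> (Re w + t)\<^sup>2" using assms by (intro power_mono) auto
  thus ?thesis unfolding cmod_def by simp
qed

text \<open>The mean value inequality for Ln along the horizontal segment from w + 1 to w + R, which
  stays at modulus at least |w|: the derivative is at most 1 / |w|, and this cancels the factor w.
  On a large arc the exponent is thus negligible against c |w|.\<close>

lemma half_plane_exponent_bounded:
  assumes "R \<ge> 1" "0 \<le> Re w" "w \<noteq> 0"
  shows "cmod (w * (Ln (w + of_real R) - Ln (w + 1))) \<le> R - 1"
proof -
  define S where "S = closed_segment (w + 1) (w + of_real R)"
  have S: "\<exists>t. z = w + of_real t \<and> t \<ge> 1" if "z \<in> S" for z
  proof -
    from that obtain u where u: "0 \<le> u" "u \<le> 1" "z = (1 - u) *\<^sub>R (w + 1) + u *\<^sub>R (w + of_real R)"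
      unfolding S_def closed_segment_def by blast
    have "z = w + of_real (1 + u * (R - 1))" using u(3)
      by (simp add: scaleR_conv_of_real algebra_simps)
    thus ?thesis using u assms by (intro exI[of _ "1 + u * (R - 1)"]) simp
  qed
  have "cmod (Ln (w + of_real R) - Ln (w + 1)) \<le> (1 / cmod w) * cmod ((w + of_real R) - (w + 1))"
  proof (rule field_differentiable_bound[of S Ln "\<lambda>z. inverse z"])
    show "convex S" unfolding S_def by simp
    fix z assume z: "z \<in> S"
    then obtain t where t: "z = w + of_real t" "t \<ge> 1" using S by blast
    show "(Ln has_field_derivative inverse z) (at z within S)"
      using t assms by (intro has_field_derivative_Ln[THEN DERIV_subset] ) (auto simp: complex_nonpos_Reals_iff)
    show "cmod (inverse z) \<le> 1 / cmod w"
      using norm_add_of_real_ge[OF assms(2), of t] t assms(3)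
      by (simp add: norm_inverse inverse_eq_divide norm_divide frac_le)
  qed (auto simp: S_def)
  also have "cmod ((w + of_real R) - (w + 1)) = R - 1"
    using assms(1) by (metis abs_of_nonneg add_diff_cancel_left diff_ge_0_iff_ge norm_of_real of_real_1 of_real_diff)
  finally show ?thesis using assms(3) by (simp add: norm_mult pos_le_divide_eq mult.commute)
qed

text \<open>F is multiplied by the exponential of k w (Ln (w + R) - Ln (w + 1)). The product is
  bounded by C on the boundary of a large half disk, hence at x > 0, uniformly in R; letting R tend
  to infinity forces F(x) = 0.\<close>

lemma half_plane_decay_imp_zero:
  assumes hol: "F holomorphic_on {w. Re w > -d}" and d: "d > 0" and c: "c > 0"
    and bd: "\<And>w. Re w \<ge> 0 \<Longrightarrow> cmod (F w) \<le> C * exp (- c * cmod w)"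
    and w: "Re w > -d"
  shows "F w = 0"
proof -
  \<comment> \<open>With k pi / 2 = c the growth of the multiplier on the imaginary axis is exactly
    compensated by the decay of F.\<close>
  define k where "k = 2 * c / pi"
  have k: "k > 0" using c by (simp add: k_def)
  have kpi: "k * pi = 2 * c" by (simp add: k_def)
  have C: "C \<ge> 0" using bd[of 0] by simp (metis norm_ge_zero order_trans)
  have est: "cmod (F (of_real x)) * exp (k * x * (ln (x + R) - ln (x + 1))) \<le> C"
    if x: "x > 0" and R: "R \<ge> 1" for x R :: real
  proof -
    define E where "E = (\<lambda>w. of_real k * (w * (Ln (w + of_real R) - Ln (w + 1))))"
    define H where "H = (\<lambda>w. F w * exp (E w))"
    \<comment> \<open>The half disk has to contain x, and its arc has to be so far out that the
      bound k (R - 1) of the exponent is at most c L.\<close>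
    define L where "L = max (x + 1) (k * (R - 1) / c)"
    have L: "L > x" "L > 0" using x by (auto simp: L_def)
    have "k * (R - 1) / c \<le> L" by (simp add: L_def)
    hence L2: "k * (R - 1) \<le> c * L" using c by (simp add: field_simps)
    define S where "S = {w. Re w > 0} \<inter> ball (0::complex) L"
    have opS: "open S" unfolding S_def by (intro open_Int open_halfspace_Re_gt) auto
    have "closed ({w. Re w \<ge> 0} \<inter> cball (0::complex) L)"
      by (intro closed_Int closed_halfspace_Re_ge) auto
    hence clS: "closure S \<subseteq> {w. Re w \<ge> 0} \<inter> cball 0 L"
      by (intro closure_minimal) (auto simp: S_def)
    have frS: "frontier S \<subseteq> {w. Re w \<ge> 0 \<and> cmod w \<le> L \<and> (Re w = 0 \<or> cmod w = L)}"
    proof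
      fix v assume v: "v \<in> frontier S"
      hence "v \<notin> S" using opS by (simp add: frontier_def interior_open)
      moreover have "v \<in> closure S" using v by (simp add: frontier_def)
      ultimately show "v \<in> {w. Re w \<ge> 0 \<and> cmod w \<le> L \<and> (Re w = 0 \<or> cmod w = L)}"
        using clS by (auto simp: S_def)
    qed
    \<comment> \<open>Re w > -1 keeps w + 1 and w + R off the branch cut of Ln.\<close>
    have holH: "H holomorphic_on {w. Re w > - min d 1}"
      unfolding H_def E_def
      by (intro holomorphic_intros holomorphic_on_subset[OF hol])
         (use R in \<open>auto simp: complex_nonpos_Reals_iff\<close>)
    have sub: "closure S \<subseteq> {w. Re w > - min d 1}"
    proof
      fix v assume "v \<in> closure S"
      hence "Re v \<ge> 0" using clS by auto
      thus "v \<in> {w. Re w > - min d 1}" using d by auto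
    qed
    have "cmod (H (of_real x)) \<le> C"
    proof (rule maximum_modulus_frontier[of H S])
      show "H holomorphic_on interior S"
        using holH sub interior_subset closure_subset by (meson holomorphic_on_subset order_trans)
      show "continuous_on (closure S) H"
        using holH sub by (meson continuous_on_subset holomorphic_on_imp_continuous_on)
      show "bounded S" unfolding S_def by (meson bounded_Int bounded_ball)
      show "of_real x \<in> S" using x L by (auto simp: S_def)
      fix v assume "v \<in> frontier S"
      hence v: "Re v \<ge> 0" "Re v = 0 \<or> cmod v = L" using frS by auto
      have "Re (E v) \<le> c * cmod v"
      proof (cases "Re v = 0")
        case True
        define y where "y = Im v"
        have vy: "v = \<i> * of_real y" using True by (simp add: y_def complex_eq_iff)
        have "Re (E v) = k * Re (\<i> * of_real y * (Ln (\<i> * of_real y + of_real R) - Ln (\<i> * of_real y + 1)))"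
          unfolding E_def vy by (simp add: algebra_simps)
        also have "\<dots> \<le> k * (\<bar>y\<bar> * (pi / 2))"
          using half_plane_exponent_imaginary[OF R, of y] k by (intro mult_left_mono) auto
        also have "\<dots> = c * \<bar>y\<bar>" using kpi by (simp add: algebra_simps)
        finally show ?thesis using vy by (simp add: norm_mult)
      next
        case False
        hence v2: "cmod v = L" "v \<noteq> 0" using v by auto
        have "Re (E v) \<le> cmod (E v)" by (rule complex_Re_le_cmod)
        also have "\<dots> = k * cmod (v * (Ln (v + of_real R) - Ln (v + 1)))"
          unfolding E_def using k by (simp add: norm_mult)
        also have "\<dots> \<le> k * (R - 1)"
          using half_plane_exponent_bounded[OF R v(1) v2(2)] k by (intro mult_left_mono) auto
        finally show ?thesis using L2 v2 by simp
      qed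
      have "cmod (H v) = cmod (F v) * exp (Re (E v))" by (simp add: H_def norm_mult)
      also have "\<dots> \<le> (C * exp (- c * cmod v)) * exp (c * cmod v)"
        using bd[OF v(1)] \<open>Re (E v) \<le> c * cmod v\<close> C by (intro mult_mono) auto
      also have "\<dots> = C" by (simp add: exp_minus)
      finally show "cmod (H v) \<le> C" .
    qed
    moreover have "E (of_real x) = of_real (k * x * (ln (x + R) - ln (x + 1)))"
      unfolding E_def using x R by (simp add: Ln_of_real[symmetric])
    ultimately show ?thesis by (simp add: H_def norm_mult)
  qed
  have zero: "F (of_real x) = 0" if x: "x > 0" for x :: real
  proof (rule ccontr)
    assume nz: "F (of_real x) \<noteq> 0"
    define B where "B = C / cmod (F (of_real x))"
    have "filterlim (\<lambda>R. exp (k * x * (ln (x + R) - ln (x + 1)))) at_top at_top"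
    proof -
      have "filterlim (\<lambda>R. x + R) at_top at_top"
        by (rule filterlim_tendsto_add_at_top[OF tendsto_const filterlim_ident])
      hence "filterlim (\<lambda>R. ln (x + R)) at_top at_top"
        by (rule filterlim_compose[OF ln_at_top])
      hence "filterlim (\<lambda>R. - ln (x + 1) + ln (x + R)) at_top at_top"
        by (rule filterlim_tendsto_add_at_top[OF tendsto_const])
      hence "filterlim (\<lambda>R. k * x * (- ln (x + 1) + ln (x + R))) at_top at_top"
        using k x by (intro filterlim_tendsto_pos_mult_at_top[OF tendsto_const]) auto
      thus ?thesis by (intro filterlim_compose[OF exp_at_top]) simp
    qed
    hence "\<forall>\<^sub>F R in at_top. exp (k * x * (ln (x + R) - ln (x + 1))) > B \<and> R \<ge> 1"
      by (simp add: filterlim_at_top_dense eventually_conj_iff eventually_ge_at_top)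
    then obtain R where R: "exp (k * x * (ln (x + R) - ln (x + 1))) > B" "R \<ge> 1"
      by (metis (mono_tags, lifting) eventually_at_top_linorder order_refl)
    have "B * cmod (F (of_real x)) < C"
      using est[OF x R(2)] R(1) nz by (smt (verit) mult.commute mult_strict_right_mono zero_less_norm_iff)
    thus False using nz by (simp add: B_def)
  qed
  have cv: "convex {w. Re w > -d}"
    by (rule convex_halfspace_Re_gt)
  show ?thesis
  proof (rule analytic_continuation[of F "{w. Re w > -d}" "of_real ` {0<..}" 1])
    show "open {w. Re w > -d}" by (rule open_halfspace_Re_gt)
    show "connected {w. Re w > -d}" by (rule convex_connected[OF cv])
    show "(1::complex) islimpt of_real ` {0<..}"
      unfolding islimpt_approachable
    proof (intro allI impI)
      fix e :: real assume "e > 0"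
      hence "dist (of_real (1 + e / 2) :: complex) 1 < e" "(of_real (1 + e / 2) :: complex) \<noteq> 1"
        by (auto simp: dist_norm simp flip: of_real_divide)
      moreover have "(of_real (1 + e / 2) :: complex) \<in> of_real ` {0<..}"
        using \<open>e > 0\<close> by (intro imageI) auto
      ultimately show "\<exists>x'\<in>of_real ` {0<..}. x' \<noteq> (1::complex) \<and> dist x' 1 < e" by blast
    qed
  qed (use hol w zero d in auto)
qed

text \<open>Optimal truncation: for N about 1 / (2 c1 t) the bound N! \<le> N^N makes N! (c1 t)^N at
  most 2^(-N). The leading factor 2 pays for rounding N down to an integer.\<close>

lemma factorial_decay_imp_exp_decay:
  assumes c1: "c1 > 0" and t: "t > (0::real)"
    and bd: "\<And>N. y \<le> c0 * c1 ^ N * fact N * t ^ N" and c0: "c0 \<ge> 0"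
  shows "y \<le> 2 * c0 * exp (- (ln 2 / (2 * c1)) * (1 / t))"
proof -
  define N where "N = nat \<lfloor>1 / (2 * c1 * t)\<rfloor>"
  have "1 / (2 * c1 * t) \<ge> 0" using c1 t by simp
  hence N: "real N \<le> 1 / (2 * c1 * t)" "1 / (2 * c1 * t) - 1 \<le> real N"
    unfolding N_def by linarith+
  have "fact N * (c1 * t) ^ N \<le> (real N * (c1 * t)) ^ N"
    using c1 t fact_le_power[where 'a = real and n = N] by (simp add: power_mult_distrib mult_right_mono)
  also have "\<dots> \<le> (1 / 2) ^ N"
  proof (rule power_mono)
    show "real N * (c1 * t) \<le> 1 / 2" using N(1) c1 t by (simp add: field_simps)
  qed (use c1 t in auto)
  also have "(1 / 2 :: real) ^ N = exp (- ln 2 * real N)"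
    by (metis exp_ln exp_minus exp_of_nat2_mult inverse_eq_divide zero_less_numeral)
  also have "\<dots> \<le> exp (- ln 2 * (1 / (2 * c1 * t) - 1))"
    using N(2) by simp
  also have "\<dots> = 2 * exp (- (ln 2 / (2 * c1)) * (1 / t))"
    by (simp add: right_diff_distrib exp_diff exp_minus field_simps)
  finally have "fact N * (c1 * t) ^ N \<le> 2 * exp (- (ln 2 / (2 * c1)) * (1 / t))" .
  hence "c0 * (fact N * (c1 * t) ^ N) \<le> c0 * (2 * exp (- (ln 2 / (2 * c1)) * (1 / t)))"
    using c0 by (rule mult_left_mono)
  thus ?thesis using bd[of N] by (simp add: power_mult_distrib mult_ac)
qed

text \<open>The unit vector e is the inner normal at \<xi>: e = \<xi> gives an outer disk, e =
  -\<xi> an inner one, and \<xi> = e = 1 the disk of the cardioid coordinate.\<close>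

abbreviation tangent_ball :: "complex \<Rightarrow> real \<Rightarrow> complex \<Rightarrow> complex set" where
  "tangent_ball \<xi> \<rho> e \<equiv> ball (\<xi> + of_real \<rho> * e) \<rho>"

text \<open>The inversion w = e / (x - \<xi>) maps the disk onto the half plane Re w > 1 / (2
  \<rho>) and turns |x - \<xi>| into 1 / |w|. Factorial smallness in x becomes exponential decay in
  w.\<close>

lemma watson_disk:
  assumes hol: "f holomorphic_on tangent_ball \<xi> \<rho> e" and e: "cmod e = 1" and \<rho>: "\<rho> > 0"
    and c: "c0 \<ge> 0" "c1 > 0"
    and bd: "\<And>N x. x \<in> tangent_ball \<xi> \<rho> e \<Longrightarrow>
               cmod (f x) \<le> c0 * c1 ^ N * Gamma (1 + real N) * cmod (x - \<xi>) ^ N"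
    and x: "x \<in> tangent_ball \<xi> \<rho> e"
  shows "f x = 0"
proof -
  have e0: "e \<noteq> 0" using e by auto
  define w0 where "w0 = 1 / (2 * \<rho>)"
  have w0: "w0 > 0" "w0 * \<rho> = 1 / 2" using \<rho> by (auto simp: w0_def)
  have ball_iff: "\<xi> + e / w \<in> tangent_ball \<xi> \<rho> e \<longleftrightarrow> Re w > w0" if "w \<noteq> 0" for w
  proof -
    have "dist (\<xi> + of_real \<rho> * e) (\<xi> + e / w) = cmod (e * (of_real \<rho> - 1 / w))"
      by (simp add: dist_norm right_diff_distrib' mult.commute)
    also have "\<dots> = cmod ((of_real \<rho> * w - 1) / w)"
      using that e by (simp add: norm_mult diff_divide_distrib)
    also have "\<dots> = cmod (of_real \<rho> * w - 1) / cmod w" by (rule norm_divide)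
    finally have "\<xi> + e / w \<in> tangent_ball \<xi> \<rho> e \<longleftrightarrow> cmod (of_real \<rho> * w - 1) < \<rho> * cmod w"
      using that by (simp only: mem_ball) (simp add: divide_less_eq)
    also have "\<dots> \<longleftrightarrow> (cmod (of_real \<rho> * w - 1))\<^sup>2 < (\<rho> * cmod w)\<^sup>2"
      using \<rho> by (metis abs_norm_cancel norm_mult norm_of_real order_less_imp_le power2_abs abs_of_pos power_less_imp_less_base power_strict_mono norm_ge_zero zero_less_numeral mult_nonneg_nonneg)
    also have "\<dots> \<longleftrightarrow> 1 < 2 * \<rho> * Re w"
      unfolding power_mult_distrib cmod_power2 by (simp add: power2_eq_square algebra_simps)
    also have "\<dots> \<longleftrightarrow> Re w > w0" using \<rho> by (simp add: w0_def field_simps)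
    finally show ?thesis .
  qed
  define c where "c = ln 2 / (2 * c1)"
  have cpos: "c > 0" using c by (simp add: c_def)
  define d where "d = w0"
  \<comment> \<open>Shifting by twice \<open>w0\<close> moves the boundary of the half plane to Re w
    = - w0, so that F is holomorphic beyond the imaginary axis.\<close>
  define F where "F = (\<lambda>w. f (\<xi> + e / (w + of_real (2 * w0))))"
  have "x \<noteq> \<xi>" using x e \<rho> by (auto simp: dist_norm norm_mult)
  define w where "w = e / (x - \<xi>) - of_real (2 * w0)"
  have nz: "e / (x - \<xi>) \<noteq> 0" using e0 \<open>x \<noteq> \<xi>\<close> by simp
  have xw: "\<xi> + e / (e / (x - \<xi>)) = x" using e0 \<open>x \<noteq> \<xi>\<close> by simp
  have "F w = 0"
  proof (rule half_plane_decay_imp_zero[of F w0 c "2 * c0"])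
    show "F holomorphic_on {w. - w0 < Re w}"
      unfolding F_def
    proof (rule holomorphic_on_compose_gen[unfolded o_def, OF _ hol])
      show "(\<lambda>w. \<xi> + e / (w + of_real (2 * w0))) holomorphic_on {w. - w0 < Re w}"
      proof (intro holomorphic_intros)
        fix w assume "w \<in> {w. - w0 < Re w}"
        hence "Re (w + of_real (2 * w0)) > 0" using w0 by simp
        thus "w + of_real (2 * w0) \<noteq> 0" by (metis less_irrefl zero_complex.sel(1))
      qed
      show "(\<lambda>w. \<xi> + e / (w + of_real (2 * w0))) ` {w. - w0 < Re w} \<subseteq> tangent_ball \<xi> \<rho> e"
      proof (intro image_subsetI)
        fix w assume "w \<in> {w. - w0 < Re w}"
        hence "Re (w + of_real (2 * w0)) > w0" by simp
        moreover from this have "w + of_real (2 * w0) \<noteq> 0" using w0 by (metis less_asym zero_complex.sel(1))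
        ultimately show "\<xi> + e / (w + of_real (2 * w0)) \<in> tangent_ball \<xi> \<rho> e"
          by (subst ball_iff)
      qed
    qed
    show "- w0 < Re w" using x ball_iff[OF nz] unfolding xw by (simp add: w_def)
    fix v assume v: "0 \<le> Re v"
    define v' where "v' = v + of_real (2 * w0)"
    have v': "Re v' > w0" "v' \<noteq> 0" using v w0 by (auto simp: v'_def complex_eq_iff)
    have "cmod (f (\<xi> + e / v')) \<le> 2 * c0 * exp (- (ln 2 / (2 * c1)) * (1 / (1 / cmod v')))"
    proof (rule factorial_decay_imp_exp_decay)
      fix N
      show "cmod (f (\<xi> + e / v')) \<le> c0 * c1 ^ N * fact N * (1 / cmod v') ^ N"
        using bd[of "\<xi> + e / v'" N] ball_iff[OF v'(2)] v'(1) e Gamma_fact[of N, where 'a = real]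
        by (simp add: norm_divide)
    qed (use c v' in auto)
    also have "\<dots> = 2 * c0 * exp (- c * cmod v')" by (simp add: c_def)
    also have "\<dots> \<le> 2 * c0 * exp (- c * cmod v)"
      using norm_add_of_real_ge[OF v, of "2 * w0"] c w0 cpos
      by (intro mult_left_mono) (auto simp: v'_def)
    finally show "cmod (F v) \<le> 2 * c0 * exp (- c * cmod v)" by (simp add: F_def v'_def)
  qed (use w0 cpos in auto)
  thus ?thesis using xw by (simp add: F_def w_def)
qed

section \<open>Spaces of power series and their functionals\<close>

lemma cspace_simps [simp]:
  "vscale (H_space r) c F = fps_const c * F" "vnorm (H_space r) = sup_norm r"
  "vscale (B_space r) c F = fps_const c * F" "vnorm (B_space r) = sup_norm r"
  "vecs complex_space = UNIV" "vscale complex_space = (*)" "vnorm complex_space = cmod"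
  by (auto simp: H_space_def B_space_def complex_space_def)

lemma
  assumes "r > 0" "summable (\<lambda>n. cmod (fps_nth F n) * r ^ n)"
  shows H_space_summableI: "F \<in> vecs (H_space r)"
    and sup_norm_le_suminf: "sup_norm r F \<le> (\<Sum>n. cmod (fps_nth F n) * r ^ n)"
proof -
  have le: "cmod (fps_nth F n * z ^ n) \<le> cmod (fps_nth F n) * r ^ n" if "z \<in> ball 0 r" for z n
    using that by (auto simp: norm_mult norm_power intro!: mult_left_mono power_mono)
  have bd: "cmod (eval_fps F z) \<le> (\<Sum>n. cmod (fps_nth F n) * r ^ n)" if z: "z \<in> ball 0 r" for z
  proof -
    have s: "summable (\<lambda>n. cmod (fps_nth F n * z ^ n))"
      by (rule summable_comparison_test'[OF assms(2), of 0]) (use le[OF z] in auto)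
    have "cmod (eval_fps F z) \<le> (\<Sum>n. cmod (fps_nth F n * z ^ n))"
      unfolding eval_fps_def by (rule summable_norm[OF s])
    also have "\<dots> \<le> (\<Sum>n. cmod (fps_nth F n) * r ^ n)"
      by (rule suminf_le[OF le[OF z] s assms(2)])
    finally show ?thesis .
  qed
  have "summable (\<lambda>n. fps_nth F n * of_real r ^ n)"
    by (rule summable_norm_cancel) (use assms in \<open>simp add: norm_mult norm_power\<close>)
  hence "ereal (norm (of_real r :: complex)) \<le> fps_conv_radius F"
    unfolding fps_conv_radius_def by (rule conv_radius_geI)
  hence "ereal r \<le> fps_conv_radius F" using assms by simp
  moreover have "bounded (eval_fps F ` ball 0 r)"
    using bd by (intro boundedI) auto
  ultimately show "F \<in> vecs (H_space r)" using assms by (simp add: vecs_H_space_iff)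
  show "sup_norm r F \<le> (\<Sum>n. cmod (fps_nth F n) * r ^ n)"
    unfolding sup_norm_def by (rule cSUP_least) (use assms bd in auto)
qed

lemma norm_eval_fps_le_sup_norm:
  assumes "r > 0" "F \<in> vecs (H_space r)" "cmod z < r"
  shows "cmod (eval_fps F z) \<le> sup_norm r F"
proof -
  have "bounded (eval_fps F ` ball 0 r)" using assms by (simp add: vecs_H_space_iff)
  hence "bdd_above ((\<lambda>z. cmod (eval_fps F z)) ` ball 0 r)"
    by (auto simp: bounded_iff bdd_above_def)
  thus ?thesis unfolding sup_norm_def by (rule cSUP_upper2) (use assms in auto)
qed

lemma H_space_conv_radius:
  assumes "r > 0" "F \<in> vecs (H_space r)" "cmod z < r"
  shows "ereal (cmod z) < fps_conv_radius F"
  using assms by (simp add: vecs_H_space_iff) (metis ereal_less_eq(3) less_ereal.simps(1) less_le_trans)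

lemma H_space_diff:
  assumes "r > 0" "F \<in> vecs (H_space r)" "K \<in> vecs (H_space r)"
  shows "F - K \<in> vecs (H_space r)"
proof -
  have b: "bounded (eval_fps F ` ball 0 r)" "bounded (eval_fps K ` ball 0 r)"
    and c: "ereal r \<le> fps_conv_radius F" "ereal r \<le> fps_conv_radius K"
    using assms by (auto simp: vecs_H_space_iff)
  have "ereal r \<le> fps_conv_radius (F - K)"
    using fps_conv_radius_diff[of F K] c by (meson min.boundedI order_trans)
  moreover have "bounded ((\<lambda>z. eval_fps F z - eval_fps K z) ` ball 0 r)"
    by (rule bounded_minus_comp[OF b])
  moreover have "(\<lambda>z. eval_fps F z - eval_fps K z) ` ball 0 r = eval_fps (F - K) ` ball 0 r"
  proof (rule image_cong)
    fix z :: complex assume "z \<in> ball 0 r"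
    thus "eval_fps F z - eval_fps K z = eval_fps (F - K) z"
      using assms by (simp add: eval_fps_diff H_space_conv_radius)
  qed simp
  ultimately show ?thesis using assms(1) by (simp add: vecs_H_space_iff)
qed

lemma H_space_scale:
  assumes "r > 0" "F \<in> vecs (H_space r)"
  shows "fps_const c * F \<in> vecs (H_space r)"
proof -
  have b: "bounded (eval_fps F ` ball 0 r)" and c: "ereal r \<le> fps_conv_radius F"
    using assms by (auto simp: vecs_H_space_iff)
  have "ereal r \<le> fps_conv_radius (fps_const c * F)"
    using fps_conv_radius_mult[of "fps_const c" F] c by simp
  moreover have "bounded ((\<lambda>z. c * z) ` (eval_fps F ` ball 0 r))"
    by (rule bounded_linear_image[OF b bounded_linear_mult_right])
  moreover have "(\<lambda>z. c * z) ` (eval_fps F ` ball 0 r) = eval_fps (fps_const c * F) ` ball 0 r"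
    unfolding image_image
  proof (rule image_cong)
    fix z :: complex assume "z \<in> ball 0 r"
    thus "c * eval_fps F z = eval_fps (fps_const c * F) z"
      using assms by (simp add: eval_fps_mult H_space_conv_radius)
  qed simp
  ultimately show ?thesis using assms(1) by (simp add: vecs_H_space_iff)
qed

lemma zero_in_H_space: "r > 0 \<Longrightarrow> 0 \<in> vecs (H_space r)"
  by (rule H_space_summableI) auto

lemma H_space_add:
  assumes "r > 0" "F \<in> vecs (H_space r)" "K \<in> vecs (H_space r)"
  shows "F + K \<in> vecs (H_space r)"
  using H_space_diff[OF assms(1,2) H_space_scale[OF assms(1,3), of "-1"]]
  by (simp flip: fps_const_neg)

text \<open>Cauchy's estimate on the circle of radius r / 2, which lies inside the open disk where
  the supremum norm controls the function; hence the 2.\<close>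

lemma norm_fps_nth_le_sup_norm:
  assumes "r > 0" "F \<in> vecs (H_space r)"
  shows "cmod (fps_nth F n) \<le> (2 / r) ^ n * sup_norm r F"
proof -
  have rad: "ereal (r / 2) < fps_conv_radius F"
    using H_space_conv_radius[OF assms, of "of_real (r / 2)"] assms(1) by simp
  have hol: "eval_fps F holomorphic_on cball 0 (r / 2)"
  proof (rule holomorphic_on_eval_fps)
    show "cball (0::complex) (r / 2) \<subseteq> eball 0 (fps_conv_radius F)"
    proof
      fix z :: complex assume "z \<in> cball 0 (r / 2)"
      hence "ereal (cmod z) \<le> ereal (r / 2)" by simp
      thus "z \<in> eball 0 (fps_conv_radius F)" 
        using rad le_less_trans unfolding eball_def mem_Collect_eq dist_0_norm by blast
    qed
  qed
  have bd: "cmod ((deriv ^^ n) (eval_fps F) 0) \<le> fact n * sup_norm r F / (r / 2) ^ n"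
  proof (rule Cauchy_inequality)
    show "eval_fps F holomorphic_on ball 0 (r / 2)"
      using hol by (rule holomorphic_on_subset) auto
    show "continuous_on (cball 0 (r / 2)) (eval_fps F)"
      using hol by (rule holomorphic_on_imp_continuous_on)
    show "cmod (eval_fps F x) \<le> sup_norm r F" if "cmod (0 - x) = r / 2" for x
      by (rule norm_eval_fps_le_sup_norm[OF assms]) (use that assms in auto)
  qed (use assms in auto)
  have "fps_nth F n = (deriv ^^ n) (eval_fps F) 0 / fact n"
    by (rule fps_nth_conv_deriv) (use rad assms in \<open>metis ereal_less(2) half_gt_zero less_trans\<close>)
  hence "cmod (fps_nth F n) = cmod ((deriv ^^ n) (eval_fps F) 0) / fact n"
    by (simp add: norm_divide)
  also have "\<dots> \<le> fact n * sup_norm r F / (r / 2) ^ n / fact n"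
    by (rule divide_right_mono[OF bd]) simp
  also have "\<dots> = (2 / r) ^ n * sup_norm r F"
    by (simp add: power_divide)
  finally show ?thesis .
qed

section \<open>Vector-valued expansions seen through bounded functionals\<close>

lemma vholomorphic_on_subset:
  "vholomorphic_on B f S \<Longrightarrow> T \<subseteq> S \<Longrightarrow> vholomorphic_on B f T"
  unfolding vholomorphic_on_def by (meson subsetD tendsto_within_subset)

lemma gevrey_on_subset:
  assumes "gevrey_on \<sigma> \<xi> B S f a" "T \<subseteq> S" shows "gevrey_on \<sigma> \<xi> B T f a"
  using assms unfolding gevrey_on_def by (meson subsetD vholomorphic_on_subset)

lemma vholomorphic_on_complex: "vholomorphic_on complex_space f S \<longleftrightarrow> f holomorphic_on S"
proof -
  have "((\<lambda>p. cmod (inverse (p - q) * (f p - f q) - D)) \<longlongrightarrow> 0) (at q within S) \<longleftrightarrow>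
          (f has_field_derivative D) (at q within S)" for q D
    unfolding has_field_derivative_iff tendsto_norm_zero_iff
    by (subst LIM_zero_iff) (simp add: divide_inverse mult.commute)
  thus ?thesis
    by (auto simp: vholomorphic_on_def holomorphic_on_def field_differentiable_def)
qed

lemma gevrey_on_complex:
  "gevrey_on \<sigma> \<xi> complex_space S f a \<longleftrightarrow> f holomorphic_on S \<and>
     (\<exists>c0>0. \<exists>c1>0. \<forall>N. \<forall>q\<in>S. cmod (f q - (\<Sum>n<N. (q - \<xi>) ^ n * a n))
          \<le> c0 * c1 ^ N * Gamma (1 + real N * \<sigma>) * cmod (q - \<xi>) ^ N)"
  by (simp add: gevrey_on_def vholomorphic_on_complex)

text \<open>The instances are coefficient extraction and evaluation at a point of the disk. They
  reduce vector-valued expansions to scalar ones, to which Watson's lemma and the identity theorem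
  apply.\<close>

definition bounded_functional :: "complex fps cspace \<Rightarrow> (complex fps \<Rightarrow> complex) \<Rightarrow> bool" where
  "bounded_functional B T \<longleftrightarrow>
     (\<exists>K>0. \<forall>F\<in>vecs B. cmod (T F) \<le> K * vnorm B F) \<and>
     (\<forall>F\<in>vecs B. \<forall>K\<in>vecs B. T (F - K) = T F - T K \<and> T (F + K) = T F + T K) \<and>
     (\<forall>F\<in>vecs B. \<forall>c. T (vscale B c F) = c * T F)"

lemma bounded_functional_nth:
  assumes "r > 0" "B = H_space r \<or> B = B_space r"
  shows "bounded_functional B (\<lambda>F. fps_nth F n)"
  unfolding bounded_functional_def
proof (intro conjI)
  have "cmod (fps_nth F n) \<le> (2 / r) ^ n * vnorm B F" if "F \<in> vecs B" for F
  proof -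
    have "F \<in> vecs (H_space r)" "vnorm B = sup_norm r"
      using that assms(2) by (auto simp: vecs_B_space_iff)
    thus ?thesis using norm_fps_nth_le_sup_norm[OF assms(1)] by simp
  qed
  moreover have "(2 / r) ^ n > 0" using assms(1) by simp
  ultimately show "\<exists>K>0. \<forall>F\<in>vecs B. cmod (fps_nth F n) \<le> K * vnorm B F" by blast
qed (use assms(2) in auto)

lemma bounded_functional_eval:
  assumes "cmod z < r"
  shows "bounded_functional (H_space r) (\<lambda>F. eval_fps F z)"
proof -
  have r: "r > 0" using assms norm_ge_zero le_less_trans by blast
  have "eval_fps (F - K) z = eval_fps F z - eval_fps K z"
       "eval_fps (F + K) z = eval_fps F z + eval_fps K z"
       "eval_fps (fps_const c * F) z = c * eval_fps F z"
    if "F \<in> vecs (H_space r)" "K \<in> vecs (H_space r)" for F K c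
    using H_space_conv_radius[OF r that(1) assms] H_space_conv_radius[OF r that(2) assms]
    by (simp_all add: eval_fps_diff eval_fps_add eval_fps_mult)
  thus ?thesis unfolding bounded_functional_def
    using norm_eval_fps_le_sup_norm[OF r _ assms] by (auto intro!: exI[of _ 1])
qed

lemma space_closed:
  assumes "r > 0" "B = H_space r \<or> B = B_space r" "F \<in> vecs B" "K \<in> vecs B"
  shows "F - K \<in> vecs B" "F + K \<in> vecs B" "vscale B c F \<in> vecs B" "0 \<in> vecs B"
  using assms H_space_diff H_space_add H_space_scale zero_in_H_space
  by (auto simp: vecs_B_space_iff)

lemma vholomorphic_on_functional:
  assumes "r > 0" "B = H_space r \<or> B = B_space r" "bounded_functional B T" "vholomorphic_on B f S"
  shows "(\<lambda>q. T (f q)) holomorphic_on S"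
proof -
  obtain K where K: "K > 0" "\<And>F. F \<in> vecs B \<Longrightarrow> cmod (T F) \<le> K * vnorm B F"
    using assms(3) unfolding bounded_functional_def by blast
  have main: "\<exists>D. ((\<lambda>p. cmod (inverse (p - q) * (T (f p) - T (f q)) - D)) \<longlongrightarrow> 0) (at q within S)"
    if q: "q \<in> S" for q
  proof -
    obtain D where D: "D \<in> vecs B" "((\<lambda>p. vnorm B (vscale B (inverse (p - q)) (f p - f q) - D)) \<longlongrightarrow> 0)
                       (at q within S)"
      using assms(4) q unfolding vholomorphic_on_def by blast
    have "\<forall>\<^sub>F p in at q within S. cmod (inverse (p - q) * (T (f p) - T (f q)) - T D)
            \<le> K * vnorm B (vscale B (inverse (p - q)) (f p - f q) - D)"
      unfolding eventually_at_filter
    proof (intro always_eventually allI impI)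
      fix p assume "p \<in> S"
      hence f: "f p \<in> vecs B" "f q \<in> vecs B" using assms(4) q unfolding vholomorphic_on_def by auto
      have 1: "f p - f q \<in> vecs B" using space_closed[OF assms(1,2) f] by simp
      have 2: "vscale B (inverse (p - q)) (f p - f q) \<in> vecs B"
        using space_closed[OF assms(1,2) 1 D(1)] by simp
      have 3: "vscale B (inverse (p - q)) (f p - f q) - D \<in> vecs B"
        using space_closed[OF assms(1,2) 2 D(1)] by simp
      have "T (vscale B (inverse (p - q)) (f p - f q) - D) = inverse (p - q) * (T (f p) - T (f q)) - T D"
        using assms(3) 1 2 D(1) f unfolding bounded_functional_def by simp
      thus "cmod (inverse (p - q) * (T (f p) - T (f q)) - T D)
            \<le> K * vnorm B (vscale B (inverse (p - q)) (f p - f q) - D)"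
        using K(2)[OF 3] by simp
    qed
    moreover have "((\<lambda>p. K * vnorm B (vscale B (inverse (p - q)) (f p - f q) - D)) \<longlongrightarrow> 0) (at q within S)"
      using tendsto_mult_right_zero[OF D(2)] .
    ultimately have "((\<lambda>p. cmod (inverse (p - q) * (T (f p) - T (f q)) - T D)) \<longlongrightarrow> 0) (at q within S)"
      by (rule tendsto_sandwich[OF _ _ tendsto_const, rotated]) simp
    thus ?thesis by (rule exI)
  qed
  hence "vholomorphic_on complex_space (\<lambda>q. T (f q)) S"
    unfolding vholomorphic_on_def cspace_simps bex_UNIV by (intro ballI conjI UNIV_I main)
  thus ?thesis by (simp only: vholomorphic_on_complex)
qed

lemma gevrey_on_functional:
  assumes "r > 0" "B = H_space r \<or> B = B_space r" "bounded_functional B T" "gevrey_on \<sigma> \<xi> B S f a"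
  shows "gevrey_on \<sigma> \<xi> complex_space S (\<lambda>q. T (f q)) (\<lambda>n. T (a n))"
proof -
  obtain K where K: "K > 0" "\<And>F. F \<in> vecs B \<Longrightarrow> cmod (T F) \<le> K * vnorm B F"
    using assms(3) unfolding bounded_functional_def by blast
  have T: "T (F - G) = T F - T G" "T (F + G) = T F + T G" "T (vscale B c F) = c * T F"
    if "F \<in> vecs B" "G \<in> vecs B" for F G c
    using assms(3) that unfolding bounded_functional_def by auto
  have f: "f q \<in> vecs B" if "q \<in> S" for q
    using assms(4) that unfolding gevrey_on_def vholomorphic_on_def by auto
  have a: "a n \<in> vecs B" for n using assms(4) unfolding gevrey_on_def by auto
  note cl = space_closed[OF assms(1,2)]
  obtain c0 c1 where c: "c0 > 0" "c1 > 0"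
    and bd: "\<And>N q. q \<in> S \<Longrightarrow> vnorm B (f q - (\<Sum>n<N. vscale B ((q - \<xi>) ^ n) (a n)))
          \<le> c0 * c1 ^ N * Gamma (1 + real N * \<sigma>) * cmod (q - \<xi>) ^ N"
    using assms(4) unfolding gevrey_on_def by blast
  have z: "0 \<in> vecs B" using cl(4)[OF a a] .
  have T0: "T 0 = 0" using T(1)[OF z z] by simp
  have sum: "(\<Sum>n<N. vscale B (x ^ n) (a n)) \<in> vecs B \<and>
             T (\<Sum>n<N. vscale B (x ^ n) (a n)) = (\<Sum>n<N. x ^ n * T (a n))" for N x
  proof (induction N)
    case (Suc N)
    have "vscale B (x ^ N) (a N) \<in> vecs B" using cl(3)[OF a a] .
    thus ?case using Suc T(2)[of "\<Sum>n<N. vscale B (x ^ n) (a n)" "vscale B (x ^ N) (a N)"] T(3)[OF a a]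
        cl(2)[of "\<Sum>n<N. vscale B (x ^ n) (a n)" "vscale B (x ^ N) (a N)"] by simp
  qed (use z T0 in auto)
  have "\<exists>c0>0. \<exists>c1>0. \<forall>N. \<forall>q\<in>S. cmod (T (f q) - (\<Sum>n<N. (q - \<xi>) ^ n * T (a n)))
          \<le> c0 * c1 ^ N * Gamma (1 + real N * \<sigma>) * cmod (q - \<xi>) ^ N"
  proof (rule exI[of _ "K * c0"], rule conjI, goal_cases)
    case 2
    show ?case
    proof (rule exI[of _ c1], intro conjI allI ballI)
    fix N q assume q: "q \<in> S"
    let ?s = "\<Sum>n<N. vscale B ((q - \<xi>) ^ n) (a n)"
    have "cmod (T (f q) - (\<Sum>n<N. (q - \<xi>) ^ n * T (a n))) = cmod (T (f q - ?s))"
      using sum T(1)[OF f[OF q]] by simp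
    also have "\<dots> \<le> K * vnorm B (f q - ?s)" using sum cl(1)[OF f[OF q]] by (intro K(2)) auto
    also have "\<dots> \<le> K * (c0 * c1 ^ N * Gamma (1 + real N * \<sigma>) * cmod (q - \<xi>) ^ N)"
      using bd[OF q] K(1) by (intro mult_left_mono) auto
    finally show "cmod (T (f q) - (\<Sum>n<N. (q - \<xi>) ^ n * T (a n)))
        \<le> K * c0 * c1 ^ N * Gamma (1 + real N * \<sigma>) * cmod (q - \<xi>) ^ N"
      by (simp add: mult_ac)
    qed (use c in auto)
  qed (use K c in auto)
  moreover have "(\<lambda>q. T (f q)) holomorphic_on S"
    using vholomorphic_on_functional[OF assms(1-3)] assms(4) unfolding gevrey_on_def by blast
  ultimately show ?thesis unfolding gevrey_on_complex by blast
qed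

section \<open>Gevrey asymptotics of weighted series\<close>

lemma sup_norm_nonneg:
  assumes "r > 0" "F \<in> vecs (H_space r)" shows "0 \<le> sup_norm r F"
proof -
  have "cmod (eval_fps F 0) \<le> sup_norm r F"
    by (rule norm_eval_fps_le_sup_norm[OF assms]) (use assms in simp)
  thus ?thesis by (rule order_trans[OF norm_ge_zero])
qed

text \<open>Taylor's formula with the second derivative bounded by Cauchy's estimate on disks of
  radius \<epsilon> / 2, that is by 2 M / (\<epsilon> / 2)^2. The constant depends on f only through
  M, which permits termwise differentiation of series.\<close>

lemma first_order_remainder_bound:
  assumes hol: "f holomorphic_on S" and "open S" "cball z \<epsilon> \<subseteq> S" "\<epsilon> > 0"
    and M: "\<And>x. x \<in> S \<Longrightarrow> cmod (f x) \<le> M" and p: "p \<in> ball z (\<epsilon> / 2)"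
  shows "cmod (f p - f z - deriv f z * (p - z)) \<le> 8 * M / \<epsilon>\<^sup>2 * (cmod (p - z))\<^sup>2"
proof -
  have sub: "cball x (\<epsilon> / 2) \<subseteq> S" if "x \<in> ball z (\<epsilon> / 2)" for x
  proof
    fix y assume "y \<in> cball x (\<epsilon> / 2)"
    hence "dist z y \<le> \<epsilon>" using that dist_triangle[of z y x] by (simp add: dist_commute)
    thus "y \<in> S" using assms(3) by auto
  qed
  have "cmod ((deriv ^^ 0) f p - (\<Sum>i\<le>1. (deriv ^^ i) f z * (p - z) ^ i / fact i))
          \<le> 8 * M / \<epsilon>\<^sup>2 * cmod (p - z) ^ Suc 1 / fact 1"
  proof (rule complex_Taylor[of "ball z (\<epsilon> / 2)" 1 "\<lambda>i. (deriv ^^ i) f"])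
    fix i x assume x: "x \<in> ball z (\<epsilon> / 2)"
    hence "x \<in> S" using sub[OF x] assms(4) by auto
    hence "((deriv ^^ i) f has_field_derivative deriv ((deriv ^^ i) f) x) (at x)"
      using holomorphic_higher_deriv[OF hol assms(2)] assms(2) holomorphic_derivI by blast
    thus "((deriv ^^ i) f has_field_derivative (deriv ^^ Suc i) f x) (at x within ball z (\<epsilon> / 2))"
      by (simp add: has_field_derivative_at_within)
  next
    fix x assume x: "x \<in> ball z (\<epsilon> / 2)"
    have "cmod ((deriv ^^ 2) f x) \<le> fact 2 * M / (\<epsilon> / 2) ^ 2"
    proof (rule Cauchy_inequality)
      show "f holomorphic_on ball x (\<epsilon> / 2)"
        using hol sub[OF x] by (meson ball_subset_cball holomorphic_on_subset order_trans)
      show "continuous_on (cball x (\<epsilon> / 2)) f"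
        using hol sub[OF x] by (meson holomorphic_on_imp_continuous_on holomorphic_on_subset)
      fix y assume "cmod (x - y) = \<epsilon> / 2"
      hence "y \<in> cball x (\<epsilon> / 2)" by (simp add: dist_norm)
      thus "cmod (f y) \<le> M" using sub[OF x] M by blast
    qed (use assms in auto)
    thus "cmod ((deriv ^^ Suc 1) f x) \<le> 8 * M / \<epsilon>\<^sup>2"
      by (simp add: numeral_2_eq_2 power2_eq_square)
  qed (use p assms in auto)
  thus ?thesis by (simp add: algebra_simps power2_eq_square)
qed

lemma fact_add_le: "fact (m + n) \<le> (2 ^ (m + n) * fact m * fact n :: real)"
proof -
  have eq: "fact m * fact n * ((m + n) choose m) = (fact (m + n) :: nat)"
    using binomial_fact_lemma[of m "m + n"] by simp
  have "real ((m + n) choose m) \<le> 2 ^ (m + n)"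
    using binomial_le_pow2[of "m + n" m] by (metis of_nat_le_iff of_nat_numeral of_nat_power)
  hence "fact m * fact n * real ((m + n) choose m) \<le> fact m * fact n * 2 ^ (m + n)"
    by (intro mult_left_mono) auto
  moreover have "fact (m + n) = (fact m * fact n * ((m + n) choose m) :: real)"
    using eq by (metis of_nat_fact of_nat_mult)
  ultimately show ?thesis by (simp add: mult_ac)
qed

lemma power_le_fact_exp:
  assumes "x \<ge> (0::real)" shows "x ^ m \<le> fact m * exp x"
proof -
  have "(\<Sum>n\<in>{m}. x ^ n /\<^sub>R fact n) \<le> (\<Sum>n. x ^ n /\<^sub>R fact n)"
    by (rule sum_le_suminf[OF summable_exp_generic]) (use assms in auto)
  hence "x ^ m / fact m \<le> exp x" by (simp add: exp_def divide_inverse mult.commute)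
  thus ?thesis by (simp add: field_simps)
qed

text \<open>Half of the geometric decay is spent on the power: \<kappa>' = e^(-2t), (n + 1)^m \<le>
  m! t^(-m) e^(t (n + 1)), and a ratio e^(-t) remains. With m = a + \<tau> N, the inequality
  \<open>fact_add_le\<close> separates off a!, so that only (\<tau> N)! grows with N.\<close>

lemma sum_poly_geometric_bound:
  assumes "0 \<le> \<kappa>" "\<kappa> < (1::real)"
  obtains c0 c1 where "c0 > 0" "c1 > 0"
    "\<And>N. summable (\<lambda>n. real (n + 1) ^ (a + \<tau> * N) * \<kappa> ^ n)"
    "\<And>N. (\<Sum>n. real (n + 1) ^ (a + \<tau> * N) * \<kappa> ^ n) \<le> c0 * c1 ^ N * fact (\<tau> * N)"
proof -
  \<comment> \<open>The maximum keeps the logarithm meaningful when \<kappa> = 0.\<close>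
  define \<kappa>' where "\<kappa>' = max \<kappa> (1 / 2)"
  have \<kappa>': "0 < \<kappa>'" "\<kappa>' < 1" "\<kappa> \<le> \<kappa>'" using assms by (auto simp: \<kappa>'_def)
  define t where "t = - ln \<kappa>' / 2"
  have t: "t > 0" using \<kappa>' by (simp add: t_def)
  define \<theta> where "\<theta> = exp (- t)"
  have \<theta>: "0 < \<theta>" "\<theta> < 1" "\<kappa>' * exp t = \<theta>"
  proof -
    have "\<kappa>' = exp (ln \<kappa>')" using \<kappa>' by simp
    also have "\<dots> = exp (- t) * exp (- t)" by (simp add: t_def flip: exp_add)
    finally show "\<kappa>' * exp t = \<theta>" by (simp add: \<theta>_def flip: exp_add)
  qed (use t in \<open>auto simp: \<theta>_def\<close>)
  have trm: "real (n + 1) ^ m * \<kappa> ^ n \<le> (fact m / t ^ m * exp t) * \<theta> ^ n" for n m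
  proof -
    have "(t * real (n + 1)) ^ m \<le> fact m * exp (t * real (n + 1))"
      by (rule power_le_fact_exp) (use t in auto)
    hence "real (n + 1) ^ m \<le> fact m / t ^ m * exp (t * real (n + 1))"
      using t by (simp only: power_mult_distrib) (simp add: pos_le_divide_eq mult.commute)
    moreover have "exp (t * real (n + 1)) = exp t * exp t ^ n"
      by (simp add: algebra_simps exp_add exp_of_nat2_mult)
    moreover have "\<kappa> ^ n \<le> \<kappa>' ^ n" using assms \<kappa>' by (intro power_mono) auto
    ultimately have "real (n + 1) ^ m * \<kappa> ^ n \<le> (fact m / t ^ m * (exp t * exp t ^ n)) * \<kappa>' ^ n"
      using assms t by (intro mult_mono) auto
    thus ?thesis by (simp add: \<theta>(3)[symmetric] power_mult_distrib mult_ac)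
  qed
  have geo: "summable (\<lambda>n. \<theta> ^ n)" using \<theta> by (intro summable_geometric) auto
  have sm: "summable (\<lambda>n. real (n + 1) ^ m * \<kappa> ^ n)" for m
    by (rule summable_comparison_test'[OF summable_mult[OF geo], of 0 _ "fact m / t ^ m * exp t"])
       (use trm[of _ m] assms in auto)
  have le: "(\<Sum>n. real (n + 1) ^ m * \<kappa> ^ n) \<le> fact m / t ^ m * exp t * (1 / (1 - \<theta>))" for m
  proof -
    have "(\<Sum>n. real (n + 1) ^ m * \<kappa> ^ n) \<le> (\<Sum>n. (fact m / t ^ m * exp t) * \<theta> ^ n)"
      by (intro suminf_le trm sm summable_mult geo)
    also have "\<dots> = (fact m / t ^ m * exp t) * (\<Sum>n. \<theta> ^ n)"
      by (rule suminf_mult[OF geo])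
    also have "(\<Sum>n. \<theta> ^ n) = 1 / (1 - \<theta>)" using \<theta> by (intro suminf_geometric) auto
    finally show ?thesis .
  qed
  show ?thesis
  proof (rule that[of "2 ^ a * fact a / t ^ a * exp t * (1 / (1 - \<theta>))" "(2 / t) ^ \<tau>"])
    fix N
    let ?m = "a + \<tau> * N"
    have "(\<Sum>n. real (n + 1) ^ ?m * \<kappa> ^ n) \<le> fact ?m / t ^ ?m * exp t * (1 / (1 - \<theta>))" by (rule le)
    also have "\<dots> \<le> (2 ^ ?m * fact a * fact (\<tau> * N)) / t ^ ?m * exp t * (1 / (1 - \<theta>))"
      using fact_add_le[of a "\<tau> * N"] t \<theta> by (intro mult_right_mono divide_right_mono) auto
    also have "\<dots> = 2 ^ a * fact a / t ^ a * exp t * (1 / (1 - \<theta>)) * ((2 / t) ^ \<tau>) ^ N * fact (\<tau> * N)"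
      by (simp only: power_add power_mult power_divide) (simp add: mult_ac)
    finally show "(\<Sum>n. real (n + 1) ^ ?m * \<kappa> ^ n)
      \<le> 2 ^ a * fact a / t ^ a * exp t * (1 / (1 - \<theta>)) * ((2 / t) ^ \<tau>) ^ N * fact (\<tau> * N)" .
  qed (use t \<theta> sm in auto)
qed

lemma Abs_fps_bound:
  assumes "r > 0" "B = H_space r \<or> (B = B_space r \<and> w 0 = 0)"
    and w: "\<And>n. cmod (w n) * r ^ n \<le> K * \<kappa> ^ n"
    and c: "\<And>n. cmod (c n) \<le> A * real (n + 1) ^ m" and A: "A \<ge> 0"
    and sm: "summable (\<lambda>n. real (n + 1) ^ m * \<kappa> ^ n)"
  shows "Abs_fps (\<lambda>n. w n * c n) \<in> vecs B"
    and "sup_norm r (Abs_fps (\<lambda>n. w n * c n)) \<le> A * K * (\<Sum>n. real (n + 1) ^ m * \<kappa> ^ n)"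
proof -
  let ?F = "Abs_fps (\<lambda>n. w n * c n)"
  have le: "cmod (fps_nth ?F n) * r ^ n \<le> A * K * (real (n + 1) ^ m * \<kappa> ^ n)" for n
  proof -
    have "cmod (c n) * (cmod (w n) * r ^ n) \<le> (A * real (n + 1) ^ m) * (K * \<kappa> ^ n)"
      using assms(1) by (intro mult_mono w c) (use A in auto)
    thus ?thesis by (simp add: norm_mult mult_ac)
  qed
  have s: "summable (\<lambda>n. cmod (fps_nth ?F n) * r ^ n)"
    by (rule summable_comparison_test'[OF summable_mult[OF sm], of 0 _ "A * K"]) (use le assms(1) in auto)
  have H: "?F \<in> vecs (H_space r)" by (rule H_space_summableI[OF assms(1) s])
  show "?F \<in> vecs B" using H assms(2) by (auto simp: vecs_B_space_iff)
  have "sup_norm r ?F \<le> (\<Sum>n. cmod (fps_nth ?F n) * r ^ n)"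
    by (rule sup_norm_le_suminf[OF assms(1) s])
  also have "\<dots> \<le> (\<Sum>n. A * K * (real (n + 1) ^ m * \<kappa> ^ n))"
    by (rule suminf_le[OF le s summable_mult[OF sm]])
  also have "\<dots> = A * K * (\<Sum>n. real (n + 1) ^ m * \<kappa> ^ n)" by (rule suminf_mult[OF sm])
  finally show "sup_norm r ?F \<le> A * K * (\<Sum>n. real (n + 1) ^ m * \<kappa> ^ n)" .
qed

text \<open>The derivative is the series of the derivatives of the \<phi> n. The Cauchy disk around
  q has the same radius \<epsilon> for every n, so the errors of the difference quotients are |p -
  q| times a polynomial in n, which the weights sum.\<close>

lemma series_vholomorphic_on:
  assumes "r > 0" "B = H_space r \<or> (B = B_space r \<and> w 0 = 0)" "open S"
    and w: "\<And>n. cmod (w n) * r ^ n \<le> K * \<kappa> ^ n" and \<kappa>: "0 \<le> \<kappa>" "\<kappa> < 1"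
    and hol: "\<And>n. \<phi> n holomorphic_on S"
    and bd: "\<And>n x. x \<in> S \<Longrightarrow> cmod (\<phi> n x) \<le> A * real (n + 1) ^ m" and A: "A \<ge> 0"
    and f: "\<And>q. q \<in> S \<Longrightarrow> f q = Abs_fps (\<lambda>n. w n * \<phi> n q)"
  shows "vholomorphic_on B f S"
  unfolding vholomorphic_on_def
proof (intro ballI conjI)
  have sm: "summable (\<lambda>n. real (n + 1) ^ m * \<kappa> ^ n)"
    using sum_poly_geometric_bound[OF \<kappa>, of m 0] by (metis mult_zero_left add_0_right)
  define M where "M = (\<Sum>n. real (n + 1) ^ m * \<kappa> ^ n)"
  note bound = Abs_fps_bound[OF assms(1,2) w _ _ sm]
  fix q assume q: "q \<in> S"
  show "f q \<in> vecs B" unfolding f[OF q] by (rule bound(1)[of _ A]) (use bd[OF q] A in auto)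
  obtain \<epsilon> where \<epsilon>: "\<epsilon> > 0" "cball q \<epsilon> \<subseteq> S" using assms(3) q open_contains_cball by blast
  define D where "D = Abs_fps (\<lambda>n. w n * deriv (\<phi> n) q)"
  have "D \<in> vecs B" unfolding D_def
  proof (rule bound(1)[of _ "A / \<epsilon>"])
    fix n
    have "cmod ((deriv ^^ 1) (\<phi> n) q) \<le> fact 1 * (A * real (n + 1) ^ m) / \<epsilon> ^ 1"
    proof (rule Cauchy_inequality)
      show "\<phi> n holomorphic_on ball q \<epsilon>"
        using hol \<epsilon> by (meson ball_subset_cball holomorphic_on_subset order_trans)
      show "continuous_on (cball q \<epsilon>) (\<phi> n)"
        using hol \<epsilon> by (meson holomorphic_on_imp_continuous_on holomorphic_on_subset)
      fix y assume "cmod (q - y) = \<epsilon>"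
      hence "y \<in> cball q \<epsilon>" by (simp add: dist_norm)
      thus "cmod (\<phi> n y) \<le> A * real (n + 1) ^ m" using bd \<epsilon> by blast
    qed (use \<epsilon> in auto)
    thus "cmod (deriv (\<phi> n) q) \<le> A / \<epsilon> * real (n + 1) ^ m" by simp
  qed (use A \<epsilon> in auto)
  moreover have "((\<lambda>p. vnorm B (vscale B (inverse (p - q)) (f p - f q) - D)) \<longlongrightarrow> 0) (at q within S)"
  proof (rule tendsto_sandwich[OF _ _ tendsto_const])
    have v: "vnorm B (vscale B c F - D) = sup_norm r (fps_const c * F - D)" for c F
      using assms(2) by auto
    have coeff: "fps_const (inverse (p - q)) * (f p - f q) - D
        = Abs_fps (\<lambda>n. w n * (inverse (p - q) * (\<phi> n p - \<phi> n q) - deriv (\<phi> n) q))"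
      if "p \<in> S" for p
      by (rule fps_ext) (simp add: f[OF that] f[OF q] D_def algebra_simps)
    have key: "Abs_fps (\<lambda>n. w n * (inverse (p - q) * (\<phi> n p - \<phi> n q) - deriv (\<phi> n) q)) \<in> vecs B \<and>
       sup_norm r (Abs_fps (\<lambda>n. w n * (inverse (p - q) * (\<phi> n p - \<phi> n q) - deriv (\<phi> n) q)))
         \<le> (8 * A / \<epsilon>\<^sup>2 * cmod (p - q)) * K * M" if p: "p \<in> ball q (\<epsilon> / 2)" "p \<noteq> q" for p
    proof -
      have le: "cmod (inverse (p - q) * (\<phi> n p - \<phi> n q) - deriv (\<phi> n) q)
               \<le> 8 * A / \<epsilon>\<^sup>2 * cmod (p - q) * real (n + 1) ^ m" for n
      proof -
        have "cmod (inverse (p - q) * (\<phi> n p - \<phi> n q) - deriv (\<phi> n) q)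
                = cmod (inverse (p - q) * (\<phi> n p - \<phi> n q - deriv (\<phi> n) q * (p - q)))"
          using p(2) by (simp add: field_simps)
        also have "\<dots> \<le> inverse (cmod (p - q)) * (8 * (A * real (n + 1) ^ m) / \<epsilon>\<^sup>2 * (cmod (p - q))\<^sup>2)"
          unfolding norm_mult norm_inverse
          using first_order_remainder_bound[OF hol assms(3) \<epsilon>(2,1) bd p(1)]
          by (intro mult_left_mono) auto
        also have "\<dots> = 8 * A / \<epsilon>\<^sup>2 * cmod (p - q) * real (n + 1) ^ m"
          using p(2) by (simp add: power2_eq_square field_simps)
        finally show ?thesis .
      qed
      have nn: "0 \<le> 8 * A / \<epsilon>\<^sup>2 * cmod (p - q)" using A by simp
      show ?thesis using bound[OF le nn] by (simp add: M_def)
    qed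
    have ev: "\<forall>\<^sub>F p in at q within S. p \<in> ball q (\<epsilon> / 2) \<and> p \<noteq> q \<and> p \<in> S"
      unfolding eventually_at
      by (rule exI[of _ "\<epsilon> / 2"]) (use \<epsilon> in \<open>auto simp: dist_commute\<close>)
    thus "\<forall>\<^sub>F p in at q within S. vnorm B (vscale B (inverse (p - q)) (f p - f q) - D)
             \<le> (8 * A / \<epsilon>\<^sup>2 * cmod (p - q)) * K * M"
      by eventually_elim (use key in \<open>auto simp: v coeff\<close>)
    show "\<forall>\<^sub>F p in at q within S. 0 \<le> vnorm B (vscale B (inverse (p - q)) (f p - f q) - D)"
      using ev
    proof eventually_elim
      case (elim p)
      let ?F = "Abs_fps (\<lambda>n. w n * (inverse (p - q) * (\<phi> n p - \<phi> n q) - deriv (\<phi> n) q))"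
      have "?F \<in> vecs (H_space r)" using key[of p] elim assms(2) by (auto simp: vecs_B_space_iff)
      hence "0 \<le> sup_norm r ?F"
        by (rule sup_norm_nonneg[OF assms(1)])
      thus ?case using elim coeff[of p] by (simp only: v)
    qed
    have "((\<lambda>p. (8 * A / \<epsilon>\<^sup>2 * cmod (p - q)) * K * M) \<longlongrightarrow> (8 * A / \<epsilon>\<^sup>2 * cmod (q - q)) * K * M) (at q within S)"
      by (intro tendsto_intros)
    thus "((\<lambda>p. (8 * A / \<epsilon>\<^sup>2 * cmod (p - q)) * K * M) \<longlongrightarrow> 0) (at q within S)" by simp
  qed
  ultimately show "\<exists>D\<in>vecs B. ((\<lambda>p. vnorm B (vscale B (inverse (p - q)) (f p - f q) - D)) \<longlongrightarrow> 0)
                       (at q within S)" by blast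
qed

text \<open>The remainders are geometric as for a function analytic at \<xi>, but they are demanded
  on all of S, of which \<xi> may be a boundary point. One coefficient sequence b serves every N.
  Factorials appear only when such functions are summed over n.\<close>

definition taylor_bounded ::
  "complex set \<Rightarrow> complex \<Rightarrow> (complex \<Rightarrow> complex) \<Rightarrow> real \<Rightarrow> real \<Rightarrow> bool" where
  "taylor_bounded S \<xi> \<phi> A C \<longleftrightarrow> \<phi> holomorphic_on S \<and>
     (\<exists>b. \<forall>N. \<forall>x\<in>S. cmod (\<phi> x - (\<Sum>k<N. (x - \<xi>) ^ k * b k)) \<le> A * C ^ N * cmod (x - \<xi>) ^ N)"

text \<open>The N-th remainder of the n-th term carries the power m + \<tau> N of n + 1. Summed
  against \<kappa>^n it yields (\<tau> N)! = Gamma (1 + N \<tau>), so the exponent \<tau> in the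
  Taylor constants is the Gevrey order.\<close>

theorem series_gevrey_on:
  assumes "r > 0" "B = H_space r \<or> (B = B_space r \<and> w 0 = 0)" "open S" "S \<noteq> {}" "\<xi> \<notin> S"
    and w: "\<And>n. cmod (w n) * r ^ n \<le> K * \<kappa> ^ n" and \<kappa>: "0 \<le> \<kappa>" "\<kappa> < 1"
    and \<phi>: "\<And>n. taylor_bounded S \<xi> (\<phi> n) (A * real (n + 1) ^ m) (C * real (n + 1) ^ \<tau>)"
    and AC: "A \<ge> 0" "C \<ge> 0"
    and f: "\<And>q. q \<in> S \<Longrightarrow> f q = Abs_fps (\<lambda>n. w n * \<phi> n q)"
  shows "\<exists>a. gevrey_on (real \<tau>) \<xi> B S f a"
proof -
  obtain b where b: "\<And>n N x. x \<in> S \<Longrightarrow> cmod (\<phi> n x - (\<Sum>k<N. (x - \<xi>) ^ k * b n k))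
      \<le> A * real (n + 1) ^ m * (C * real (n + 1) ^ \<tau>) ^ N * cmod (x - \<xi>) ^ N"
    using \<phi> unfolding taylor_bounded_def by metis
  obtain c0 c1 where c: "c0 > 0" "c1 > 0"
    and sm: "\<And>N. summable (\<lambda>n. real (n + 1) ^ (m + \<tau> * N) * \<kappa> ^ n)"
    and le: "\<And>N. (\<Sum>n. real (n + 1) ^ (m + \<tau> * N) * \<kappa> ^ n) \<le> c0 * c1 ^ N * fact (\<tau> * N)"
    using sum_poly_geometric_bound[OF \<kappa>, of m \<tau>] by metis
  have K0: "K \<ge> 0" using w[of 0] by simp (metis norm_ge_zero order_trans)
  define a where "a = (\<lambda>k. Abs_fps (\<lambda>n. w n * b n k))"
  have "a k \<in> vecs B" for k
  proof -
    obtain x where x: "x \<in> S" using assms(4) by blast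
    hence nz: "cmod (x - \<xi>) > 0" using assms(5) by auto
    define d where "d = cmod (x - \<xi>)"
    have "cmod (b n k) \<le> (A * C ^ k + A * C ^ (k + 1) * d) * real (n + 1) ^ (m + \<tau> * (k + 1))" for n
    proof -
      let ?y = "\<phi> n x - (\<Sum>k<k. (x - \<xi>) ^ k * b n k)"
      \<comment> \<open>Two consecutive remainders at the one point x differ by the k-th Taylor
        term. This bounds b n k by a power of n + 1, so that a k is an element of B.\<close>
      have "(x - \<xi>) ^ k * b n k = ?y - (\<phi> n x - (\<Sum>k<k + 1. (x - \<xi>) ^ k * b n k))" by simp
      hence "cmod ((x - \<xi>) ^ k * b n k) \<le> cmod ?y + cmod (\<phi> n x - (\<Sum>k<k + 1. (x - \<xi>) ^ k * b n k))"
        by (metis norm_triangle_ineq4)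
      also have "\<dots> \<le> A * real (n + 1) ^ m * (C * real (n + 1) ^ \<tau>) ^ k * d ^ k
                    + A * real (n + 1) ^ m * (C * real (n + 1) ^ \<tau>) ^ (k + 1) * d ^ (k + 1)"
        unfolding d_def by (intro add_mono b x)
      also have "\<dots> = d ^ k * (A * C ^ k * real (n + 1) ^ (m + \<tau> * k)
                    + A * C ^ (k + 1) * d * real (n + 1) ^ (m + \<tau> * (k + 1)))"
        by (simp add: power_mult_distrib power_add power_mult algebra_simps)
      finally have "cmod (b n k) \<le> A * C ^ k * real (n + 1) ^ (m + \<tau> * k)
                    + A * C ^ (k + 1) * d * real (n + 1) ^ (m + \<tau> * (k + 1))"
        using nz by (simp add: norm_mult norm_power d_def)
      also have "real (n + 1) ^ (m + \<tau> * k) \<le> real (n + 1) ^ (m + \<tau> * (k + 1))"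
        by (intro power_increasing) auto
      hence "A * C ^ k * real (n + 1) ^ (m + \<tau> * k) \<le> A * C ^ k * real (n + 1) ^ (m + \<tau> * (k + 1))"
        using AC by (intro mult_left_mono) auto
      finally show ?thesis by (simp add: algebra_simps)
    qed
    thus ?thesis unfolding a_def
      by (rule Abs_fps_bound(1)[OF assms(1,2) w _ _ sm[of "k + 1"]]) (use AC nz in \<open>auto simp: d_def\<close>)
  qed
  moreover have "vholomorphic_on B f S"
  proof (rule series_vholomorphic_on[OF assms(1-3) w \<kappa> _ _ AC(1) f])
    show "\<phi> n holomorphic_on S" for n using \<phi> unfolding taylor_bounded_def by blast
    show "cmod (\<phi> n x) \<le> A * real (n + 1) ^ m" if "x \<in> S" for n x using b[OF that, of n 0] by simp
  qed
  moreover have "vnorm B (f q - (\<Sum>k<N. vscale B ((q - \<xi>) ^ k) (a k)))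
      \<le> ((A * K + 1) * c0) * (C * c1 + 1) ^ N * Gamma (1 + real N * real \<tau>) * cmod (q - \<xi>) ^ N"
    if q: "q \<in> S" for N q
  proof -
    have v: "vnorm B = sup_norm r" "\<And>c F. vscale B c F = fps_const c * F" using assms(2) by auto
    have eq: "f q - (\<Sum>k<N. fps_const ((q - \<xi>) ^ k) * a k)
       = Abs_fps (\<lambda>n. w n * (\<phi> n q - (\<Sum>k<N. (q - \<xi>) ^ k * b n k)))"
      by (rule fps_ext) (simp add: f[OF q] a_def fps_sum_nth sum_distrib_left right_diff_distrib mult_ac)
    have "cmod (\<phi> n q - (\<Sum>k<N. (q - \<xi>) ^ k * b n k))
             \<le> A * C ^ N * cmod (q - \<xi>) ^ N * real (n + 1) ^ (m + \<tau> * N)" for n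
      using b[OF q, of n N] by (simp only: power_mult_distrib power_add power_mult) (simp only: mult_ac)
    hence "sup_norm r (Abs_fps (\<lambda>n. w n * (\<phi> n q - (\<Sum>k<N. (q - \<xi>) ^ k * b n k))))
        \<le> A * C ^ N * cmod (q - \<xi>) ^ N * K * (\<Sum>n. real (n + 1) ^ (m + \<tau> * N) * \<kappa> ^ n)"
      by (rule Abs_fps_bound(2)[OF assms(1,2) w _ _ sm]) (use AC in auto)
    also have "\<dots> \<le> A * C ^ N * cmod (q - \<xi>) ^ N * K * (c0 * c1 ^ N * fact (\<tau> * N))"
      using AC K0 by (intro mult_left_mono le) auto
    also have "\<dots> = (A * K * c0) * (C * c1) ^ N * fact (\<tau> * N) * cmod (q - \<xi>) ^ N"
      by (simp add: power_mult_distrib mult_ac)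
    \<comment> \<open>Raising the constants by 1 keeps them positive when A, K or C
      vanishes.\<close>
    also have "\<dots> \<le> ((A * K + 1) * c0) * (C * c1 + 1) ^ N * fact (\<tau> * N) * cmod (q - \<xi>) ^ N"
      using AC K0 c by (intro mult_right_mono mult_mono power_mono) auto
    also have "fact (\<tau> * N) = Gamma (1 + real N * real \<tau>)"
      using Gamma_fact[of "\<tau> * N", where 'a = real] by (simp add: mult.commute)
    finally show ?thesis unfolding v eq .
  qed
  ultimately show ?thesis unfolding gevrey_on_def using AC K0 c
    by (intro exI[of _ a] conjI allI exI[of _ "(A * K + 1) * c0"] exI[of _ "C * c1 + 1"])
       (auto intro!: add_nonneg_pos mult_pos_pos)
qed

section \<open>Simple poles seen from tangent disks and cardioids\<close>

text \<open>For e = \<xi> this is an outer and an inner disk. In the normal form \<xi> = 0, e = 1,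
  inversion maps the pair to the half planes Re > 2 and Re < -2; their distance from the strip |Re|
  \<le> 1 of the inverted poles is what keeps q away from the poles.\<close>

definition tangent_disks :: "complex \<Rightarrow> complex \<Rightarrow> complex set" where
  "tangent_disks \<xi> e = ball (\<xi> + e / 4) (1 / 4) \<union> ball (\<xi> - e / 4) (1 / 4)"

lemma open_tangent_disks: "open (tangent_disks \<xi> e)"
  by (auto simp: tangent_disks_def)

lemma tangent_disks_nonempty: "tangent_disks \<xi> e \<noteq> {}"
  by (auto simp: tangent_disks_def)

lemma base_notin_tangent_disks:
  assumes "cmod e = 1" shows "\<xi> \<notin> tangent_disks \<xi> e"
  using assms by (auto simp: tangent_disks_def dist_norm norm_divide)

lemma in_tangent_disks_iff:
  assumes "cmod e = 1"
  shows "x \<in> tangent_disks \<xi> e \<longleftrightarrow> (x - \<xi>) / e \<in> tangent_disks 0 1"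
proof -
  have e: "e \<noteq> 0" using assms by auto
  have "dist (\<xi> + s * e / 4) x = dist (s / 4) ((x - \<xi>) / e)" for s
  proof -
    have "\<xi> + s * e / 4 - x = e * (s / 4 - (x - \<xi>) / e)" using e by (simp add: field_simps)
    thus ?thesis using assms by (simp add: dist_norm norm_mult)
  qed
  from this[of 1] this[of "-1"] show ?thesis by (simp add: tangent_disks_def)
qed

lemma tangent_disk_Re:
  assumes "v \<in> ball (1 / 4) (1 / 4)"
  shows "2 * (cmod v)\<^sup>2 < Re v"
proof -
  have "(cmod (1 / 4 - v))\<^sup>2 < (1 / 4)\<^sup>2"
    using assms by (intro power_strict_mono) (auto simp: dist_norm)
  thus ?thesis unfolding cmod_power2 by (simp add: power2_eq_square algebra_simps)
qed

text \<open>
  Inversion maps the disk to the half plane \<open>Re > 2\<close>, while the hypothesis says \<open>\<bar>Re (1 / p)\<bar> \<le> 1\<close>.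
\<close>

lemma dist_tangent_disks_ge:
  assumes v: "v \<in> tangent_disks 0 1" and p: "\<bar>Re p\<bar> \<le> (cmod p)\<^sup>2" "p \<noteq> 0" "cmod p \<le> 2"
  shows "cmod (v - p) \<ge> (cmod p)\<^sup>2 / 4"
proof -
  have main: "cmod (v - p) \<ge> (cmod p)\<^sup>2 / 4"
    if v: "v \<in> ball (1 / 4) (1 / 4)" and p: "Re p \<le> (cmod p)\<^sup>2" "p \<noteq> 0" "cmod p \<le> 2" for v p
  proof (cases "cmod v \<ge> cmod p / 2")
    case True
    have v2: "2 * (cmod v)\<^sup>2 < Re v" by (rule tangent_disk_Re[OF v])
    have v0: "v \<noteq> 0" using v2 by auto
    have "Re (1 / v) > 2"
      using v2 v0 by (simp add: Re_divide cmod_power2[symmetric] less_divide_eq)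
    moreover have "Re (1 / p) \<le> 1"
      using p by (simp add: Re_divide cmod_power2[symmetric] divide_le_eq)
    ultimately have "1 \<le> Re (1 / v - 1 / p)" by simp
    also have "\<dots> \<le> cmod (1 / v - 1 / p)" by (rule complex_Re_le_cmod)
    \<comment> \<open>Multiplication by v p turns the gap 1 between the inverted points into |v| |p|
      \<le> |v - p|.\<close>
    finally have "cmod v * cmod p * 1 \<le> cmod v * cmod p * cmod (1 / v - 1 / p)"
      by (intro mult_left_mono) auto
    also have "\<dots> = cmod (v * p * (1 / v - 1 / p))" by (simp add: norm_mult)
    also have "v * p * (1 / v - 1 / p) = p - v" using v0 p by (simp add: field_simps)
    finally have "cmod v * cmod p \<le> cmod (v - p)" by (simp add: norm_minus_commute)
    moreover have "(cmod p / 2) * cmod p \<le> cmod v * cmod p"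
      using True by (intro mult_right_mono) auto
    ultimately show ?thesis
      using norm_ge_zero[of "v - p"] unfolding power2_eq_square by linarith
  next
    case False
    have "cmod p - cmod v \<le> cmod (v - p)" by (metis norm_minus_commute norm_triangle_ineq2)
    moreover have "cmod p * cmod p \<le> 2 * cmod p" using p by (intro mult_right_mono) auto
    ultimately show ?thesis using False unfolding power2_eq_square by linarith
  qed
  show ?thesis
  proof (cases "v \<in> ball (1 / 4) (1 / 4)")
    case True
    thus ?thesis using main[of v p] p by auto
  next
    case False
    \<comment> \<open>The second disk is the reflection of the first, and the hypotheses on p do not
      change under p |-> -p.\<close>
    hence "- v \<in> ball (1 / 4) (1 / 4)"
      using v by (auto simp: tangent_disks_def dist_norm norm_minus_commute add.commute)
    moreover have "cmod (- v - (- p)) = cmod (v - p)" by (metis minus_diff_minus norm_minus_cancel)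
    ultimately show ?thesis using main[of "- v" "- p"] p by auto
  qed
qed

section \<open>Calculus of geometric Taylor bounds\<close>

lemma taylor_bounded_mono:
  assumes "taylor_bounded S \<xi> \<phi> A C" "A \<le> A'" "0 \<le> C" "C \<le> C'" "0 \<le> A"
  shows "taylor_bounded S \<xi> \<phi> A' C'"
proof -
  have "A * C ^ N * cmod (x - \<xi>) ^ N \<le> A' * C' ^ N * cmod (x - \<xi>) ^ N" for x N
    using assms by (intro mult_right_mono mult_mono power_mono) auto
  thus ?thesis using assms(1) unfolding taylor_bounded_def by (meson order_trans)
qed

lemma taylor_bounded_cong:
  assumes "taylor_bounded S \<xi> \<phi> A C" "\<And>x. x \<in> S \<Longrightarrow> \<phi> x = \<psi> x"
  shows "taylor_bounded S \<xi> \<psi> A C"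
proof -
  have "\<psi> holomorphic_on S"
    using assms holomorphic_transform unfolding taylor_bounded_def by blast
  moreover have "cmod (\<psi> x - s) = cmod (\<phi> x - s)" if "x \<in> S" for x s using assms(2)[OF that] by simp
  ultimately show ?thesis using assms(1) unfolding taylor_bounded_def by auto
qed

lemma taylor_bounded_const:
  assumes "0 \<le> C" shows "taylor_bounded S \<xi> (\<lambda>_. c) (cmod c) C"
  unfolding taylor_bounded_def
proof (intro conjI exI[of _ "\<lambda>k. if k = 0 then c else 0"] allI ballI)
  fix N x
  show "cmod (c - (\<Sum>k<N. (x - \<xi>) ^ k * (if k = 0 then c else 0))) \<le> cmod c * C ^ N * cmod (x - \<xi>) ^ N"
  proof (cases N)
    case (Suc M)
    have "(\<Sum>k<N. (x - \<xi>) ^ k * (if k = 0 then c else 0)) = c"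
      unfolding Suc sum.lessThan_Suc_shift by simp
    thus ?thesis using assms by simp
  qed simp
qed auto

lemma taylor_bounded_add:
  assumes "taylor_bounded S \<xi> \<phi> A C" "taylor_bounded S \<xi> \<psi> A' C"
  shows "taylor_bounded S \<xi> (\<lambda>x. \<phi> x + \<psi> x) (A + A') C"
proof -
  obtain b where
    b: "\<And>N x. x \<in> S \<Longrightarrow> cmod (\<phi> x - (\<Sum>k<N. (x - \<xi>) ^ k * b k)) \<le> A * C ^ N * cmod (x - \<xi>) ^ N"
    using assms(1) unfolding taylor_bounded_def by blast
  obtain b' where
    b': "\<And>N x. x \<in> S \<Longrightarrow> cmod (\<psi> x - (\<Sum>k<N. (x - \<xi>) ^ k * b' k)) \<le> A' * C ^ N * cmod (x - \<xi>) ^ N"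
    using assms(2) unfolding taylor_bounded_def by blast
  have "cmod (\<phi> x + \<psi> x - (\<Sum>k<N. (x - \<xi>) ^ k * (b k + b' k))) \<le> (A + A') * C ^ N * cmod (x - \<xi>) ^ N"
    if "x \<in> S" for N x
  proof -
    have "\<phi> x + \<psi> x - (\<Sum>k<N. (x - \<xi>) ^ k * (b k + b' k))
      = (\<phi> x - (\<Sum>k<N. (x - \<xi>) ^ k * b k)) + (\<psi> x - (\<Sum>k<N. (x - \<xi>) ^ k * b' k))"
      by (simp add: sum.distrib distrib_left)
    also have "cmod \<dots> \<le> A * C ^ N * cmod (x - \<xi>) ^ N + A' * C ^ N * cmod (x - \<xi>) ^ N"
      by (rule order_trans[OF norm_triangle_ineq add_mono[OF b[OF that] b'[OF that]]])
    finally show ?thesis by (simp add: algebra_simps)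
  qed
  moreover have "(\<lambda>x. \<phi> x + \<psi> x) holomorphic_on S"
    using assms unfolding taylor_bounded_def by (intro holomorphic_intros) auto
  ultimately show ?thesis unfolding taylor_bounded_def
    by (intro conjI exI[of _ "\<lambda>k. b k + b' k"]) auto
qed

lemma taylor_bounded_cmult:
  assumes "taylor_bounded S \<xi> \<phi> A C"
  shows "taylor_bounded S \<xi> (\<lambda>x. c * \<phi> x) (cmod c * A) C"
proof -
  obtain b where
    b: "\<And>N x. x \<in> S \<Longrightarrow> cmod (\<phi> x - (\<Sum>k<N. (x - \<xi>) ^ k * b k)) \<le> A * C ^ N * cmod (x - \<xi>) ^ N"
    using assms unfolding taylor_bounded_def by blast
  have "cmod (c * \<phi> x - (\<Sum>k<N. (x - \<xi>) ^ k * (c * b k))) \<le> cmod c * A * C ^ N * cmod (x - \<xi>) ^ N"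
    if "x \<in> S" for N x
  proof -
    have "c * \<phi> x - (\<Sum>k<N. (x - \<xi>) ^ k * (c * b k)) = c * (\<phi> x - (\<Sum>k<N. (x - \<xi>) ^ k * b k))"
      by (simp add: right_diff_distrib sum_distrib_left mult_ac)
    thus ?thesis using mult_left_mono[OF b[OF that, of N] norm_ge_zero[of c]]
      by (simp add: norm_mult mult.assoc)
  qed
  moreover have "(\<lambda>x. c * \<phi> x) holomorphic_on S"
    using assms unfolding taylor_bounded_def by (intro holomorphic_intros) auto
  ultimately show ?thesis unfolding taylor_bounded_def
    by (intro conjI exI[of _ "\<lambda>k. c * b k"]) auto
qed

lemma taylor_bounded_sum:
  assumes "finite I" "\<And>i. i \<in> I \<Longrightarrow> taylor_bounded S \<xi> (\<phi> i) A C" "0 \<le> C"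
  shows "taylor_bounded S \<xi> (\<lambda>x. \<Sum>i\<in>I. \<phi> i x) (real (card I) * A) C"
  using assms(1,2)
proof (induction I)
  case empty
  show ?case using taylor_bounded_const[OF assms(3), of S \<xi> 0] by simp
next
  case (insert i I)
  thus ?case using taylor_bounded_add[of S \<xi> "\<phi> i" A C "\<lambda>x. \<Sum>i\<in>I. \<phi> i x" "real (card I) * A"]
    by (simp add: algebra_simps)
qed

lemma taylor_bounded_affine:
  assumes e: "cmod e = 1" and tb: "taylor_bounded (tangent_disks 0 1) 0 (\<lambda>v. \<phi> (\<xi> + e * v)) A C"
  shows "taylor_bounded (tangent_disks \<xi> e) \<xi> \<phi> A C"
proof -
  have e0: "e \<noteq> 0" using e by auto
  obtain b where
    b: "\<And>N v. v \<in> tangent_disks 0 1 \<Longrightarrow>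
          cmod (\<phi> (\<xi> + e * v) - (\<Sum>k<N. (v - 0) ^ k * b k)) \<le> A * C ^ N * cmod (v - 0) ^ N"
    using tb unfolding taylor_bounded_def by blast
  have inv: "\<xi> + e * ((x - \<xi>) / e) = x" for x using e0 by simp
  have "((\<lambda>v. \<phi> (\<xi> + e * v)) \<circ> (\<lambda>x. (x - \<xi>) / e)) holomorphic_on tangent_disks \<xi> e"
  proof (rule holomorphic_on_compose_gen)
    show "(\<lambda>x. (x - \<xi>) / e) holomorphic_on tangent_disks \<xi> e"
      using e0 by (intro holomorphic_intros)
    show "(\<lambda>v. \<phi> (\<xi> + e * v)) holomorphic_on tangent_disks 0 1"
      using tb unfolding taylor_bounded_def by blast
  qed (use in_tangent_disks_iff[OF e] in auto)
  hence "\<phi> holomorphic_on tangent_disks \<xi> e" by (simp add: o_def e0)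
  moreover have "cmod (\<phi> x - (\<Sum>k<N. (x - \<xi>) ^ k * (b k / e ^ k))) \<le> A * C ^ N * cmod (x - \<xi>) ^ N"
    if "x \<in> tangent_disks \<xi> e" for N x
    using b[OF that[unfolded in_tangent_disks_iff[OF e]], of N] e e0
    by (simp add: inv power_divide norm_divide)
  ultimately show ?thesis unfolding taylor_bounded_def
    by (intro conjI exI[of _ "\<lambda>k. b k / e ^ k"]) auto
qed

text \<open>The expansion is the geometric series of 1 / (v - p) at 0, whose N-th remainder is
  exactly (v / p)^N / (v - p). The last factor is bounded by the distance estimate, the first gives
  the ratio 1 / |p|.\<close>

lemma taylor_bounded_pole:
  assumes p: "\<bar>Re p\<bar> \<le> (cmod p)\<^sup>2" "p \<noteq> 0" "cmod p \<le> 2"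
  shows "taylor_bounded (tangent_disks 0 1) 0 (\<lambda>v. 1 / (v - p)) (4 / (cmod p)\<^sup>2) (1 / cmod p)"
  unfolding taylor_bounded_def
proof (intro conjI exI[of _ "\<lambda>k. - (1 / p ^ (k + 1))"] allI ballI)
  have ge: "cmod (v - p) \<ge> (cmod p)\<^sup>2 / 4" if "v \<in> tangent_disks 0 1" for v
    by (rule dist_tangent_disks_ge[OF that p])
  have nz: "v - p \<noteq> 0" if "v \<in> tangent_disks 0 1" for v
    using ge[OF that] p(2) by auto
  show "(\<lambda>v. 1 / (v - p)) holomorphic_on tangent_disks 0 1"
    by (intro holomorphic_intros) (use nz in auto)
  fix N v assume v: "v \<in> tangent_disks 0 1"
  have "1 / (v - p) - (\<Sum>k<N. v ^ k * - (1 / p ^ (k + 1))) = (v / p) ^ N / (v - p)"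
  proof (induction N)
    case (Suc N)
    have "1 / (v - p) - (\<Sum>k<Suc N. v ^ k * - (1 / p ^ (k + 1)))
        = (v / p) ^ N / (v - p) + (v / p) ^ N / p"
      by (subst Suc[symmetric]) (simp add: power_divide)
    also have "\<dots> = (v / p) ^ N * (1 / (v - p) + 1 / p)" by (simp add: distrib_left)
    also have "1 / (v - p) + 1 / p = (v / p) / (v - p)" using nz[OF v] p(2) by (simp add: field_simps)
    finally show ?case by simp
  qed simp
  hence "cmod (1 / (v - p) - (\<Sum>k<N. v ^ k * - (1 / p ^ (k + 1))))
      = cmod ((v / p) ^ N / (v - p))" by (rule arg_cong)
  also have "\<dots> = (1 / cmod (v - p)) * ((1 / cmod p) ^ N * cmod v ^ N)"
    by (simp only: norm_divide norm_power power_divide) simp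
  also have "\<dots> \<le> (4 / (cmod p)\<^sup>2) * ((1 / cmod p) ^ N * cmod v ^ N)"
  proof (rule mult_right_mono)
    have "1 / cmod (v - p) \<le> 1 / ((cmod p)\<^sup>2 / 4)"
      using ge[OF v] p(2) by (intro divide_left_mono) (auto intro!: mult_pos_pos nz[OF v, simplified])
    thus "1 / cmod (v - p) \<le> 4 / (cmod p)\<^sup>2" by simp
  qed auto
  finally show "cmod (1 / (v - p) - (\<Sum>k<N. (v - 0) ^ k * - (1 / p ^ (k + 1))))
      \<le> 4 / (cmod p)\<^sup>2 * (1 / cmod p) ^ N * cmod (v - 0) ^ N" by (simp add: mult.assoc)
qed

text \<open>Partial fractions at the two square roots p and -p of P: the prefactor 1 / (2p) and two
  poles with bound 4 / |p|^2 give 4 / |p|^3. The ratio is 1 / sqrt |P| instead of 1 / |P|, which is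
  the gain of the cardioid coordinate.\<close>

lemma taylor_bounded_quadratic_pole:
  assumes P: "\<bar>Re (csqrt P)\<bar> \<le> cmod P" "P \<noteq> 0" "cmod P \<le> 2"
  shows "taylor_bounded (tangent_disks 0 1) 0 (\<lambda>v. 1 / (v\<^sup>2 - P)) (4 / sqrt (cmod P) ^ 3) (1 / sqrt (cmod P))"
proof -
  define p where "p = csqrt P"
  have pP: "p\<^sup>2 = P" by (simp add: p_def)
  have np: "cmod p = sqrt (cmod P)" using pP by (metis norm_ge_zero norm_power real_sqrt_unique)
  hence np2: "(cmod p)\<^sup>2 = cmod P" by simp
  have p0: "p \<noteq> 0" using pP P(2) by auto
  have "(cmod p)\<^sup>2 \<le> 2\<^sup>2" using np2 P(3) by simp
  hence p2: "cmod p \<le> 2" by (rule power2_le_imp_le) simp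
  have tb: "taylor_bounded (tangent_disks 0 1) 0 (\<lambda>v. 1 / (v - s * p)) (4 / (cmod p)\<^sup>2) (1 / cmod p)"
    if "s = 1 \<or> s = -1" for s :: complex
    using taylor_bounded_pole[of "s * p"] that P(1) p0 p2 np2 by (auto simp: p_def)
  have eq: "1 / (2 * p) * (1 / (v - 1 * p) + (-1) * (1 / (v - (-1) * p))) = 1 / (v\<^sup>2 - P)"
    if "v \<in> tangent_disks 0 1" for v
  proof -
    have "v - p \<noteq> 0" "v + p \<noteq> 0"
      using dist_tangent_disks_ge[OF that, of p] dist_tangent_disks_ge[OF that, of "- p"] P(1) p0 p2 np2
      by (auto simp: p_def)
    moreover have "v\<^sup>2 - P = (v - p) * (v + p)" using pP by (simp add: power2_eq_square algebra_simps)
    ultimately show ?thesis using p0 by (simp add: field_simps)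
  qed
  have "taylor_bounded (tangent_disks 0 1) 0
     (\<lambda>v. 1 / (2 * p) * (1 / (v - 1 * p) + (-1) * (1 / (v - (-1) * p))))
     (cmod (1 / (2 * p)) * (4 / (cmod p)\<^sup>2 + cmod (-1) * (4 / (cmod p)\<^sup>2))) (1 / cmod p)"
    by (intro taylor_bounded_cmult taylor_bounded_add tb) auto
  moreover have "cmod (1 / (2 * p)) * (4 / (cmod p)\<^sup>2 + cmod (-1) * (4 / (cmod p)\<^sup>2)) = 4 / sqrt (cmod P) ^ 3"
    using p0 unfolding np[symmetric] by (simp add: norm_divide norm_mult power2_eq_square power3_eq_cube)
  ultimately have "taylor_bounded (tangent_disks 0 1) 0
     (\<lambda>v. 1 / (2 * p) * (1 / (v - 1 * p) + (-1) * (1 / (v - (-1) * p)))) (4 / sqrt (cmod P) ^ 3) (1 / cmod p)"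
    by (simp only:)
  thus ?thesis unfolding np by (rule taylor_bounded_cong) (use eq in simp)
qed

text \<open>The equation |P|^2 = 2 |Im P| describes unit circles through 0 tangent to the real axis,
  and Re P \<le> 0 selects an arc. With csqrt P = a + i b and m = |P|, the sign of Re P gives b^2
  \<ge> m / 2 and the equation gives 4 |a b| = m^2; hence a^2 \<le> m^3 / 8 \<le> m^2.\<close>

lemma Re_csqrt_le:
  assumes P: "Re P \<le> 0" "(cmod P)\<^sup>2 = 2 * \<bar>Im P\<bar>" "cmod P \<le> 2"
  shows "\<bar>Re (csqrt P)\<bar> \<le> cmod P"
proof (cases "P = 0")
  case False
  define s where "s = csqrt P"
  define a where "a = Re s"
  define b where "b = Im s"
  define m where "m = cmod P"
  have m: "m > 0" "m \<le> 2" using False P by (auto simp: m_def)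
  have s2: "P = s\<^sup>2" by (simp add: s_def)
  have eq: "a\<^sup>2 - b\<^sup>2 = Re P" "2 * (a * b) = Im P"
    unfolding s2 by (simp_all add: a_def b_def power2_eq_square)
  have "cmod s ^ 2 = m" by (simp add: m_def s2 norm_power)
  hence ab: "a\<^sup>2 + b\<^sup>2 = m" by (simp add: cmod_power2 a_def b_def)
  have b2: "m / 2 \<le> b\<^sup>2" using eq(1) ab P(1) by simp
  have "4 * \<bar>a * b\<bar> = m\<^sup>2" using P(2) eq(2) by (simp add: m_def)
  hence "(4 * \<bar>a * b\<bar>)\<^sup>2 = (m\<^sup>2)\<^sup>2" by simp
  hence "a\<^sup>2 * b\<^sup>2 = (m\<^sup>2)\<^sup>2 / 16" by (simp add: power_mult_distrib)
  moreover have "a\<^sup>2 * (m / 2) \<le> a\<^sup>2 * b\<^sup>2" using b2 by (intro mult_left_mono) auto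
  ultimately have "a\<^sup>2 * m \<le> (m * m\<^sup>2 / 8) * m" by (simp add: power2_eq_square)
  hence "a\<^sup>2 \<le> m * m\<^sup>2 / 8" using m(1) by (rule mult_right_le_imp_le)
  also have "\<dots> \<le> m\<^sup>2" using mult_right_mono[OF m(2), of "m\<^sup>2"] m by simp
  finally have "\<bar>a\<bar> \<le> \<bar>m\<bar>" by (simp add: abs_le_square_iff)
  thus ?thesis using m by (simp add: a_def m_def s_def)
qed simp

lemma unit_minus_one:
  assumes "cmod \<zeta> = 1"
  shows "(cmod (\<zeta> - 1))\<^sup>2 = 2 - 2 * Re \<zeta>"
proof -
  have "(Re \<zeta>)\<^sup>2 + (Im \<zeta>)\<^sup>2 = 1" using assms by (metis cmod_power2 power_one)
  thus ?thesis unfolding cmod_power2 by (simp add: power2_eq_square algebra_simps)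
qed

lemma norm_div_minus_one:
  assumes "cmod \<xi> = 1" shows "cmod (\<Lambda> / \<xi> - 1) = cmod (\<Lambda> - \<xi>)"
proof -
  have "\<xi> \<noteq> 0" using assms by auto
  hence "\<Lambda> / \<xi> - 1 = (\<Lambda> - \<xi>) / \<xi>" by (simp add: field_simps)
  thus ?thesis using assms by (simp add: norm_divide)
qed

lemma taylor_bounded_unit_pole:
  assumes \<xi>: "cmod \<xi> = 1" and \<Lambda>: "cmod \<Lambda> = 1 \<or> \<Lambda> = 0" "\<Lambda> \<noteq> \<xi>"
  shows "taylor_bounded (tangent_disks \<xi> \<xi>) \<xi> (\<lambda>q. 1 / (q - \<Lambda>)) (4 / (cmod (\<Lambda> - \<xi>))\<^sup>2) (1 / cmod (\<Lambda> - \<xi>))"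
proof (rule taylor_bounded_affine[OF \<xi>])
  have \<xi>0: "\<xi> \<noteq> 0" using \<xi> by auto
  define p where "p = \<Lambda> / \<xi> - 1"
  have np: "cmod p = cmod (\<Lambda> - \<xi>)" unfolding p_def by (rule norm_div_minus_one[OF \<xi>])
  have "cmod p \<le> 2" using norm_triangle_ineq4[of \<Lambda> \<xi>] \<xi> \<Lambda> np by auto
  moreover have "\<bar>Re p\<bar> \<le> (cmod p)\<^sup>2"
  proof (cases "\<Lambda> = 0")
    case False
    hence "cmod (\<Lambda> / \<xi>) = 1" using \<xi> \<Lambda> by (simp add: norm_divide)
    moreover from this have "Re (\<Lambda> / \<xi>) \<le> 1" by (metis complex_Re_le_cmod)
    ultimately show ?thesis using unit_minus_one[of "\<Lambda> / \<xi>"] by (simp add: p_def)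
  qed (simp add: p_def)
  moreover have "p \<noteq> 0" using np \<Lambda> by auto
  ultimately have "taylor_bounded (tangent_disks 0 1) 0 (\<lambda>v. (1 / \<xi>) * (1 / (v - p)))
      (cmod (1 / \<xi>) * (4 / (cmod p)\<^sup>2)) (1 / cmod p)"
    by (intro taylor_bounded_cmult taylor_bounded_pole)
  moreover have "(1 / \<xi>) * (1 / (v - p)) = 1 / (\<xi> + \<xi> * v - \<Lambda>)" for v
    using \<xi>0 by (simp add: p_def right_diff_distrib algebra_simps)
  ultimately show "taylor_bounded (tangent_disks 0 1) 0 (\<lambda>v. 1 / (\<xi> + \<xi> * v - \<Lambda>))
     (4 / (cmod (\<Lambda> - \<xi>))\<^sup>2) (1 / cmod (\<Lambda> - \<xi>))"
    using \<xi> by (simp add: np norm_divide)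
qed

text \<open>
  Here \<open>\<epsilon> = 1\<close> and \<open>\<epsilon> = -1\<close> parametrize the cardioids of \<open>gevrey_lt\<close> and \<open>gevrey_gt\<close>.
\<close>

lemma taylor_bounded_cardioid_pole:
  assumes \<xi>: "cmod \<xi> = 1" and \<epsilon>: "\<epsilon> = 1 \<or> \<epsilon> = -1"
    and \<Lambda>: "cmod \<Lambda> = 1 \<and> \<epsilon> * Im (\<Lambda> / \<xi>) \<le> 0 \<or> \<Lambda> = 0" "\<Lambda> \<noteq> \<xi>"
  shows "taylor_bounded (tangent_disks 1 1) 1 (\<lambda>u. 1 / (\<xi> * (1 + of_real \<epsilon> * \<i> * (u - 1)\<^sup>2) - \<Lambda>))
           (4 / sqrt (cmod (\<Lambda> - \<xi>)) ^ 3) (1 / sqrt (cmod (\<Lambda> - \<xi>)))"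
proof (rule taylor_bounded_affine)
  have \<xi>0: "\<xi> \<noteq> 0" using \<xi> by auto
  define c where "c = complex_of_real \<epsilon> * \<i>"
  have c: "c \<noteq> 0" "cmod c = 1" "1 / c = - c" using \<epsilon> by (auto simp: c_def)
  \<comment> \<open>P is the value of v^2 at the pole: \<xi> (1 + c v^2) - \<Lambda> = \<xi> c (v^2
    - P).\<close>
  define P where "P = (\<Lambda> / \<xi> - 1) / c"
  have nP: "cmod P = cmod (\<Lambda> - \<xi>)"
    unfolding P_def norm_divide c(2) by (simp add: norm_div_minus_one[OF \<xi>])
  have P2: "cmod P \<le> 2" using norm_triangle_ineq4[of \<Lambda> \<xi>] \<xi> \<Lambda> nP by auto
  have Pc: "P = - c * (\<Lambda> / \<xi> - 1)" using c(3) by (simp add: P_def divide_inverse)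
  have Re: "\<bar>Re (csqrt P)\<bar> \<le> cmod P"
  proof (cases "\<Lambda> = 0")
    case False
    have u: "cmod (\<Lambda> / \<xi>) = 1" using \<xi> \<Lambda> False by (simp add: norm_divide)
    hence le: "Re (\<Lambda> / \<xi>) \<le> 1" by (metis complex_Re_le_cmod)
    show ?thesis
    proof (rule Re_csqrt_le[OF _ _ P2])
      show "Re P \<le> 0" using \<Lambda> \<epsilon> False unfolding Pc c_def by auto
      have "(cmod P)\<^sup>2 = 2 - 2 * Re (\<Lambda> / \<xi>)"
        using unit_minus_one[OF u] norm_div_minus_one[OF \<xi>] nP by simp
      moreover have "\<bar>Im P\<bar> = 1 - Re (\<Lambda> / \<xi>)" using \<epsilon> le unfolding Pc c_def by auto
      ultimately show "(cmod P)\<^sup>2 = 2 * \<bar>Im P\<bar>" by simp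
    qed
  next
    \<comment> \<open>For \<Lambda> = 0 both P and its square root have modulus 1, and the bound is
      the trivial one.\<close>
    case True
    have "cmod P = 1" using True \<xi> nP by simp
    moreover have "cmod (csqrt P) ^ 2 = cmod P" by (metis norm_power power2_csqrt)
    ultimately have "cmod (csqrt P) = 1"
      by (metis norm_ge_zero power2_eq_imp_eq power_one zero_le_one)
    thus ?thesis using abs_Re_le_cmod[of "csqrt P"] \<open>cmod P = 1\<close> by simp
  qed
  have "P \<noteq> 0" using nP \<Lambda> by auto
  hence "taylor_bounded (tangent_disks 0 1) 0 (\<lambda>v. (1 / (\<xi> * c)) * (1 / (v\<^sup>2 - P)))
      (cmod (1 / (\<xi> * c)) * (4 / sqrt (cmod P) ^ 3)) (1 / sqrt (cmod P))"
    by (intro taylor_bounded_cmult taylor_bounded_quadratic_pole Re P2)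
  moreover have "(1 / (\<xi> * c)) * (1 / (v\<^sup>2 - P)) = 1 / (\<xi> * (1 + c * v\<^sup>2) - \<Lambda>)" for v
  proof -
    have "\<xi> * c * (v\<^sup>2 - P) = \<xi> * (1 + c * v\<^sup>2) - \<Lambda>"
    proof -
      have "c * P = \<Lambda> / \<xi> - 1" using c(1) by (simp add: P_def)
      hence "\<xi> * (c * P) = \<Lambda> - \<xi>" using \<xi>0 by (simp add: right_diff_distrib)
      moreover have "\<xi> * c * (v\<^sup>2 - P) = \<xi> * c * v\<^sup>2 - \<xi> * (c * P)" by (simp add: algebra_simps)
      ultimately show ?thesis using \<xi>0 by (simp add: algebra_simps)
    qed
    thus ?thesis by simp
  qed
  ultimately show "taylor_bounded (tangent_disks 0 1) 0
     (\<lambda>v. 1 / (\<xi> * (1 + complex_of_real \<epsilon> * \<i> * (1 + 1 * v - 1)\<^sup>2) - \<Lambda>))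
     (4 / sqrt (cmod (\<Lambda> - \<xi>)) ^ 3) (1 / sqrt (cmod (\<Lambda> - \<xi>)))"
    using \<xi> c(2) by (simp add: nP norm_divide norm_mult c_def)
qed simp

section \<open>Roots of unity and Diophantine points\<close>

text \<open>The double angle formula with y = s / 2: on ]0, pi / 4] both cos y and sin y / y are at
  least sqrt 2 / 2.\<close>

lemma half_le_sin:
  assumes "0 \<le> s" "s \<le> pi / 2" shows "s / 2 \<le> sin s"
proof (cases "s = 0")
  case False
  define y where "y = s / 2"
  have y: "0 < y" "y \<le> pi / 4" using assms False by (auto simp: y_def)
  have cosge: "cos x \<ge> sqrt 2 / 2" if "0 \<le> x" "x \<le> y" for x
    using cos_monotone_0_pi_le[of x "pi / 4"] that y by (simp add: cos_45)
  obtain c where c: "0 < c" "c < y" "sin y - sin 0 = (y - 0) * cos c"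
    using MVT2[of 0 y sin cos] y(1) by auto
  have "y * (sqrt 2 / 2) \<le> sin y" using c y cosge[of c] by (simp add: mult_left_mono)
  hence "y * (sqrt 2 / 2) * (sqrt 2 / 2) \<le> sin y * cos y"
    using y cosge[of y] by (intro mult_mono sin_ge_zero) auto
  moreover have "sin s = 2 * sin y * cos y" unfolding sin_double[symmetric] by (simp add: y_def)
  moreover have "y * (sqrt 2 / 2) * (sqrt 2 / 2) = y * (sqrt 2 * sqrt 2) / 4" by simp
  hence "y * (sqrt 2 / 2) * (sqrt 2 / 2) = y / 2" by simp
  ultimately show ?thesis using y_def by linarith
qed simp

lemma norm_cis_minus_one_ge:
  assumes "\<bar>t\<bar> \<le> 1 / 2"
  shows "cmod (cis (2 * pi * t) - 1) \<ge> 2 * \<bar>t\<bar>"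
proof -
  have "cmod (cis (2 * pi * t) - 1) = 2 * \<bar>sin (pi * t)\<bar>"
    using dist_exp_i_1[of "2 * pi * t"] by (simp add: cis_conv_exp)
  also have "\<bar>sin (pi * t)\<bar> = sin (pi * \<bar>t\<bar>)"
  proof -
    have "0 \<le> sin (pi * \<bar>t\<bar>)" using assms by (intro sin_ge_zero) (auto simp: mult_le_cancel_left1)
    thus ?thesis by (cases "t \<ge> 0") auto
  qed
  also have "sin (pi * \<bar>t\<bar>) \<ge> pi * \<bar>t\<bar> / 2" using assms by (intro half_le_sin) auto
  moreover have "2 * \<bar>t\<bar> \<le> pi * \<bar>t\<bar>" using pi_ge_two by (intro mult_right_mono) auto
  ultimately show ?thesis by linarith
qed

lemma norm_power_diff_le:
  fixes x y :: complex
  assumes "cmod x = 1" "cmod y = 1"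
  shows "cmod (x ^ n - y ^ n) \<le> real n * cmod (x - y)"
  using norm_power_diff[of x y n] assms by simp

lemma norm_root_of_unity: "\<Lambda> \<in> roots_of_unity n \<Longrightarrow> n \<ge> 1 \<Longrightarrow> cmod \<Lambda> = 1"
  using power_eq_1_iff[of \<Lambda> n] by (simp add: roots_of_unity_def)

lemma finite_roots_of_unity: "n \<ge> 1 \<Longrightarrow> finite (roots_of_unity n)"
  unfolding roots_of_unity_def by (rule finite_nth_roots) simp

lemma card_roots_of_unity: "n \<ge> 1 \<Longrightarrow> card (roots_of_unity n) = n"
  unfolding roots_of_unity_def using card_nth_roots[of 1 n] by simp

text \<open>Both points are raised to the n-th power, so no argument of \<Lambda> has to be chosen.
  With t the signed distance of n y from the nearest integer k, 2 |t| \<le> |\<xi>^n - 1| = |\<xi>^n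
  - \<Lambda>^n| \<le> n |\<xi> - \<Lambda>|; division by n compares |y - k / n| with |\<xi> -
  \<Lambda>|.\<close>

lemma DC2_dist_roots:
  assumes "\<xi> \<in> DC2"
  obtains \<gamma> where "0 < \<gamma>" "\<gamma> \<le> 1" "cmod \<xi> = 1"
    "\<And>n \<Lambda>. n \<ge> 1 \<Longrightarrow> \<Lambda> \<in> roots_of_unity n \<Longrightarrow> cmod (\<Lambda> - \<xi>) \<ge> \<gamma> / (real n)\<^sup>2"
proof -
  obtain y \<gamma> where y: "\<xi> = cis (2 * pi * y)" "\<gamma> > 0"
    and dio: "\<And>k::int. \<And>m::nat. m \<ge> 1 \<Longrightarrow> \<bar>y - of_int k / real m\<bar> \<ge> \<gamma> / (real m)\<^sup>2"
    using assms unfolding DC2_def by blast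
  have "cmod (\<Lambda> - \<xi>) \<ge> min \<gamma> 1 / (real n)\<^sup>2" if n: "n \<ge> 1" and \<Lambda>: "\<Lambda> \<in> roots_of_unity n" for n \<Lambda>
  proof -
    define k where "k = round (real n * y)"
    define t where "t = real n * y - of_int k"
    have t: "\<bar>t\<bar> \<le> 1 / 2" using of_int_round_abs_le[of "real n * y"] by (simp add: t_def k_def abs_minus_commute)
    have "\<xi> ^ n = cis (2 * pi * (real n * y))" by (simp only: y(1) Complex.DeMoivre) (simp add: mult_ac)
    also have "\<dots> = cis (2 * pi * t) * cis (2 * pi * of_int k)"
      by (simp add: t_def cis_mult algebra_simps)
    also have "cis (2 * pi * of_int k) = 1" by (rule cis_multiple_2pi) simp
    finally have "cmod (\<xi> ^ n - 1) \<ge> 2 * \<bar>t\<bar>" using norm_cis_minus_one_ge[OF t] by simp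
    moreover have "cmod (\<Lambda> ^ n - \<xi> ^ n) \<le> real n * cmod (\<Lambda> - \<xi>)"
      by (rule norm_power_diff_le) (use norm_root_of_unity[OF \<Lambda> n] y in auto)
    moreover have "\<Lambda> ^ n = 1" using \<Lambda> by (simp add: roots_of_unity_def)
    ultimately have "\<bar>t\<bar> \<le> real n * cmod (\<Lambda> - \<xi>)" by (simp add: norm_minus_commute)
    moreover have "t = real n * (y - of_int k / real n)" using n by (simp add: t_def field_simps)
    hence "\<bar>t\<bar> = real n * \<bar>y - of_int k / real n\<bar>" by (simp add: abs_mult)
    ultimately have "\<bar>y - of_int k / real n\<bar> \<le> cmod (\<Lambda> - \<xi>)" using n by simp
    hence "\<gamma> / (real n)\<^sup>2 \<le> cmod (\<Lambda> - \<xi>)" using dio[OF n, of k] by linarith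
    moreover have "min \<gamma> 1 / (real n)\<^sup>2 \<le> \<gamma> / (real n)\<^sup>2" by (intro divide_right_mono) auto
    ultimately show ?thesis by linarith
  qed
  \<comment> \<open>With \<gamma> at most 1, the factor 1 / \<gamma> later absorbs the constants of
    the pole at 0.\<close>
  thus ?thesis using y by (intro that[of "min \<gamma> 1"]) auto
qed

text \<open>The powers of \<zeta> sum to 0, hence m is the sum of the 1 - \<zeta>^j over j < m. Each
  term is at most m |\<zeta> - 1|, so m \<le> m^2 |\<zeta> - 1|.\<close>

lemma root_of_unity_dist:
  fixes \<zeta> :: complex
  assumes "\<zeta> ^ m = 1" "\<zeta> \<noteq> 1" "m \<ge> 1"
  shows "cmod (\<zeta> - 1) \<ge> 1 / real m"
proof -
  have n: "cmod \<zeta> = 1" using power_eq_1_iff[of \<zeta> m] assms by simp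
  have "(\<Sum>j<m. \<zeta> ^ j) = 0" using assms geometric_sum[of \<zeta> m] by simp
  hence "of_nat m = (\<Sum>j<m. 1 ^ j - \<zeta> ^ j)" by (simp add: sum_subtractf)
  hence "real m = cmod (\<Sum>j<m. 1 ^ j - \<zeta> ^ j)" by (metis norm_of_nat)
  also have "\<dots> \<le> (\<Sum>j<m. cmod (1 ^ j - \<zeta> ^ j))" by (rule norm_sum)
  also have "\<dots> \<le> (\<Sum>j<m. real m * cmod (\<zeta> - 1))"
  proof (rule sum_mono)
    fix j assume "j \<in> {..<m}"
    have "cmod (1 ^ j - \<zeta> ^ j) \<le> real j * cmod (1 - \<zeta>)"
      by (rule norm_power_diff_le) (use n in auto)
    also have "\<dots> \<le> real m * cmod (1 - \<zeta>)" using \<open>j \<in> {..<m}\<close> by (intro mult_right_mono) auto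
    finally show "cmod (1 ^ j - \<zeta> ^ j) \<le> real m * cmod (\<zeta> - 1)" by (simp add: norm_minus_commute)
  qed
  also have "\<dots> = real m * (real m * cmod (\<zeta> - 1))" by simp
  finally have "1 \<le> real m * cmod (\<zeta> - 1)" using assms(3) by (simp add: mult_le_cancel_left1)
  thus ?thesis using assms(3) by (simp add: field_simps)
qed

section \<open>Taylor bounds for the three families of pole sums\<close>

lemma tangent_disks_norm:
  assumes "cmod \<xi> = 1" "q \<in> tangent_disks \<xi> \<xi>"
  shows "cmod q \<noteq> 1" "q \<noteq> 0"
proof -
  have "cmod q > 1" if "q \<in> ball (\<xi> + \<xi> / 4) (1 / 4)"
  proof -
    have "\<xi> + \<xi> / 4 = 5 / 4 * \<xi>" by simp
    hence "cmod (\<xi> + \<xi> / 4) = 5 / 4" using assms(1) by (simp add: norm_mult)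
    thus ?thesis using that norm_triangle_ineq2[of "\<xi> + \<xi> / 4" q] by (simp add: dist_norm)
  qed
  moreover have "cmod q < 1 \<and> cmod q > 0" if "q \<in> ball (\<xi> - \<xi> / 4) (1 / 4)"
  proof -
    have "\<xi> - \<xi> / 4 = 3 / 4 * \<xi>" by simp
    hence "cmod (\<xi> - \<xi> / 4) = 3 / 4" using assms(1) by (simp add: norm_mult)
    thus ?thesis using that norm_triangle_ineq2[of q "\<xi> - \<xi> / 4"] norm_triangle_ineq2[of "\<xi> - \<xi> / 4" q]
      by (auto simp: dist_norm norm_minus_commute)
  qed
  ultimately have "cmod q \<noteq> 1 \<and> cmod q > 0" using assms(2) unfolding tangent_disks_def by fastforce
  thus "cmod q \<noteq> 1" "q \<noteq> 0" by auto
qed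

lemma inverse_dist_bound:
  assumes "d \<ge> \<gamma> / real n ^ k" "n \<ge> 1" "0 < \<gamma>"
  shows "0 < d" "1 / d \<le> 1 / \<gamma> * real (n + 1) ^ k"
proof -
  have "0 < \<gamma> / real n ^ k" using assms by simp
  thus d: "0 < d" using assms(1) by linarith
  have "1 / d \<le> 1 / (\<gamma> / real n ^ k)" using assms d by (intro divide_left_mono) auto
  also have "\<dots> = 1 / \<gamma> * real n ^ k" by simp
  also have "\<dots> \<le> 1 / \<gamma> * real (n + 1) ^ k" using assms by (intro mult_left_mono power_mono) auto
  finally show "1 / d \<le> 1 / \<gamma> * real (n + 1) ^ k" .
qed

lemma taylor_bounded_family_sum:
  assumes "finite I" "card I \<le> n + 1" "0 \<le> A" "0 \<le> C"
    and "\<And>i. i \<in> I \<Longrightarrow> taylor_bounded S \<xi> (\<phi> i) (A * real (n + 1) ^ m) (C * real (n + 1) ^ \<tau>)"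
  shows "taylor_bounded S \<xi> (\<lambda>x. \<Sum>i\<in>I. \<phi> i x) (A * real (n + 1) ^ (m + 1)) (C * real (n + 1) ^ \<tau>)"
proof (rule taylor_bounded_mono)
  show "taylor_bounded S \<xi> (\<lambda>x. \<Sum>i\<in>I. \<phi> i x) (real (card I) * (A * real (n + 1) ^ m)) (C * real (n + 1) ^ \<tau>)"
    by (rule taylor_bounded_sum) (use assms in auto)
  have "real (card I) * (A * real (n + 1) ^ m) \<le> real (n + 1) * (A * real (n + 1) ^ m)"
    using assms by (intro mult_right_mono) auto
  thus "real (card I) * (A * real (n + 1) ^ m) \<le> A * real (n + 1) ^ (m + 1)" by (simp add: mult_ac)
qed (use assms in auto)

text \<open>The distance \<gamma> / n^2 enters the amplitude 4 / |\<Lambda> - \<xi>|^2 as n^4, and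
  the n poles add one more power, giving 5; it enters the ratio as n^2, whence order 2. The entry 1
  / q at n = 0 is for the constant term of chi.\<close>

lemma taylor_bounded_diophantine:
  assumes "\<xi> \<in> DC2"
  shows "\<exists>A\<ge>0. \<exists>C\<ge>0. \<forall>n. taylor_bounded (tangent_disks \<xi> \<xi>) \<xi>
    (\<lambda>q. if n = 0 then 1 / q else \<Sum>\<Lambda>\<in>roots_of_unity n. 1 / (q - \<Lambda>) - 1 / q)
    (A * real (n + 1) ^ 5) (C * real (n + 1) ^ 2)"
proof -
  obtain \<gamma> where \<gamma>: "0 < \<gamma>" "\<gamma> \<le> 1" and \<xi>: "cmod \<xi> = 1"
    and dist: "\<And>n \<Lambda>. n \<ge> 1 \<Longrightarrow> \<Lambda> \<in> roots_of_unity n \<Longrightarrow> cmod (\<Lambda> - \<xi>) \<ge> \<gamma> / (real n)\<^sup>2"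
    using DC2_dist_roots[OF assms] by metis
  let ?tb = "taylor_bounded (tangent_disks \<xi> \<xi>) \<xi>"
  have \<gamma>1: "1 \<le> 1 / \<gamma>" using \<gamma> by simp
  have zero: "?tb (\<lambda>q. 1 / q) (4 * (1 / \<gamma>)\<^sup>2 * real (n + 1) ^ k) (1 / \<gamma> * real (n + 1) ^ 2)" for n k
  proof (rule taylor_bounded_mono)
    show "?tb (\<lambda>q. 1 / q) 4 1"
      using taylor_bounded_unit_pole[OF \<xi>, of 0] \<xi> by fastforce
    have "1 * 1 \<le> (1 / \<gamma>)\<^sup>2 * real (n + 1) ^ k"
      using \<gamma>1 \<gamma> by (intro mult_mono one_le_power) auto
    thus "4 \<le> 4 * (1 / \<gamma>)\<^sup>2 * real (n + 1) ^ k" by simp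
    have "1 * 1 \<le> 1 / \<gamma> * real (n + 1) ^ 2" using \<gamma>1 \<gamma> by (intro mult_mono one_le_power) auto
    thus "1 \<le> 1 / \<gamma> * real (n + 1) ^ 2" by simp
  qed auto
  have root: "?tb (\<lambda>q. 1 / (q - \<Lambda>)) (4 * (1 / \<gamma>)\<^sup>2 * real (n + 1) ^ 4) (1 / \<gamma> * real (n + 1) ^ 2)"
    if n: "n \<ge> 1" and \<Lambda>: "\<Lambda> \<in> roots_of_unity n" for n \<Lambda>
  proof (rule taylor_bounded_mono)
    note d = inverse_dist_bound[OF dist[OF n \<Lambda>] n \<gamma>(1)]
    show "?tb (\<lambda>q. 1 / (q - \<Lambda>)) (4 / (cmod (\<Lambda> - \<xi>))\<^sup>2) (1 / cmod (\<Lambda> - \<xi>))"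
      using norm_root_of_unity[OF \<Lambda> n] d(1) by (intro taylor_bounded_unit_pole[OF \<xi>]) auto
    show "1 / cmod (\<Lambda> - \<xi>) \<le> 1 / \<gamma> * real (n + 1) ^ 2" by (rule d(2))
    have "(1 / cmod (\<Lambda> - \<xi>))\<^sup>2 \<le> (1 / \<gamma> * real (n + 1) ^ 2)\<^sup>2"
      by (rule power_mono[OF d(2)]) auto
    thus "4 / (cmod (\<Lambda> - \<xi>))\<^sup>2 \<le> 4 * (1 / \<gamma>)\<^sup>2 * real (n + 1) ^ 4"
      by (simp add: power_mult_distrib power_divide flip: power_mult)
  qed auto
  have "?tb (\<lambda>q. if n = 0 then 1 / q else \<Sum>\<Lambda>\<in>roots_of_unity n. 1 / (q - \<Lambda>) - 1 / q)
          (8 * (1 / \<gamma>)\<^sup>2 * real (n + 1) ^ 5) (1 / \<gamma> * real (n + 1) ^ 2)" for n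
  proof (cases "n = 0")
    case True
    thus ?thesis using taylor_bounded_mono[OF zero[of n 5], of "8 * (1 / \<gamma>)\<^sup>2 * real (n + 1) ^ 5" "1 / \<gamma> * real (n + 1) ^ 2"] \<gamma> by simp
  next
    case False
    hence n: "n \<ge> 1" by simp
    have "?tb (\<lambda>q. 1 / (q - \<Lambda>) - 1 / q) (8 * (1 / \<gamma>)\<^sup>2 * real (n + 1) ^ 4) (1 / \<gamma> * real (n + 1) ^ 2)"
      if "\<Lambda> \<in> roots_of_unity n" for \<Lambda>
      using taylor_bounded_add[OF root[OF n that] taylor_bounded_cmult[OF zero[of n 4], of "-1"]] by (simp add: mult.assoc)
    hence "?tb (\<lambda>q. \<Sum>\<Lambda>\<in>roots_of_unity n. 1 / (q - \<Lambda>) - 1 / q)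
          (8 * (1 / \<gamma>)\<^sup>2 * real (n + 1) ^ (4 + 1)) (1 / \<gamma> * real (n + 1) ^ 2)"
      using finite_roots_of_unity[OF n] card_roots_of_unity[OF n] \<gamma>
      by (intro taylor_bounded_family_sum) auto
    thus ?thesis using False by simp
  qed
  thus ?thesis using \<gamma> by (intro exI[of _ "8 * (1 / \<gamma>)\<^sup>2"] conjI exI[of _ "1 / \<gamma>"]) auto
qed

text \<open>The relevant distance is now sqrt (\<gamma>) / n: the amplitude 4 / sqrt (|\<Lambda> -
  \<xi>|)^3 costs n^3, the number of poles one more power, and the ratio only n, whence order 1. The
  entry at n = 0 vanishes because \<open>delta\<close> has no constant term.\<close>

lemma taylor_bounded_cardioid:
  assumes "\<xi> \<in> DC2" "\<epsilon> = 1 \<or> \<epsilon> = -1" and X: "\<And>\<Lambda>. \<Lambda> \<in> X \<Longrightarrow> \<epsilon> * Im (\<Lambda> / \<xi>) \<le> 0"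
  shows "\<exists>A\<ge>0. \<exists>C\<ge>0. \<forall>n. taylor_bounded (tangent_disks 1 1) 1
    (\<lambda>u. if n = 0 then 0 else \<Sum>\<Lambda>\<in>roots_of_unity n \<inter> X.
       1 / (\<xi> * (1 + of_real \<epsilon> * \<i> * (u - 1)\<^sup>2) - \<Lambda>) - 1 / (\<xi> * (1 + of_real \<epsilon> * \<i> * (u - 1)\<^sup>2)))
    (A * real (n + 1) ^ 4) (C * real (n + 1) ^ 1)"
proof -
  obtain \<gamma> where \<gamma>: "0 < \<gamma>" "\<gamma> \<le> 1" and \<xi>: "cmod \<xi> = 1"
    and dist: "\<And>n \<Lambda>. n \<ge> 1 \<Longrightarrow> \<Lambda> \<in> roots_of_unity n \<Longrightarrow> cmod (\<Lambda> - \<xi>) \<ge> \<gamma> / (real n)\<^sup>2"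
    using DC2_dist_roots[OF assms(1)] by metis
  let ?tb = "taylor_bounded (tangent_disks 1 1) 1"
  define q where "q = (\<lambda>u. \<xi> * (1 + of_real \<epsilon> * \<i> * (u - 1)\<^sup>2))"
  define s where "s = 1 / sqrt \<gamma>"
  have s: "1 \<le> s" using \<gamma> by (simp add: s_def)
  have zero: "?tb (\<lambda>u. 1 / q u) (4 * s ^ 3 * real (n + 1) ^ 3) (s * real (n + 1) ^ 1)" for n
  proof (rule taylor_bounded_mono)
    show "?tb (\<lambda>u. 1 / q u) 4 1"
      using taylor_bounded_cardioid_pole[OF \<xi> assms(2), of 0] \<xi> unfolding q_def by fastforce
    have "1 * 1 \<le> s ^ 3 * real (n + 1) ^ 3" using s by (intro mult_mono one_le_power) auto
    thus "4 \<le> 4 * s ^ 3 * real (n + 1) ^ 3" by simp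
    have "1 * 1 \<le> s * real (n + 1) ^ 1" using s by (intro mult_mono one_le_power) auto
    thus "1 \<le> s * real (n + 1) ^ 1" by simp
  qed auto
  have root: "?tb (\<lambda>u. 1 / (q u - \<Lambda>)) (4 * s ^ 3 * real (n + 1) ^ 3) (s * real (n + 1) ^ 1)"
    if n: "n \<ge> 1" and \<Lambda>: "\<Lambda> \<in> roots_of_unity n" "\<Lambda> \<in> X" for n \<Lambda>
  proof (rule taylor_bounded_mono)
    have "sqrt \<gamma> / real n ^ 1 \<le> sqrt (cmod (\<Lambda> - \<xi>))"
      using real_sqrt_le_mono[OF dist[OF n \<Lambda>(1)]] by (simp add: real_sqrt_divide)
    note d = inverse_dist_bound[OF this n, folded s_def]
    have g: "0 < sqrt \<gamma>" using \<gamma> by simp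
    show "?tb (\<lambda>u. 1 / (q u - \<Lambda>)) (4 / sqrt (cmod (\<Lambda> - \<xi>)) ^ 3) (1 / sqrt (cmod (\<Lambda> - \<xi>)))"
      unfolding q_def using norm_root_of_unity[OF \<Lambda>(1) n] d(1)[OF g] X[OF \<Lambda>(2)]
      by (intro taylor_bounded_cardioid_pole[OF \<xi> assms(2)]) auto
    show "1 / sqrt (cmod (\<Lambda> - \<xi>)) \<le> s * real (n + 1) ^ 1" by (rule d(2)[OF g])
    have "(1 / sqrt (cmod (\<Lambda> - \<xi>))) ^ 3 \<le> (s * real (n + 1) ^ 1) ^ 3"
      by (rule power_mono[OF d(2)[OF g]]) auto
    thus "4 / sqrt (cmod (\<Lambda> - \<xi>)) ^ 3 \<le> 4 * s ^ 3 * real (n + 1) ^ 3"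
      by (simp add: power_mult_distrib power_divide)
  qed auto
  have "?tb (\<lambda>u. if n = 0 then 0 else \<Sum>\<Lambda>\<in>roots_of_unity n \<inter> X. 1 / (q u - \<Lambda>) - 1 / q u)
          (8 * s ^ 3 * real (n + 1) ^ 4) (s * real (n + 1) ^ 1)" for n
  proof (cases "n = 0")
    case True
    show ?thesis
      using taylor_bounded_mono[OF taylor_bounded_const[of s "tangent_disks 1 1" 1 0], of "8 * s ^ 3"] s True by simp
  next
    case False
    hence n: "n \<ge> 1" by simp
    have "?tb (\<lambda>u. 1 / (q u - \<Lambda>) - 1 / q u) (8 * s ^ 3 * real (n + 1) ^ 3) (s * real (n + 1) ^ 1)"
      if "\<Lambda> \<in> roots_of_unity n \<inter> X" for \<Lambda>
      using taylor_bounded_add[OF root[OF n, of \<Lambda>] taylor_bounded_cmult[OF zero[of n], of "-1"]] that by (simp add: mult.assoc)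
    moreover have "card (roots_of_unity n \<inter> X) \<le> n + 1"
      using card_mono[OF finite_roots_of_unity[OF n], of "roots_of_unity n \<inter> X"] card_roots_of_unity[OF n] by simp
    ultimately have "?tb (\<lambda>u. \<Sum>\<Lambda>\<in>roots_of_unity n \<inter> X. 1 / (q u - \<Lambda>) - 1 / q u)
          (8 * s ^ 3 * real (n + 1) ^ (3 + 1)) (s * real (n + 1) ^ 1)"
      using finite_roots_of_unity[OF n] s by (intro taylor_bounded_family_sum) auto
    thus ?thesis using False by simp
  qed
  thus ?thesis using s unfolding q_def by (intro exI[of _ "8 * s ^ 3"] conjI exI[of _ s]) auto
qed

lemma primitive_subset_roots: "primitive_roots n \<subseteq> roots_of_unity n"
  by (auto simp: primitive_roots_def roots_of_unity_def)

text \<open>The factor q - \<xi> turns the pole at \<xi> itself into the constant 1, and otherwise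
  (q - \<xi>) / (q - \<Lambda>) = 1 + (\<Lambda> - \<xi>) / (q - \<Lambda>), where the numerator
  saves one power of the distance d: 1 + 4 / d \<le> 5 m (n + 1). The distance is at least 1 / (m n)
  because \<Lambda> / \<xi> is an (m n)-th root of unity.\<close>

lemma taylor_bounded_polar:
  assumes "\<xi> \<in> all_roots_of_unity"
  shows "\<exists>A\<ge>0. \<exists>C\<ge>0. \<forall>n. taylor_bounded (tangent_disks \<xi> \<xi>) \<xi>
    (\<lambda>q. if n = 0 then 0 else \<Sum>\<Lambda>\<in>primitive_roots n. (q - \<xi>) / (q - \<Lambda>))
    (A * real (n + 1) ^ 2) (C * real (n + 1) ^ 1)"
proof -
  obtain m where m: "m \<ge> 1" "\<xi> \<in> roots_of_unity m" using assms by (auto simp: all_roots_of_unity_def)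
  have \<xi>: "cmod \<xi> = 1" by (rule norm_root_of_unity[OF m(2,1)])
  let ?tb = "taylor_bounded (tangent_disks \<xi> \<xi>) \<xi>"
  have m1: "1 \<le> real m * real (n + 1)" for n using mult_mono[of 1 "real m" 1 "real (n + 1)"] m(1) by simp
  have one: "?tb (\<lambda>q. (q - \<xi>) / (q - \<xi>)) 1 (real m * real (n + 1) ^ 1)" for n
    by (rule taylor_bounded_cong[OF taylor_bounded_const[of _ _ _ 1, simplified]])
       (use base_notin_tangent_disks[OF \<xi>] in auto)
  have root: "?tb (\<lambda>q. (q - \<xi>) / (q - \<Lambda>)) (5 * real m * real (n + 1) ^ 1) (real m * real (n + 1) ^ 1)"
    if n: "n \<ge> 1" and \<Lambda>: "\<Lambda> \<in> roots_of_unity n" for n \<Lambda>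
  proof (cases "\<Lambda> = \<xi>")
    case True
    show ?thesis unfolding True
      by (rule taylor_bounded_mono[OF one]) (use m1[of n] m in auto)
  next
    case False
    define d where "d = cmod (\<Lambda> - \<xi>)"
    have \<xi>0: "\<xi> \<noteq> 0" using \<xi> by auto
    have "1 / real (m * n) \<le> cmod (\<Lambda> / \<xi> - 1)"
    proof (rule root_of_unity_dist)
      have "\<Lambda> ^ n = 1" "\<xi> ^ m = 1" using \<Lambda> m by (auto simp: roots_of_unity_def)
      thus "(\<Lambda> / \<xi>) ^ (m * n) = 1"
        by (metis div_by_1 mult.commute power_divide power_mult power_one)
    qed (use False \<xi>0 m n in auto)
    hence "(1 / real m) / real n ^ 1 \<le> d" using norm_div_minus_one[OF \<xi>, of \<Lambda>] by (simp add: d_def)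
    note d = inverse_dist_bound[OF this n, simplified]
    have d0: "0 < d" "1 / d \<le> real m * real (n + 1)" using d m by auto
    have "?tb (\<lambda>q. 1 + (\<Lambda> - \<xi>) * (1 / (q - \<Lambda>))) (cmod 1 + d * (4 / d\<^sup>2)) (1 / d)"
      unfolding d_def using norm_root_of_unity[OF \<Lambda> n] False
      by (intro taylor_bounded_add taylor_bounded_const taylor_bounded_cmult taylor_bounded_unit_pole[OF \<xi>]) auto
    moreover have "cmod 1 + d * (4 / d\<^sup>2) \<le> 5 * real m * real (n + 1) ^ 1"
    proof -
      have "d * (4 / d\<^sup>2) = 4 * (1 / d)" by (simp add: power2_eq_square)
      thus ?thesis using d0(2) m1[of n] unfolding norm_one power_one_right mult.assoc by linarith
    qed
    ultimately have "?tb (\<lambda>q. 1 + (\<Lambda> - \<xi>) * (1 / (q - \<Lambda>))) (5 * real m * real (n + 1) ^ 1) (real m * real (n + 1) ^ 1)"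
      by (rule taylor_bounded_mono) (use d0 in auto)
    thus ?thesis
    proof (rule taylor_bounded_cong)
      fix q assume "q \<in> tangent_disks \<xi> \<xi>"
      hence "q - \<Lambda> \<noteq> 0" using tangent_disks_norm(1)[OF \<xi>] norm_root_of_unity[OF \<Lambda> n] by auto
      thus "1 + (\<Lambda> - \<xi>) * (1 / (q - \<Lambda>)) = (q - \<xi>) / (q - \<Lambda>)" by (simp add: field_simps)
    qed
  qed
  have "?tb (\<lambda>q. if n = 0 then 0 else \<Sum>\<Lambda>\<in>primitive_roots n. (q - \<xi>) / (q - \<Lambda>))
    (5 * real m * real (n + 1) ^ 2) (real m * real (n + 1) ^ 1)" for n
  proof (cases "n = 0")
    case True
    show ?thesis
      using taylor_bounded_mono[OF taylor_bounded_const[of "real m" "tangent_disks \<xi> \<xi>" \<xi> 0], of "5 * real m"] True by simp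
  next
    case False
    hence n: "n \<ge> 1" by simp
    have "?tb (\<lambda>q. \<Sum>\<Lambda>\<in>primitive_roots n. (q - \<xi>) / (q - \<Lambda>))
      (5 * real m * real (n + 1) ^ (1 + 1)) (real m * real (n + 1) ^ 1)"
    proof (rule taylor_bounded_family_sum)
      show "finite (primitive_roots n)"
        using finite_roots_of_unity[OF n] primitive_subset_roots finite_subset by blast
      show "card (primitive_roots n) \<le> n + 1"
        using card_mono[OF finite_roots_of_unity[OF n] primitive_subset_roots] card_roots_of_unity[OF n] by simp
    qed (use root[OF n] primitive_subset_roots in auto)
    thus ?thesis using False by (simp add: numeral_2_eq_2)
  qed
  thus ?thesis by (intro exI[of _ "5 * real m"] conjI exI[of _ "real m"]) auto
qed

section \<open>Partial fractions and Moebius inversion\<close>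

text \<open>Orthogonality of characters. Exchanging the roles of the index k of the root and the
  exponent l makes the sum geometric with a ratio different from 1.\<close>

lemma sum_negative_powers_roots:
  assumes "0 < l" "l < n"
  shows "(\<Sum>\<Lambda>\<in>roots_of_unity n. \<Lambda> powi (- int l)) = 0"
proof -
  let ?f = "\<lambda>k. cis (2 * pi * real k / real n)"
  have n: "n > 0" using assms by simp
  have bij: "bij_betw ?f {..<n} (roots_of_unity n)"
    unfolding roots_of_unity_def by (rule Complex.bij_betw_roots_unity[OF n])
  have "inverse (?f l) \<noteq> 1"
  proof
    assume "inverse (?f l) = 1"
    hence "?f l = 1" by (metis inverse_1 inverse_inverse_eq)
    hence "?f l = ?f 0" by simp
    hence "l = 0" using bij assms unfolding bij_betw_def inj_on_def by (metis lessThan_iff n)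
    thus False using assms by simp
  qed
  moreover have "inverse (?f l) ^ n = 1"
  proof -
    have "?f l \<in> roots_of_unity n" using bij_betwE[OF bij] assms by auto
    thus ?thesis by (simp only: roots_of_unity_def mem_Collect_eq power_inverse inverse_1)
  qed
  ultimately have "(\<Sum>k<n. inverse (?f l) ^ k) = 0"
    using geometric_sum[of "inverse (?f l)" n] by simp
  moreover have "(\<Sum>\<Lambda>\<in>roots_of_unity n. \<Lambda> powi (- int l)) = (\<Sum>k<n. ?f k powi (- int l))"
    by (rule sum.reindex_bij_betw[OF bij, symmetric])
  moreover have "?f k powi (- int l) = inverse (?f l) ^ k" for k
  proof -
    have "?f k powi (- int l) = inverse (?f k ^ l)" by (simp add: power_int_minus)
    also have "?f k ^ l = ?f l ^ k" by (simp add: Complex.DeMoivre mult_ac)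
    finally show ?thesis by (simp only: power_inverse)
  qed
  ultimately show ?thesis by simp
qed

text \<open>Summation over l comes first: it is a geometric sum in q / \<Lambda>, and (q /
  \<Lambda>)^n = q^n. The resulting factor q^n - 1 cancels the denominator in \<open>f_ser\<close>,
  so the Hadamard product with chi leaves exactly the poles in X.\<close>

lemma delta_nth:
  assumes "n \<ge> 1" "q ^ n \<noteq> 1"
  shows "fps_nth (delta X q) n = (q ^ n - 1) / of_nat n * (\<Sum>\<Lambda>\<in>roots_of_unity n \<inter> X. \<Lambda> / (q - \<Lambda>))"
proof -
  have "fps_nth (delta X q) n = (\<Sum>l<n. \<Sum>\<Lambda>\<in>roots_of_unity n \<inter> X. 1 / of_nat n * (\<Lambda> powi (- int l) * q ^ l))"
    by (simp add: delta_def delta_coeff_def sum_distrib_left sum_distrib_right mult_ac)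
  also have "\<dots> = (\<Sum>\<Lambda>\<in>roots_of_unity n \<inter> X. \<Sum>l<n. 1 / of_nat n * (\<Lambda> powi (- int l) * q ^ l))"
    by (rule sum.swap)
  also have "\<dots> = (\<Sum>\<Lambda>\<in>roots_of_unity n \<inter> X. (q ^ n - 1) / of_nat n * (\<Lambda> / (q - \<Lambda>)))"
  proof (rule sum.cong[OF refl])
    fix \<Lambda> assume "\<Lambda> \<in> roots_of_unity n \<inter> X"
    hence \<Lambda>: "\<Lambda> ^ n = 1" by (simp add: roots_of_unity_def)
    hence nz: "\<Lambda> \<noteq> 0" using assms(1) by (metis power_0_left not_one_le_zero zero_neq_one)
    have ne: "q \<noteq> \<Lambda>" using \<Lambda> assms(2) by auto
    have "(\<Sum>l<n. \<Lambda> powi (- int l) * q ^ l) = (\<Sum>l<n. (q / \<Lambda>) ^ l)"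
      by (simp add: power_int_minus power_divide) (simp add: divide_inverse mult.commute)
    also have "\<dots> = ((q / \<Lambda>) ^ n - 1) / (q / \<Lambda> - 1)"
      using ne nz by (intro geometric_sum) auto
    also have "\<dots> = (q ^ n - 1) * (\<Lambda> / (q - \<Lambda>))"
      using ne nz \<Lambda> by (simp add: power_divide field_simps)
    finally show "(\<Sum>l<n. 1 / of_nat n * (\<Lambda> powi (- int l) * q ^ l)) = (q ^ n - 1) / of_nat n * (\<Lambda> / (q - \<Lambda>))"
      by (simp flip: sum_distrib_left sum_divide_distrib)
  qed
  finally show ?thesis by (simp add: sum_distrib_left)
qed

text \<open>Orthogonality leaves only l = 0, to which the n roots contribute 1 in total.\<close>

lemma delta_UNIV_nth: "n \<ge> 1 \<Longrightarrow> fps_nth (delta UNIV q) n = 1"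
proof -
  assume n: "n \<ge> 1"
  have "delta_coeff UNIV n l = (if l = 0 then 1 else 0)" if "l < n" for l
    using sum_negative_powers_roots[of l n] that n card_roots_of_unity[OF n] by (auto simp: delta_coeff_def)
  hence "fps_nth (delta UNIV q) n = (\<Sum>l<n. if l = 0 then 1 else 0)"
    unfolding delta_def fps_nth_Abs_fps by (intro sum.cong) auto
  thus ?thesis using n by simp
qed

text \<open>Obtained by equating the two evaluations of \<open>delta UNIV\<close>, as a sum over all
  poles and as 1.\<close>

lemma partial_fractions_power:
  assumes "n \<ge> 1" "q ^ n \<noteq> 1"
  shows "(\<Sum>\<Lambda>\<in>roots_of_unity n. \<Lambda> / (q - \<Lambda>)) = of_nat n / (q ^ n - 1)"
  using delta_nth[OF assms, of UNIV] delta_UNIV_nth[OF assms(1), of q] assms by (simp add: field_simps)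

lemma norm_ne_1_power:
  fixes q :: complex
  assumes "cmod q \<noteq> 1" "n \<ge> 1" shows "q ^ n \<noteq> 1"
  using assms power_eq_1_iff[of q n] by auto

text \<open>\<Lambda> / (q (q - \<Lambda>)) is split into simple poles with numerators free of
  \<Lambda>, the form to which the Taylor bounds apply.\<close>

lemma sum_roots_eq:
  assumes "cmod q \<noteq> 1" "q \<noteq> 0" "n \<ge> 1"
  shows "(\<Sum>\<Lambda>\<in>roots_of_unity n \<inter> X. 1 / (q - \<Lambda>) - 1 / q)
           = inverse q * (\<Sum>\<Lambda>\<in>roots_of_unity n \<inter> X. \<Lambda> / (q - \<Lambda>))"
  unfolding sum_distrib_left
proof (rule sum.cong[OF refl])
  fix \<Lambda> assume "\<Lambda> \<in> roots_of_unity n \<inter> X"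
  hence "q - \<Lambda> \<noteq> 0" using norm_root_of_unity[of \<Lambda> n] assms(1,3) by auto
  thus "1 / (q - \<Lambda>) - 1 / q = inverse q * (\<Lambda> / (q - \<Lambda>))" using assms(2) by (simp add: field_simps)
qed

lemma chi_nth:
  assumes "n \<ge> 1" "cmod q \<noteq> 1" "q \<noteq> 0" "fps_nth g n = of_nat n * a"
  shows "fps_nth (chi g q) n = a * (\<Sum>\<Lambda>\<in>roots_of_unity n. 1 / (q - \<Lambda>) - 1 / q)"
proof -
  have "(\<Sum>\<Lambda>\<in>roots_of_unity n. 1 / (q - \<Lambda>) - 1 / q) = inverse q * (of_nat n / (q ^ n - 1))"
    using partial_fractions_power[OF assms(1) norm_ne_1_power[OF assms(2,1)]] sum_roots_eq[OF assms(2,3,1), of UNIV]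
    by simp
  thus ?thesis using assms by (simp add: chi_def f_ser_def)
qed

lemma chi_hadamard_delta_nth:
  assumes "n \<ge> 1" "cmod q \<noteq> 1" "q \<noteq> 0" "fps_nth g n = of_nat n * a"
  shows "fps_nth (chi g q \<odot> delta X q) n = a * (\<Sum>\<Lambda>\<in>roots_of_unity n \<inter> X. 1 / (q - \<Lambda>) - 1 / q)"
proof -
  have qn: "q ^ n \<noteq> 1" by (rule norm_ne_1_power[OF assms(2,1)])
  have "(\<Sum>\<Lambda>\<in>roots_of_unity n \<inter> X. 1 / (q - \<Lambda>) - 1 / q)
      = inverse q * (\<Sum>\<Lambda>\<in>roots_of_unity n \<inter> X. \<Lambda> / (q - \<Lambda>))"
    by (rule sum_roots_eq[OF assms(2,3,1)])
  thus ?thesis using assms delta_nth[OF assms(1) qn, of X] qn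
    by (simp add: hadamard_def chi_def f_ser_def)
qed

lemma chi_hadamard_delta_0: "fps_nth (F \<odot> delta X q) 0 = 0"
  by (simp add: hadamard_def delta_def)

lemma chi_nth_0:
  assumes "fps_nth g 0 = 0" "ereal (cmod 1) < fps_conv_radius g"
  shows "fps_nth (chi g q) 0 = inverse q * eval_fps g 1"
proof -
  have "f_ser g 0 = - g"
    by (rule fps_ext) (use assms in \<open>simp add: f_ser_def power_0_left\<close>)
  moreover have "eval_fps (- g) 1 = - eval_fps g 1" by (rule eval_fps_minus[OF assms(2)])
  ultimately show ?thesis using assms by (simp add: chi_def f_ser_def)
qed

section \<open>Moebius inversion for finite and infinite sums\<close>

fun moebius_mu :: "nat \<Rightarrow> complex" where
  "moebius_mu n = (if n \<le> 1 then 1 else - (\<Sum>d\<in>{d. d dvd n \<and> d < n}. moebius_mu d))"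

declare moebius_mu.simps [simp del]

lemma finite_divisors: "n \<ge> 1 \<Longrightarrow> finite {d::nat. d dvd n}"
  by (intro finite_divisors_nat) auto

lemma sum_moebius:
  assumes "n \<ge> 1"
  shows "(\<Sum>d\<in>{d. d dvd n}. moebius_mu d) = (if n = 1 then 1 else 0)"
proof (cases "n = 1")
  case True
  thus ?thesis by (simp add: moebius_mu.simps)
next
  case False
  have "{d. d dvd n} = insert n {d. d dvd n \<and> d < n}"
    using assms by (auto dest: dvd_imp_le)
  hence "(\<Sum>d\<in>{d. d dvd n}. moebius_mu d) = moebius_mu n + (\<Sum>d\<in>{d. d dvd n \<and> d < n}. moebius_mu d)"
    by (simp add: sum.insert)
  thus ?thesis using False assms moebius_mu.simps[of n] by simp
qed

text \<open>A crude bound, but it follows from the recursion alone, and the decay e^(-k) of the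
  weights absorbs it.\<close>

lemma norm_moebius_le: "cmod (moebius_mu n) \<le> 2 ^ n"
proof (induction n rule: less_induct)
  case (less n)
  show ?case
  proof (cases "n \<le> 1")
    case True
    thus ?thesis by (simp add: moebius_mu.simps)
  next
    case False
    have "cmod (moebius_mu n) \<le> (\<Sum>d\<in>{d. d dvd n \<and> d < n}. cmod (moebius_mu d))"
      using False by (subst moebius_mu.simps) (simp add: norm_sum)
    also have "\<dots> \<le> (\<Sum>d\<in>{d. d dvd n \<and> d < n}. 2 ^ d)" using less by (intro sum_mono) auto
    also have "\<dots> \<le> (\<Sum>d<n. 2 ^ d)" by (rule sum_mono2) auto
    also have "(\<Sum>d<n. 2 ^ d :: real) = 2 ^ n - 1" for n :: nat by (induction n) auto
    hence "(\<Sum>d<n. 2 ^ d :: real) \<le> 2 ^ n" by simp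
    finally show ?thesis .
  qed
qed

lemma moebius_inversion:
  fixes T U :: "nat \<Rightarrow> complex"
  assumes "m \<ge> 1" and U: "\<And>n. n \<ge> 1 \<Longrightarrow> U n = (\<Sum>d\<in>{d. d dvd n}. T d)"
  shows "(\<Sum>d\<in>{d. d dvd m}. moebius_mu (m div d) * U d) = T m"
proof -
  let ?D = "{d. d dvd m}"
  have fin: "finite ?D" by (rule finite_divisors[OF assms(1)])
  have pos: "d \<ge> 1" if "d dvd m" for d using that assms(1) by (metis dvd_0_left_iff less_one not_le)
  have "(\<Sum>d\<in>?D. moebius_mu (m div d) * U d) = (\<Sum>d\<in>?D. \<Sum>e\<in>{e\<in>?D. e dvd d}. moebius_mu (m div d) * T e)"
  proof (rule sum.cong[OF refl])
    fix d assume d: "d \<in> ?D"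
    hence "{e\<in>?D. e dvd d} = {e. e dvd d}" by (auto intro: dvd_trans)
    thus "moebius_mu (m div d) * U d = (\<Sum>e\<in>{e\<in>?D. e dvd d}. moebius_mu (m div d) * T e)"
      using U[OF pos] d by (simp add: sum_distrib_left)
  qed
  also have "\<dots> = (\<Sum>e\<in>?D. \<Sum>d\<in>{d\<in>?D. e dvd d}. moebius_mu (m div d) * T e)"
    by (rule sum.swap_restrict[OF fin fin])
  also have "\<dots> = (\<Sum>e\<in>?D. if e = m then T m else 0)"
  proof (rule sum.cong[OF refl])
    fix e assume e: "e \<in> ?D"
    \<comment> \<open>Complementary divisors: d |-> m / d maps the multiples of e among the divisors
      of m onto the divisors of m / e, where \<open>sum_moebius\<close> applies.\<close>
    have "(\<Sum>d\<in>{d\<in>?D. e dvd d}. moebius_mu (m div d)) = (\<Sum>j\<in>{j. j dvd m div e}. moebius_mu j)"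
    proof (rule sum.reindex_bij_witness[of _ "\<lambda>j. m div j" "\<lambda>d. m div d"])
      fix d assume d: "d \<in> {d\<in>?D. e dvd d}"
      thus "m div (m div d) = d" using assms(1) by (auto elim!: dvdE)
      show "m div d \<in> {j. j dvd m div e}"
        using d assms(1) by (auto elim!: dvdE)
    next
      fix j assume "j \<in> {j. j dvd m div e}"
      then obtain c where c: "m div e = j * c" by (auto elim: dvdE)
      have m: "m = e * j * c" using e c by (metis dvd_mult_div_cancel mem_Collect_eq mult.assoc)
      thus "m div (m div j) = j" using assms(1) by auto
      have "m div j = e * c" using m assms(1) by auto
      thus "m div j \<in> {d\<in>?D. e dvd d}" using m by simp
    qed simp
    also have "\<dots> = (if m div e = 1 then 1 else 0)"
      using e assms(1) by (intro sum_moebius) (auto elim!: dvdE)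
    also have "(m div e = 1) = (e = m)" using e assms(1) by (auto elim!: dvdE)
    finally have "(\<Sum>d\<in>{d\<in>?D. e dvd d}. moebius_mu (m div d)) = (if e = m then 1 else 0)" .
    thus "(\<Sum>d\<in>{d\<in>?D. e dvd d}. moebius_mu (m div d) * T e) = (if e = m then T m else 0)"
      by (simp flip: sum_distrib_right)
  qed
  also have "\<dots> = T m" using fin by simp
  finally show ?thesis .
qed

text \<open>One unconditionally summable double series is summed in two ways: over k for fixed n it
  gives a n * U n, and over the pairs with n k = m it gives S m times the Moebius inversion of U,
  which is T m.\<close>

lemma moebius_rearrangement:
  fixes S T U a :: "nat \<Rightarrow> complex"
  assumes U: "\<And>n. n \<ge> 1 \<Longrightarrow> U n = (\<Sum>d\<in>{d. d dvd n}. T d)"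
    and a: "\<And>n. n \<ge> 1 \<Longrightarrow> ((\<lambda>k. moebius_mu k * S (n * k)) has_sum a n) {1..}"
    and sm: "(\<lambda>(n, k). moebius_mu k * S (n * k) * U n) summable_on ({1..} \<times> {1..})"
  shows "\<exists>x. ((\<lambda>n. a n * U n) has_sum x) {1..} \<and> ((\<lambda>m. S m * T m) has_sum x) {1..}"
proof -
  define c where "c = (\<lambda>(n, k). moebius_mu k * S (n * k) * U n)"
  obtain x where x: "(c has_sum x) ({1..} \<times> {1..})"
    using sm unfolding c_def summable_on_def by blast
  have "((\<lambda>n. a n * U n) has_sum x) {1..}"
    by (rule has_sum_SigmaD[OF x]) (use a in \<open>auto simp: c_def intro!: has_sum_cmult_left\<close>)
  \<comment> \<open>Pairs (n, k) of positive numbers correspond to pairs (m, d) with d a divisor of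
    m, by m = n k and d = n.\<close>
  moreover have "((\<lambda>(m, d). c (d, m div d)) has_sum x) (Sigma {1..} (\<lambda>m. {d. d dvd m}))"
    by (subst has_sum_reindex_bij_witness[of "Sigma {1..} (\<lambda>m. {d. d dvd m})" "\<lambda>(n, k). (n * k, n)"
            "\<lambda>(m, d). (d, m div d)" "{1..} \<times> {1..}" c _ x x])
       (use x in \<open>auto elim!: dvdE\<close>)
  hence "((\<lambda>m. S m * T m) has_sum x) {1..}"
  proof (rule has_sum_SigmaD)
    fix m :: nat assume "m \<in> {1..}"
    hence m: "m \<ge> 1" by simp
    have "(\<Sum>d\<in>{d. d dvd m}. c (d, m div d)) = S m * (\<Sum>d\<in>{d. d dvd m}. moebius_mu (m div d) * U d)"
      unfolding sum_distrib_left c_def by (intro sum.cong) auto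
    also have "\<dots> = S m * T m" using moebius_inversion[OF m U] by simp
    finally show "((\<lambda>d. (\<lambda>(m, d). c (d, m div d)) (m, d)) has_sum S m * T m) {d. d dvd m}"
      using finite_divisors[OF m] by (intro has_sum_finiteI) auto
  qed
  ultimately show ?thesis by blast
qed

section \<open>The weights and the coefficients of g\<close>

definition weight :: "nat \<Rightarrow> complex" where
  "weight m = (if m \<ge> 2 then of_real (exp (- real m)) else 0)"

text \<open>
  Expanding \<open>1 / (q\<^sup>n - 1)\<close> in partial fractions, \<open>chi g q\<close> at \<open>z = 1\<close> has the coefficient
  \<open>\<Sum>k\<ge>1. g\<^sub>m\<^sub>k / (m k)\<close> at each \<open>1 / (q - \<Lambda>)\<close> with \<open>\<Lambda>\<close> primitive of order \<open>m\<close>.  It must be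
  \<open>weight m\<close>; Moebius inversion gives \<open>g\<^sub>n = n * coeff_a n\<close>.
\<close>

definition coeff_a :: "nat \<Rightarrow> complex" where
  "coeff_a n = (\<Sum>\<^sub>\<infinity>k\<in>{1..}. moebius_mu k * weight (n * k))"

lemma exp_minus_nat: "exp (- real n) = exp (-1) ^ n"
  using exp_of_nat_mult[of n "-1::real"] by simp

text \<open>This inequality is used twice: for the radius r = 2 against the decay e^(-n), and for
  the bound 2^k of the Moebius function.\<close>

lemma two_less_e: "2 * exp (-1) < (1::real)"
  using exp_lower_Taylor_quadratic[of "1::real"] by (simp add: exp_minus field_simps)

text \<open>(n - 1) (k - 1) \<ge> 0 means n k \<ge> n + k - 1. This separates the variables at the
  price of a factor e, so that double sums are dominated by products.\<close>

lemma norm_weight_le: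
  assumes "n \<ge> 1" "k \<ge> 1"
  shows "cmod (weight (n * k)) \<le> exp 1 * (exp (-1) ^ n * exp (-1) ^ k)"
proof -
  have "(real n - 1) * (real k - 1) \<ge> 0" using assms by (intro mult_nonneg_nonneg) auto
  hence "- real (n * k) \<le> 1 + (- real n + - real k)" by (simp add: algebra_simps)
  hence "exp (- real (n * k)) \<le> exp (1 + (- real n + - real k))" by simp
  also have "\<dots> = exp 1 * (exp (-1) ^ n * exp (-1) ^ k)"
    unfolding exp_add exp_minus_nat ..
  finally show ?thesis by (auto simp: weight_def)
qed

lemma norm_moebius_weight_le:
  assumes "n \<ge> 1" "k \<ge> 1"
  shows "cmod (moebius_mu k * weight (n * k)) \<le> exp 1 * exp (-1) ^ n * (2 * exp (-1)) ^ k"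
proof -
  have "cmod (moebius_mu k * weight (n * k)) \<le> 2 ^ k * (exp 1 * (exp (-1) ^ n * exp (-1) ^ k))"
    unfolding norm_mult by (intro mult_mono norm_moebius_le norm_weight_le assms) auto
  thus ?thesis by (simp add: power_mult_distrib mult_ac)
qed

lemma summable_on_geometric:
  assumes "0 \<le> c" "c < (1::real)" shows "(\<lambda>k. c ^ k) summable_on (A :: nat set)"
proof -
  have "(\<lambda>k. c ^ k) summable_on UNIV"
    using assms by (subst summable_on_UNIV_nonneg_real_iff) (auto intro!: summable_geometric)
  thus ?thesis by (rule summable_on_subset_banach) auto
qed

lemma coeff_a_has_sum:
  assumes "n \<ge> 1" shows "((\<lambda>k. moebius_mu k * weight (n * k)) has_sum coeff_a n) {1..}"
proof -
  have "(\<lambda>k. exp 1 * exp (-1) ^ n * (2 * exp (-1)) ^ k :: real) summable_on {1..}"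
    using two_less_e by (intro summable_on_cmult_right summable_on_geometric) auto
  hence "(\<lambda>k. cmod (moebius_mu k * weight (n * k))) summable_on {1..}"
    by (rule Infinite_Sum.abs_summable_on_comparison_test') (use norm_moebius_weight_le[OF assms] in auto)
  thus ?thesis unfolding coeff_a_def by (intro has_sum_infsum) (rule abs_summable_summable)
qed

lemma coeff_a_0: "coeff_a 0 = 0"
  by (simp add: coeff_a_def weight_def)

lemma norm_coeff_a_le: "\<exists>K\<ge>0. \<forall>n. cmod (coeff_a n) \<le> K * exp (-1) ^ n"
proof -
  define G where "G = (\<Sum>\<^sub>\<infinity>k\<in>{1::nat..}. (2 * exp (-1)) ^ k :: real)"
  have "cmod (coeff_a n) \<le> (exp 1 * G) * exp (-1) ^ n" if n: "n \<ge> 1" for n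
  proof -
    have g: "((\<lambda>k. exp 1 * exp (-1) ^ n * (2 * exp (-1)) ^ k) has_sum (exp 1 * exp (-1) ^ n * G)) {1::nat..}"
      unfolding G_def by (intro has_sum_cmult_right has_sum_infsum summable_on_geometric) (use two_less_e in auto)
    have "cmod (coeff_a n) \<le> exp 1 * exp (-1) ^ n * G"
      by (rule norm_infsum_le[OF coeff_a_has_sum[OF n] g norm_moebius_weight_le[OF n]]) auto
    thus ?thesis by (simp add: mult_ac)
  qed
  moreover have G0: "G \<ge> 0" unfolding G_def by (intro infsum_nonneg) auto
  moreover have "cmod (coeff_a 0) \<le> (exp 1 * G) * exp (-1) ^ 0" using G0 coeff_a_0 by simp
  ultimately have "cmod (coeff_a n) \<le> (exp 1 * G) * exp (-1) ^ n" for n by (cases "n = 0") auto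
  thus ?thesis using G0 by (intro exI[of _ "exp 1 * G"]) auto
qed

section \<open>The function G\<close>

definition root_sum :: "complex \<Rightarrow> nat \<Rightarrow> complex" where
  "root_sum q n = (\<Sum>\<Lambda>\<in>roots_of_unity n. 1 / (q - \<Lambda>))"

definition primitive_sum :: "complex \<Rightarrow> nat \<Rightarrow> complex" where
  "primitive_sum q n = (\<Sum>\<Lambda>\<in>primitive_roots n. 1 / (q - \<Lambda>))"

definition g_series :: "complex fps" where
  "g_series = Abs_fps (\<lambda>n. of_nat n * coeff_a n)"

lemma finite_primitive_roots: "n \<ge> 1 \<Longrightarrow> finite (primitive_roots n)"
  using finite_roots_of_unity primitive_subset_roots finite_subset by metis

lemma roots_of_unity_eq_UN:
  assumes "n \<ge> 1"
  shows "roots_of_unity n = (\<Union>d\<in>{d. d dvd n}. primitive_roots d)"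
proof (intro equalityI subsetI)
  fix \<Lambda> assume "\<Lambda> \<in> roots_of_unity n"
  hence \<Lambda>: "\<Lambda> ^ n = 1" by (simp add: roots_of_unity_def)
  define d where "d = (LEAST k. 0 < k \<and> \<Lambda> ^ k = 1)"
  have d: "0 < d \<and> \<Lambda> ^ d = 1" unfolding d_def by (rule LeastI[of _ n]) (use assms \<Lambda> in auto)
  have min: "\<Lambda> ^ k \<noteq> 1" if "0 < k" "k < d" for k using not_less_Least[of k] that unfolding d_def by blast
  have "\<Lambda> ^ n = (\<Lambda> ^ d) ^ (n div d) * \<Lambda> ^ (n mod d)" by (simp flip: power_mult power_add)
  hence "\<Lambda> ^ (n mod d) = 1" using d \<Lambda> by simp
  hence "n mod d = 0" using min[of "n mod d"] d by (metis gr0I mod_less_divisor)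
  thus "\<Lambda> \<in> (\<Union>d\<in>{d. d dvd n}. primitive_roots d)" using d min by (auto simp: primitive_roots_def)
next
  fix \<Lambda> assume "\<Lambda> \<in> (\<Union>d\<in>{d. d dvd n}. primitive_roots d)"
  thus "\<Lambda> \<in> roots_of_unity n"
    by (auto simp: primitive_roots_def roots_of_unity_def power_mult elim!: dvdE)
qed

lemma root_sum_eq:
  assumes "n \<ge> 1"
  shows "root_sum q n = (\<Sum>d\<in>{d. d dvd n}. primitive_sum q d)"
  unfolding root_sum_def primitive_sum_def roots_of_unity_eq_UN[OF assms]
proof (rule sum.UNION_disjoint)
  have pos: "d \<ge> 1" if "d dvd n" for d using that assms by (metis dvd_0_left_iff less_one not_le)
  show "finite {d. d dvd n}" by (rule finite_divisors[OF assms])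
  show "\<forall>d\<in>{d. d dvd n}. finite (primitive_roots d)" using pos finite_primitive_roots by blast
  show "\<forall>d\<in>{d. d dvd n}. \<forall>e\<in>{d. d dvd n}. d \<noteq> e \<longrightarrow> primitive_roots d \<inter> primitive_roots e = {}"
  proof (intro ballI impI)
    fix d e assume "d \<in> {d. d dvd n}" "e \<in> {d. d dvd n}" "d \<noteq> e"
    hence "0 < d" "0 < e" "d < e \<or> e < d" using pos[of d] pos[of e] by auto
    thus "primitive_roots d \<inter> primitive_roots e = {}" by (auto simp: primitive_roots_def)
  qed
qed

lemma norm_sum_roots_le:
  assumes "n \<ge> 1" "R \<subseteq> roots_of_unity n" "d > 0" "d \<le> \<bar>cmod q - 1\<bar>"
  shows "cmod (\<Sum>\<Lambda>\<in>R. 1 / (q - \<Lambda>)) \<le> real n / d"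
proof -
  have "cmod (1 / (q - \<Lambda>)) \<le> 1 / d" if "\<Lambda> \<in> R" for \<Lambda>
  proof -
    have "cmod \<Lambda> = 1" using that assms norm_root_of_unity by blast
    hence "\<bar>cmod q - 1\<bar> \<le> cmod (q - \<Lambda>)" by (metis norm_triangle_ineq3)
    hence "d \<le> cmod (q - \<Lambda>)" using assms(4) by linarith
    thus ?thesis using assms(3) by (simp add: norm_divide frac_le)
  qed
  hence "cmod (\<Sum>\<Lambda>\<in>R. 1 / (q - \<Lambda>)) \<le> of_nat (card R) * (1 / d)" by (rule sum_norm_bound)
  also have "real (card R) \<le> real n"
    using card_mono[OF finite_roots_of_unity[OF assms(1)] assms(2)] card_roots_of_unity[OF assms(1)] by simp
  hence "of_nat (card R) * (1 / d) \<le> real n * (1 / d)" using assms(3) by (intro mult_right_mono) auto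
  finally show ?thesis by simp
qed

lemma weight_sums_iff:
  "(\<lambda>m. weight m * c m) sums x \<longleftrightarrow> (\<lambda>m. weight (m + 2) * c (m + 2)) sums x"
  using sums_iff_shift[of "\<lambda>m. weight m * c m" 2 x] by (simp add: weight_def lessThan_Suc numeral_2_eq_2)

lemma G_sums:
  assumes "cmod q \<noteq> 1" shows "(\<lambda>m. weight m * primitive_sum q m) sums G q"
proof -
  have "G_term q (m + 2) = weight (m + 2) * primitive_sum q (m + 2)" for m
    by (simp add: G_term_def weight_def primitive_sum_def sum_distrib_left)
  thus ?thesis unfolding weight_sums_iff G_def using summable_sums[OF summable_G_term[OF assms]] by simp
qed

lemma summable_poly_geometric:
  assumes "0 \<le> \<kappa>" "\<kappa> < (1::real)"
  shows "summable (\<lambda>n. real (n + 1) ^ m * \<kappa> ^ n)"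
proof -
  have "summable (\<lambda>n. real (n + 1) ^ (m + 0 * 0) * \<kappa> ^ n)"
    by (rule sum_poly_geometric_bound[OF assms, of m 0])
  thus ?thesis by simp
qed

text \<open>The rearrangement with T summing the poles at primitive roots and U those at all roots.
  Off the unit circle the sum over the n-th roots is at most n / d, with d the distance of |q| from
  1, which gives the domination required.\<close>

lemma coeff_a_root_sum_sums:
  assumes "cmod q \<noteq> 1" shows "(\<lambda>n. coeff_a n * root_sum q n) sums G q"
proof -
  define d where "d = \<bar>cmod q - 1\<bar>"
  have d: "d > 0" using assms by (simp add: d_def)
  have s1: "(\<lambda>n. real (n + 1) * exp (-1) ^ n) summable_on {1..}"
  proof -
    have "summable (\<lambda>n. real (n + 1) * exp (-1) ^ n)"
      using summable_poly_geometric[of "exp (-1)" 1] by simp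
    hence "(\<lambda>n. real (n + 1) * exp (-1) ^ n) summable_on UNIV"
      by (subst summable_on_UNIV_nonneg_real_iff) auto
    thus ?thesis by (rule summable_on_subset_banach) auto
  qed
  \<comment> \<open>The majorant is a product of a function of n and a geometric term in k, so its
    summability is checked in one variable at a time.\<close>
  define H where "H = (\<lambda>(n, k). (exp 1 / d) * (real (n + 1) * exp (-1) ^ n) * (2 * exp (-1)) ^ k :: real)"
  have "H summable_on ({1..} \<times> {1..})"
  proof (rule summable_on_SigmaI)
    fix n :: nat
    show "((\<lambda>k. H (n, k)) has_sum ((exp 1 / d) * (real (n + 1) * exp (-1) ^ n)
            * (\<Sum>\<^sub>\<infinity>k\<in>{1..}. (2 * exp (-1)) ^ k))) {1..}"
      unfolding H_def prod.case
      by (intro has_sum_cmult_right has_sum_infsum summable_on_geometric) (use two_less_e in auto)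
    show "(\<lambda>n. (exp 1 / d) * (real (n + 1) * exp (-1) ^ n)
            * (\<Sum>\<^sub>\<infinity>k\<in>{1::nat..}. (2 * exp (-1)) ^ k)) summable_on {1..}"
      by (intro summable_on_cmult_left summable_on_cmult_right s1)
  qed (use d in \<open>auto simp: H_def\<close>)
  hence "(\<lambda>x. norm (case x of (n, k) \<Rightarrow> moebius_mu k * weight (n * k) * root_sum q n)) summable_on ({1..} \<times> {1..})"
  proof (rule Infinite_Sum.abs_summable_on_comparison_test')
    fix x :: "nat \<times> nat" assume "x \<in> {1..} \<times> {1..}"
    then obtain n k where x: "x = (n, k)" "n \<ge> 1" "k \<ge> 1" by auto
    have "cmod (root_sum q n) \<le> real n / d"
      unfolding root_sum_def by (rule norm_sum_roots_le[OF x(2) _ d]) (auto simp: d_def)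
    also have "\<dots> \<le> real (n + 1) / d" using d by (intro divide_right_mono) auto
    finally have "cmod (moebius_mu k * weight (n * k)) * cmod (root_sum q n)
        \<le> (exp 1 * exp (-1) ^ n * (2 * exp (-1)) ^ k) * (real (n + 1) / d)"
      by (intro mult_mono norm_moebius_weight_le x) auto
    thus "norm (case x of (n, k) \<Rightarrow> moebius_mu k * weight (n * k) * root_sum q n) \<le> H x"
      by (simp add: x(1) H_def norm_mult mult_ac)
  qed
  hence "(\<lambda>(n, k). moebius_mu k * weight (n * k) * root_sum q n) summable_on ({1..} \<times> {1..})"
    by (rule abs_summable_summable)
  from moebius_rearrangement[OF root_sum_eq coeff_a_has_sum this]
  obtain x where x: "((\<lambda>n. coeff_a n * root_sum q n) has_sum x) {1..}"
    "((\<lambda>m. weight m * primitive_sum q m) has_sum x) {1..}" by blast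
  \<comment> \<open>\<open>sums\<close> starts at index 0, where both series have the term
    0.\<close>
  have ext: "f sums x" if "(f has_sum x) {1..}" "f 0 = 0" for f :: "nat \<Rightarrow> complex"
  proof (rule has_sum_imp_sums)
    have "(f has_sum x) {1..} \<longleftrightarrow> (f has_sum x) UNIV"
      by (rule has_sum_cong_neutral) (use that(2) in \<open>auto simp: not_le\<close>)
    thus "(f has_sum x) UNIV" using that(1) by blast
  qed
  have "(\<lambda>m. weight m * primitive_sum q m) sums x" by (rule ext[OF x(2)]) (simp add: weight_def)
  hence "x = G q" using G_sums[OF assms] sums_unique2 by blast
  thus ?thesis using ext[OF x(1)] by (simp add: coeff_a_0)
qed

lemma coeff_a_bound:
  obtains K where "K \<ge> 0"
    "\<And>r n. 0 < r \<Longrightarrow> r \<le> 2 \<Longrightarrow> cmod (coeff_a n) * r ^ n \<le> K * (2 * exp (-1)) ^ n"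
proof -
  obtain K where K: "K \<ge> 0" "\<And>n. cmod (coeff_a n) \<le> K * exp (-1) ^ n" using norm_coeff_a_le by blast
  have "cmod (coeff_a n) * r ^ n \<le> K * (2 * exp (-1)) ^ n" if "0 < r" "r \<le> 2" for r n
  proof -
    have "cmod (coeff_a n) * r ^ n \<le> (K * exp (-1) ^ n) * 2 ^ n"
      using that K by (intro mult_mono power_mono) auto
    thus ?thesis by (simp add: power_mult_distrib mult_ac)
  qed
  thus ?thesis using K(1) that by blast
qed

lemma weight_bound: "cmod (weight n) * 2 ^ n \<le> 1 * (2 * exp (-1)) ^ n"
proof -
  have "cmod (weight n) \<le> exp (-1) ^ n" by (simp add: weight_def flip: exp_minus_nat)
  hence "cmod (weight n) * 2 ^ n \<le> exp (-1) ^ n * 2 ^ n" by (rule mult_right_mono) simp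
  thus ?thesis by (simp only: power_mult_distrib mult.commute mult_1)
qed

lemma g_series_in_B_space: "g_series \<in> vecs (B_space 2)"
proof -
  obtain K where K: "\<And>n. cmod (coeff_a n) * 2 ^ n \<le> K * (2 * exp (-1)) ^ n"
    using coeff_a_bound by (metis order_refl zero_less_numeral)
  have sm: "summable (\<lambda>n. real (n + 1) ^ 1 * (2 * exp (-1)) ^ n)"
    using two_less_e by (intro summable_poly_geometric) auto
  have "Abs_fps (\<lambda>n. coeff_a n * of_nat n) \<in> vecs (B_space 2)"
    by (rule Abs_fps_bound(1)[of 2 _ coeff_a K "2 * exp (-1)" of_nat 1 1, OF _ _ K _ _ sm]) (auto simp: coeff_a_0)
  thus ?thesis by (simp add: g_series_def mult.commute)
qed

lemma g_series_conv_radius: "ereal (cmod 1) < fps_conv_radius g_series"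
  using H_space_conv_radius[of 2 g_series 1] g_series_in_B_space by (simp add: vecs_B_space_iff)

text \<open>The parts - 1 / q of the coefficients with n \<ge> 1 add up to - g(1) / q, and the
  constant term g(1) / q of chi cancels them. This is the purpose of subtracting f_g(0, 1).\<close>

lemma chi_eval:
  assumes "cmod q \<noteq> 1" "q \<noteq> 0" shows "eval_fps (chi g_series q) 1 = G q"
proof -
  define g1 where "g1 = eval_fps g_series 1"
  have g1: "(\<lambda>n. of_nat n * coeff_a n) sums g1"
    using sums_eval_fps[OF g_series_conv_radius] by (simp add: g1_def g_series_def)
  have nth: "fps_nth (chi g_series q) n * 1 ^ n
      = coeff_a n * root_sum q n - inverse q * (of_nat n * coeff_a n) + (if n = 0 then inverse q * g1 else 0)" for n
  proof (cases "n = 0")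
    case True
    thus ?thesis using chi_nth_0[OF _ g_series_conv_radius] coeff_a_0 by (simp add: g1_def g_series_def)
  next
    case False
    hence n: "n \<ge> 1" by simp
    have "fps_nth (chi g_series q) n = coeff_a n * (\<Sum>\<Lambda>\<in>roots_of_unity n. 1 / (q - \<Lambda>) - 1 / q)"
      by (rule chi_nth[OF n assms]) (simp add: g_series_def)
    also have "(\<Sum>\<Lambda>\<in>roots_of_unity n. 1 / (q - \<Lambda>) - 1 / q) = root_sum q n - of_nat n * inverse q"
      using card_roots_of_unity[OF n] by (simp add: root_sum_def sum_subtractf divide_inverse)
    finally show ?thesis using False by (simp add: algebra_simps)
  qed
  have "(\<lambda>n. coeff_a n * root_sum q n - inverse q * (of_nat n * coeff_a n) + (if n = 0 then inverse q * g1 else 0))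
      sums (G q - inverse q * g1 + inverse q * g1)"
    by (intro sums_add sums_diff coeff_a_root_sum_sums assms(1) sums_mult g1 sums_single[of 0 "\<lambda>_. inverse q * g1"])
  hence "(\<lambda>n. fps_nth (chi g_series q) n * 1 ^ n) sums G q" unfolding nth by simp
  thus ?thesis unfolding eval_fps_def by (rule sums_unique[symmetric])
qed

text \<open>Presents G as the value at z = 1 of a power series in z, so that the results on
  vector-valued series apply to it. The factor c will be 1 or q - \<xi>.\<close>

lemma G_scaled_eval:
  assumes "cmod q \<noteq> 1"
  shows "eval_fps (Abs_fps (\<lambda>n. weight n * (c * primitive_sum q n))) 1 = c * G q"
proof -
  have "(\<lambda>n. c * (weight n * primitive_sum q n)) sums (c * G q)"
    by (intro sums_mult G_sums assms)
  thus ?thesis by (simp add: eval_fps_def mult.left_commute sums_iff)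
qed

text \<open>The value of chi at q = 0 is a limit, and it has to be G 0. All poles of G are on the
  unit circle, so on the disk of radius 1 / 2 the n-th pole sum is at most 2 n and G is holomorphic
  there.\<close>

lemma isCont_G_0: "isCont G 0"
proof -
  have d: "1 / 2 \<le> \<bar>cmod q - 1\<bar>" "cmod q \<noteq> 1" if "q \<in> ball 0 (1 / 2)" for q
    using that by auto
  have vh: "vholomorphic_on (H_space 2) (\<lambda>q. Abs_fps (\<lambda>n. weight n * (if n = 0 then 0 else primitive_sum q n))) (ball 0 (1 / 2))"
  proof (rule series_vholomorphic_on[where r = 2 and w = weight and K = 1 and \<kappa> = "2 * exp (-1)" and A = 2 and m = 1
        and \<phi> = "\<lambda>n q. if n = 0 then 0 else primitive_sum q n"])
    show "cmod (weight n) * 2 ^ n \<le> 1 * (2 * exp (-1)) ^ n" for n by (rule weight_bound)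
    fix n :: nat
    show "(\<lambda>q. if n = 0 then 0 else primitive_sum q n) holomorphic_on ball 0 (1 / 2)"
    proof (cases "n = 0")
      case False
      have "q \<noteq> \<Lambda>" if "q \<in> ball 0 (1 / 2)" "\<Lambda> \<in> primitive_roots n" for q \<Lambda>
      proof -
        have "\<Lambda> \<in> roots_of_unity n" using that(2) primitive_subset_roots by blast
        hence "cmod \<Lambda> = 1" using False by (intro norm_root_of_unity) auto
        thus ?thesis using that(1) by auto
      qed
      thus ?thesis using False unfolding primitive_sum_def by (auto intro!: holomorphic_intros)
    qed auto
    fix q :: complex assume q: "q \<in> ball 0 (1 / 2)"
    show "cmod (if n = 0 then 0 else primitive_sum q n) \<le> 2 * real (n + 1) ^ 1"
      using norm_sum_roots_le[of n "primitive_roots n" "1 / 2" q] primitive_subset_roots d(1)[OF q]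
      by (auto simp: primitive_sum_def)
  qed (use two_less_e in auto)
  have "(\<lambda>q. eval_fps (Abs_fps (\<lambda>n. weight n * (if n = 0 then 0 else primitive_sum q n))) 1) holomorphic_on ball 0 (1 / 2)"
    by (intro vholomorphic_on_functional[of 2 "H_space 2", OF _ _ bounded_functional_eval vh]) auto
  moreover have "eval_fps (Abs_fps (\<lambda>n. weight n * (if n = 0 then 0 else primitive_sum q n))) 1 = G q"
    if "q \<in> ball 0 (1 / 2)" for q
  proof -
    have "(\<lambda>n. weight n * (if n = 0 then 0 else primitive_sum q n)) = (\<lambda>n. weight n * (1 * primitive_sum q n))"
      by (auto simp: weight_def)
    thus ?thesis using G_scaled_eval[OF d(2)[OF that], of 1] by simp
  qed
  ultimately have "G holomorphic_on ball 0 (1 / 2)" by (rule holomorphic_transform)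
  hence "continuous_on (ball 0 (1 / 2)) G" by (rule holomorphic_on_imp_continuous_on)
  thus ?thesis by (simp add: continuous_on_eq_continuous_at)
qed

lemma gevrey_expansionI:
  assumes "gevrey_on \<sigma> \<xi> B (tangent_disks \<xi> \<xi>) f a"
  shows "gevrey_expansion \<sigma> \<xi> B f a"
proof -
  have "ball (\<xi> - \<xi> / 4) (1 / 4) \<in> inner_disks \<xi>" "ball (\<xi> + \<xi> / 4) (1 / 4) \<in> outer_disks \<xi>"
    unfolding inner_disks_def outer_disks_def by (auto intro!: exI[of _ "1 / 4"] simp: algebra_simps)
  thus ?thesis using gevrey_on_subset[OF assms] unfolding gevrey_expansion_def tangent_disks_def by blast
qed

text \<open>The factor q - \<xi> is put into each pole sum before anything is estimated; afterwards
  the expansion is evaluated at z = 1, inside the disk of radius 2.\<close>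

lemma G_in_polar_gevrey:
  assumes "\<xi> \<in> all_roots_of_unity" shows "G \<in> polar_gevrey 1 \<xi>"
proof -
  obtain n0 where n0: "n0 \<ge> 1" "\<xi> \<in> roots_of_unity n0" using assms by (auto simp: all_roots_of_unity_def)
  have \<xi>: "cmod \<xi> = 1" by (rule norm_root_of_unity[OF n0(2,1)])
  define \<phi> where "\<phi> = (\<lambda>n q. if n = 0 then 0 else \<Sum>\<Lambda>\<in>primitive_roots n. (q - \<xi>) / (q - \<Lambda>))"
  obtain A C where AC: "A \<ge> 0" "C \<ge> 0"
    "\<And>n. taylor_bounded (tangent_disks \<xi> \<xi>) \<xi> (\<phi> n) (A * real (n + 1) ^ 2) (C * real (n + 1) ^ 1)"
    using taylor_bounded_polar[OF assms] unfolding \<phi>_def by blast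
  obtain a where "gevrey_on (real 1) \<xi> (H_space 2) (tangent_disks \<xi> \<xi>) (\<lambda>q. Abs_fps (\<lambda>n. weight n * \<phi> n q)) a"
    using series_gevrey_on[of 2 "H_space 2" weight "tangent_disks \<xi> \<xi>" \<xi> 1 "2 * exp (-1)" \<phi>,
        OF _ _ open_tangent_disks tangent_disks_nonempty base_notin_tangent_disks[OF \<xi>] weight_bound _ two_less_e AC(3,1,2)]
    by fastforce
  from gevrey_on_functional[of 2 "H_space 2", OF _ _ bounded_functional_eval[of 1 2] this]
  have "gevrey_on 1 \<xi> complex_space (tangent_disks \<xi> \<xi>)
     (\<lambda>q. eval_fps (Abs_fps (\<lambda>n. weight n * \<phi> n q)) 1) (\<lambda>n. eval_fps (a n) 1)" by simp
  moreover have "eval_fps (Abs_fps (\<lambda>n. weight n * \<phi> n q)) 1 = (q - \<xi>) * G q" if "q \<in> tangent_disks \<xi> \<xi>" for q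
  proof -
    have "(\<lambda>n. weight n * \<phi> n q) = (\<lambda>n. weight n * ((q - \<xi>) * primitive_sum q n))"
      by (auto simp: weight_def \<phi>_def primitive_sum_def sum_distrib_left)
    thus ?thesis using G_scaled_eval[OF tangent_disks_norm(1)[OF \<xi> that], of "q - \<xi>"] by simp
  qed
  ultimately have "gevrey_on 1 \<xi> complex_space (tangent_disks \<xi> \<xi>) (\<lambda>q. (q - \<xi>) * G q) (\<lambda>n. eval_fps (a n) 1)"
    unfolding gevrey_on_complex using holomorphic_transform by auto
  thus ?thesis unfolding polar_gevrey_def gevrey_def using gevrey_expansionI by blast
qed

section \<open>Quasianalyticity\<close>

lemma tangent_ball_mono:
  assumes "cmod e = 1" "\<rho> \<le> \<rho>'"
  shows "tangent_ball \<xi> \<rho> e \<subseteq> tangent_ball \<xi> \<rho>' e"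
proof
  fix x assume x: "x \<in> tangent_ball \<xi> \<rho> e"
  have "dist (\<xi> + of_real \<rho>' * e) (\<xi> + of_real \<rho> * e) = cmod (of_real (\<rho>' - \<rho>) * e)"
    by (simp add: dist_norm left_diff_distrib)
  also have "\<dots> = \<rho>' - \<rho>" using assms by (simp only: norm_mult norm_of_real) simp
  finally show "x \<in> tangent_ball \<xi> \<rho>' e"
    using x dist_triangle[of "\<xi> + of_real \<rho>' * e" x "\<xi> + of_real \<rho> * e"] by simp
qed

lemma outer_disks_iff:
  "\<Delta> \<in> outer_disks \<xi> \<longleftrightarrow> (\<exists>\<rho>>0. \<Delta> = tangent_ball \<xi> \<rho> \<xi>)"
  by (auto simp: outer_disks_def algebra_simps)

lemma inner_disks_iff:
  "\<Delta> \<in> inner_disks \<xi> \<longleftrightarrow> (\<exists>\<rho>>0. \<rho> < 1 \<and> \<Delta> = tangent_ball \<xi> \<rho> (- \<xi>))"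
  by (auto simp: inner_disks_def algebra_simps)

lemma gevrey_on_complex_diff:
  assumes "\<sigma> \<ge> 0" "gevrey_on \<sigma> \<xi> complex_space S f a" "gevrey_on \<sigma> \<xi> complex_space S h b"
  shows "gevrey_on \<sigma> \<xi> complex_space S (\<lambda>q. f q - h q) (\<lambda>n. a n - b n)"
proof -
  obtain c0 c1 where c: "c0 > 0" "c1 > 0" and f: "\<And>N q. q \<in> S \<Longrightarrow> cmod (f q - (\<Sum>n<N. (q - \<xi>) ^ n * a n))
          \<le> c0 * c1 ^ N * Gamma (1 + real N * \<sigma>) * cmod (q - \<xi>) ^ N"
    using assms(2) unfolding gevrey_on_complex by blast
  obtain d0 d1 where d: "d0 > 0" "d1 > 0" and h: "\<And>N q. q \<in> S \<Longrightarrow> cmod (h q - (\<Sum>n<N. (q - \<xi>) ^ n * b n))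
          \<le> d0 * d1 ^ N * Gamma (1 + real N * \<sigma>) * cmod (q - \<xi>) ^ N"
    using assms(3) unfolding gevrey_on_complex by blast
  have "cmod (f q - h q - (\<Sum>n<N. (q - \<xi>) ^ n * (a n - b n)))
      \<le> (c0 + d0) * (max c1 d1) ^ N * Gamma (1 + real N * \<sigma>) * cmod (q - \<xi>) ^ N" if "q \<in> S" for N q
  proof -
    have G: "0 \<le> Gamma (1 + real N * \<sigma>)"
      using assms(1) by (intro less_imp_le Gamma_real_pos) (auto intro: add_pos_nonneg)
    have "f q - h q - (\<Sum>n<N. (q - \<xi>) ^ n * (a n - b n))
      = (f q - (\<Sum>n<N. (q - \<xi>) ^ n * a n)) - (h q - (\<Sum>n<N. (q - \<xi>) ^ n * b n))"
      by (simp add: right_diff_distrib sum_subtractf)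
    also have "cmod \<dots> \<le> c0 * c1 ^ N * Gamma (1 + real N * \<sigma>) * cmod (q - \<xi>) ^ N
       + d0 * d1 ^ N * Gamma (1 + real N * \<sigma>) * cmod (q - \<xi>) ^ N"
      by (rule order_trans[OF norm_triangle_ineq4 add_mono[OF f[OF that] h[OF that]]])
    also have "\<dots> \<le> c0 * (max c1 d1) ^ N * Gamma (1 + real N * \<sigma>) * cmod (q - \<xi>) ^ N
       + d0 * (max c1 d1) ^ N * Gamma (1 + real N * \<sigma>) * cmod (q - \<xi>) ^ N"
      using c d G by (intro add_mono mult_right_mono mult_left_mono power_mono) auto
    finally show ?thesis by (simp add: distrib_right)
  qed
  moreover have "(\<lambda>q. f q - h q) holomorphic_on S"
    using assms unfolding gevrey_on_complex by (intro holomorphic_intros) auto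
  moreover have "c0 + d0 > 0" "max c1 d1 > 0" using c d by auto
  ultimately show ?thesis unfolding gevrey_on_complex by blast
qed

lemma gevrey_on_zero_expansion:
  assumes "gevrey_on 1 \<xi> complex_space (tangent_ball \<xi> \<rho> e) f (\<lambda>_. 0)"
    "cmod e = 1" "\<rho> > 0" "q \<in> tangent_ball \<xi> \<rho> e"
  shows "f q = 0"
proof -
  obtain c0 c1 where "c0 > 0" "c1 > 0" "\<And>N q. q \<in> tangent_ball \<xi> \<rho> e \<Longrightarrow>
      cmod (f q) \<le> c0 * c1 ^ N * Gamma (1 + real N) * cmod (q - \<xi>) ^ N"
    and "f holomorphic_on tangent_ball \<xi> \<rho> e"
    using assms(1) unfolding gevrey_on_complex by auto
  thus ?thesis using watson_disk[of f \<xi> \<rho> e c0 c1 q] assms by auto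
qed

text \<open>Multiplied by q - \<xi>, the difference of two such functions has zero expansion of
  order 1 on each of the two disks, and Watson's lemma applies to each disk separately.\<close>

lemma quasianalytic_polar:
  assumes \<xi>: "cmod \<xi> = 1"
  shows "quasianalytic \<xi> (polar_gevrey 1 \<xi>) (polar_gevrey_expansion 1 \<xi>)"
  unfolding quasianalytic_def
proof (intro conjI ballI allI impI)
  fix f assume "f \<in> polar_gevrey 1 \<xi>"
  thus "\<exists>a. polar_gevrey_expansion 1 \<xi> f a"
    by (auto simp: polar_gevrey_def gevrey_def polar_gevrey_expansion_def)
next
  fix f h L assume "polar_gevrey_expansion 1 \<xi> f L" "polar_gevrey_expansion 1 \<xi> h L"
  then obtain a b where
    a: "gevrey_expansion 1 \<xi> complex_space (\<lambda>q. (q - \<xi>) * f q) a" "L = fls_X_inv * fps_to_fls (Abs_fps a)" and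
    b: "gevrey_expansion 1 \<xi> complex_space (\<lambda>q. (q - \<xi>) * h q) b" "L = fls_X_inv * fps_to_fls (Abs_fps b)"
    unfolding polar_gevrey_expansion_def by blast
  \<comment> \<open>The Laurent series determines the coefficients since \<open>fls_X_inv\<close> is
    invertible.\<close>
  have "Abs_fps a = Abs_fps b" using a(2) b(2) by simp
  hence ab: "a = b" by (auto simp: fps_eq_iff)
  have same: "f q = h q" if "\<rho> > 0" "cmod e = 1" "q \<in> tangent_ball \<xi> \<rho> e"
    "gevrey_on 1 \<xi> complex_space (tangent_ball \<xi> \<rho> e) (\<lambda>q. (q - \<xi>) * f q) a"
    "gevrey_on 1 \<xi> complex_space (tangent_ball \<xi> \<rho> e) (\<lambda>q. (q - \<xi>) * h q) a" for \<rho> e q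
  proof -
    have "gevrey_on 1 \<xi> complex_space (tangent_ball \<xi> \<rho> e) (\<lambda>q. (q - \<xi>) * f q - (q - \<xi>) * h q) (\<lambda>_. 0)"
      using gevrey_on_complex_diff[OF _ that(4,5)] by simp
    hence "(q - \<xi>) * f q - (q - \<xi>) * h q = 0" by (rule gevrey_on_zero_expansion) (use that in auto)
    moreover have "q \<noteq> \<xi>" using that by (auto simp: dist_norm norm_mult)
    ultimately show ?thesis by simp
  qed
  obtain \<rho>1 \<rho>2 \<rho>3 \<rho>4 where \<rho>: "\<rho>1 > 0" "\<rho>2 > 0" "\<rho>3 > 0" "\<rho>4 > 0" "\<rho>1 < 1"
    and g: "gevrey_on 1 \<xi> complex_space (tangent_ball \<xi> \<rho>1 (-\<xi>)) (\<lambda>q. (q - \<xi>) * f q) a"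
     "gevrey_on 1 \<xi> complex_space (tangent_ball \<xi> \<rho>2 (-\<xi>)) (\<lambda>q. (q - \<xi>) * h q) a"
     "gevrey_on 1 \<xi> complex_space (tangent_ball \<xi> \<rho>3 \<xi>) (\<lambda>q. (q - \<xi>) * f q) a"
     "gevrey_on 1 \<xi> complex_space (tangent_ball \<xi> \<rho>4 \<xi>) (\<lambda>q. (q - \<xi>) * h q) a"
    using a(1) b(1) unfolding gevrey_expansion_def ab Bex_def outer_disks_iff inner_disks_iff by blast
  have \<xi>': "cmod (- \<xi>) = 1" using \<xi> by simp
  define s where "s = min \<rho>1 \<rho>2"
  define t where "t = min \<rho>3 \<rho>4"
  have st: "s > 0" "t > 0" "s < 1" using \<rho> by (auto simp: s_def t_def)
  have s_sub: "tangent_ball \<xi> s (-\<xi>) \<subseteq> tangent_ball \<xi> \<rho>1 (-\<xi>)"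
    "tangent_ball \<xi> s (-\<xi>) \<subseteq> tangent_ball \<xi> \<rho>2 (-\<xi>)"
    by (rule tangent_ball_mono[OF \<xi>']; simp add: s_def)+
  have t_sub: "tangent_ball \<xi> t \<xi> \<subseteq> tangent_ball \<xi> \<rho>3 \<xi>"
    "tangent_ball \<xi> t \<xi> \<subseteq> tangent_ball \<xi> \<rho>4 \<xi>"
    by (rule tangent_ball_mono[OF \<xi>]; simp add: t_def)+
  have "f q = h q" if "q \<in> tangent_ball \<xi> s (-\<xi>)" for q
    by (rule same[OF st(1) \<xi>' that gevrey_on_subset[OF g(1) s_sub(1)] gevrey_on_subset[OF g(2) s_sub(2)]])
  moreover have "f q = h q" if "q \<in> tangent_ball \<xi> t \<xi>" for q
    by (rule same[OF st(2) \<xi> that gevrey_on_subset[OF g(3) t_sub(1)] gevrey_on_subset[OF g(4) t_sub(2)]])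
  moreover have "tangent_ball \<xi> s (-\<xi>) \<in> inner_disks \<xi>" "tangent_ball \<xi> t \<xi> \<in> outer_disks \<xi>"
    using st unfolding inner_disks_iff outer_disks_iff by blast+
  ultimately show "coincide_near \<xi> f h" unfolding coincide_near_def by blast
qed

section \<open>Uniqueness along the cardioids\<close>

lemma ray_in_disk:
  assumes "cmod \<xi> = 1" "\<eta> = 1 \<or> \<eta> = -1" "0 < s" "s < 2 * \<rho>"
  shows "\<xi> * (1 + of_real (\<eta> * s)) \<in> tangent_ball \<xi> \<rho> (of_real \<eta> * \<xi>)"
proof -
  have "dist (\<xi> + of_real \<rho> * (of_real \<eta> * \<xi>)) (\<xi> * (1 + of_real (\<eta> * s))) = cmod (\<xi> * of_real \<eta> * of_real (\<rho> - s))"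
    by (simp add: dist_norm algebra_simps)
  also have "\<dots> = \<bar>\<rho> - s\<bar>" unfolding norm_mult norm_of_real using assms by auto
  finally show ?thesis using assms by simp
qed

lemma zero_on_ray_imp_zero:
  assumes \<xi>: "cmod \<xi> = 1" "\<eta> = 1 \<or> \<eta> = -1" and "\<sigma> > 0" "\<sigma> < 2 * \<rho>"
    and hol: "D holomorphic_on tangent_ball \<xi> \<rho> (of_real \<eta> * \<xi>)"
    and zero: "\<And>s. 0 < s \<Longrightarrow> s < \<sigma> \<Longrightarrow> D (\<xi> * (1 + of_real (\<eta> * s))) = 0"
    and q: "q \<in> tangent_ball \<xi> \<rho> (of_real \<eta> * \<xi>)"
  shows "D q = 0"
proof (rule analytic_continuation[OF hol])
  let ?p = "\<lambda>s. \<xi> * (1 + complex_of_real (\<eta> * s))"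
  show "?p ` {0<..<\<sigma>} \<subseteq> tangent_ball \<xi> \<rho> (of_real \<eta> * \<xi>)"
    using ray_in_disk[OF \<xi>] assms(4) by auto
  show "?p (\<sigma> / 2) \<in> tangent_ball \<xi> \<rho> (of_real \<eta> * \<xi>)"
    using ray_in_disk[OF \<xi>, of "\<sigma> / 2" \<rho>] assms(3,4) by auto
  show "?p (\<sigma> / 2) islimpt ?p ` {0<..<\<sigma>}"
    unfolding islimpt_approachable
  proof (intro allI impI)
    fix e :: real assume e: "e > 0"
    define s where "s = \<sigma> / 2 + min (e / 2) (\<sigma> / 4)"
    have s: "0 < s" "s < \<sigma>" "s - \<sigma> / 2 > 0" "s - \<sigma> / 2 < e" using e assms(3) by (auto simp: s_def min_def)
    have "dist (?p s) (?p (\<sigma> / 2)) = cmod (\<xi> * of_real \<eta> * of_real (s - \<sigma> / 2))"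
      by (simp add: dist_norm algebra_simps)
    also have "\<dots> = s - \<sigma> / 2" unfolding norm_mult norm_of_real using \<xi> s by auto
    finally have eq: "dist (?p s) (?p (\<sigma> / 2)) = s - \<sigma> / 2" .
    have "0 < dist (?p s) (?p (\<sigma> / 2))" unfolding eq by (rule s(3))
    hence "?p s \<noteq> ?p (\<sigma> / 2)" by (rule zero_less_dist_iff[THEN iffD1])
    moreover have "dist (?p s) (?p (\<sigma> / 2)) < e" unfolding eq by (rule s(4))
    moreover have "?p s \<in> ?p ` {0<..<\<sigma>}" using s by (intro imageI) simp
    ultimately show "\<exists>x'\<in>?p ` {0<..<\<sigma>}. x' \<noteq> ?p (\<sigma> / 2) \<and> dist x' (?p (\<sigma> / 2)) < e" by (intro bexI conjI)
  qed
qed (use q zero in auto)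

text \<open>
  The rays \<open>u = 1 + t w\<close> with \<open>\<epsilon> \<i> w\<^sup>2 = \<plusminus>1\<close> are mapped to the radial segments at \<open>\<xi>\<close>, which lie in
  the tangent disks.  Flatness along one of them kills the Gevrey 1 expansion of \<open>K\<close>.
\<close>

lemma cardioid_flat_imp_zero:
  assumes \<xi>: "cmod \<xi> = 1" and \<epsilon>: "\<epsilon> = 1 \<or> \<epsilon> = -1" and \<rho>: "\<rho> > 0" "\<rho>1 > 0"
    and K: "gevrey_on 1 1 complex_space (tangent_ball 1 \<rho> 1) K b"
    and hol: "\<And>\<eta>. \<eta> = 1 \<or> \<eta> = -1 \<Longrightarrow> D holomorphic_on tangent_ball \<xi> \<rho>1 (of_real \<eta> * \<xi>)"
    and flat: "\<And>N. \<exists>C. \<forall>q\<in>tangent_ball \<xi> \<rho>1 (of_real 1 * \<xi>). cmod (D q) \<le> C * cmod (q - \<xi>) ^ N"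
    and eq: "\<And>u \<eta>. \<eta> = 1 \<or> \<eta> = -1 \<Longrightarrow> u \<in> tangent_ball 1 \<rho> 1 \<Longrightarrow>
       \<xi> * (1 + of_real \<epsilon> * \<i> * (u - 1)\<^sup>2) \<in> tangent_ball \<xi> \<rho>1 (of_real \<eta> * \<xi>) \<Longrightarrow>
       K u = D (\<xi> * (1 + of_real \<epsilon> * \<i> * (u - 1)\<^sup>2))"
    and \<eta>: "\<eta> = 1 \<or> \<eta> = -1" and q: "q \<in> tangent_ball \<xi> \<rho>1 (of_real \<eta> * \<xi>)"
  shows "D q = 0"
proof -
  \<comment> \<open>This is the square root of - i \<epsilon> \<eta> with positive real part 1 /
    sqrt 2, so the ray enters the disk of the coordinate u.\<close>
  define w where "w = (\<lambda>\<eta>::real. Complex (sqrt (1 / 2)) (- (\<epsilon> * \<eta>) * sqrt (1 / 2)))"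
  have w2: "of_real \<epsilon> * \<i> * (w \<eta>)\<^sup>2 = of_real \<eta>" if "\<eta> = 1 \<or> \<eta> = -1" for \<eta>
    using \<epsilon> that by (auto simp: w_def complex_eq_iff power2_eq_square)
  have wn: "cmod (w \<eta>) = 1" if "\<eta> = 1 \<or> \<eta> = -1" for \<eta>
    using \<epsilon> that by (auto simp: w_def cmod_def real_sqrt_divide power_divide)
  \<comment> \<open>t < T \<le> \<rho> keeps the ray in the disk; t \<le> 1 and t \<le> \<rho>1 keep
    its image, at distance t^2 from \<xi>, in the tangent disk.\<close>
  define T where "T = min 1 (min \<rho> \<rho>1)"
  have T: "0 < T" "T \<le> 1" "T \<le> \<rho>" "T \<le> \<rho>1" using \<rho> by (auto simp: T_def)
  have u_in: "1 + of_real t * w \<eta> \<in> tangent_ball 1 \<rho> 1" if t: "0 < t" "t < T" and \<eta>: "\<eta> = 1 \<or> \<eta> = -1" for t \<eta>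
  proof -
    have "1 / 2 \<le> sqrt (1 / 2 :: real)" by (rule real_le_rsqrt) (simp add: power2_eq_square)
    hence Re: "1 / 2 \<le> Re (w \<eta>)" by (simp add: w_def)
    have "(cmod (of_real \<rho> - of_real t * w \<eta>))\<^sup>2 = \<rho>\<^sup>2 - 2 * \<rho> * t * Re (w \<eta>) + t\<^sup>2 * (cmod (w \<eta>))\<^sup>2"
      unfolding cmod_power2 by (simp add: power2_eq_square algebra_simps)
    also have "\<dots> = \<rho>\<^sup>2 - (\<rho> * (2 * Re (w \<eta>)) - t) * t"
      using wn[OF \<eta>] by (simp add: power2_eq_square algebra_simps)
    also have "\<dots> < \<rho>\<^sup>2"
    proof -
      have "\<rho> * 1 \<le> \<rho> * (2 * Re (w \<eta>))" using Re \<rho> by (intro mult_left_mono) auto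
      hence "0 < \<rho> * (2 * Re (w \<eta>)) - t" using t T by linarith
      thus ?thesis using t by simp
    qed
    finally have "cmod (of_real \<rho> - of_real t * w \<eta>) < \<rho>" using \<rho> by (simp add: power2_less_imp_less)
    thus ?thesis by (simp add: dist_norm)
  qed
  have KD: "K (1 + of_real t * w \<eta>) = D (\<xi> * (1 + of_real (\<eta> * t\<^sup>2)))"
    and q_in: "\<xi> * (1 + of_real (\<eta> * t\<^sup>2)) \<in> tangent_ball \<xi> \<rho>1 (of_real \<eta> * \<xi>)"
    if t: "0 < t" "t < T" and \<eta>: "\<eta> = 1 \<or> \<eta> = -1" for t \<eta>
  proof -
    have "of_real \<epsilon> * \<i> * (1 + of_real t * w \<eta> - 1)\<^sup>2 = (of_real t)\<^sup>2 * (of_real \<epsilon> * \<i> * (w \<eta>)\<^sup>2)"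
      by (simp add: power_mult_distrib mult_ac)
    also have "\<dots> = of_real (\<eta> * t\<^sup>2)" by (simp only: w2[OF \<eta>]) (simp add: mult.commute)
    finally have qq: "of_real \<epsilon> * \<i> * (1 + of_real t * w \<eta> - 1)\<^sup>2 = complex_of_real (\<eta> * t\<^sup>2)" .
    have "t\<^sup>2 \<le> t" using t T by (simp add: power2_eq_square mult_le_one mult_left_le)
    thus qi: "\<xi> * (1 + of_real (\<eta> * t\<^sup>2)) \<in> tangent_ball \<xi> \<rho>1 (of_real \<eta> * \<xi>)"
      using t T by (intro ray_in_disk \<xi> \<eta>) auto
    show "K (1 + of_real t * w \<eta>) = D (\<xi> * (1 + of_real (\<eta> * t\<^sup>2)))"
      using eq[OF \<eta> u_in[OF t \<eta>]] qi unfolding qq by blast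
  qed
  obtain c0 c1 where c: "c0 > 0" "c1 > 0" and Kb: "\<And>N u. u \<in> tangent_ball 1 \<rho> 1 \<Longrightarrow>
      cmod (K u - (\<Sum>n<N. (u - 1) ^ n * b n)) \<le> c0 * c1 ^ N * Gamma (1 + real N * 1) * cmod (u - 1) ^ N"
    using K unfolding gevrey_on_complex by blast
  \<comment> \<open>Once the lower coefficients vanish, the N = k + 1 remainder and the flatness of
    D give t^k |b k| \<le> const * t^(k + 1) along the ray for \<eta> = 1; then t tends to
    0.\<close>
  have b0: "b k = 0" for k
  proof (induction k rule: less_induct)
    case (less k)
    obtain C where C: "\<And>q. q \<in> tangent_ball \<xi> \<rho>1 (of_real 1 * \<xi>) \<Longrightarrow>
        cmod (D q) \<le> C * cmod (q - \<xi>) ^ (k + 1)" using flat by blast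
    define C' where "C' = c0 * c1 ^ (k + 1) * Gamma (1 + real (k + 1) * 1)"
    have le: "cmod (b k) \<le> (\<bar>C\<bar> + C') * t" if t: "0 < t" "t < T" for t
    proof -
      let ?u = "1 + of_real t * w 1"
      have 1: "cmod (D (\<xi> * (1 + of_real (1 * t\<^sup>2)))) \<le> \<bar>C\<bar> * t ^ (k + 1)"
      proof -
        have "\<xi> * (1 + of_real (1 * t\<^sup>2)) - \<xi> = \<xi> * of_real (t\<^sup>2)" by (simp add: algebra_simps)
        hence "cmod (\<xi> * (1 + of_real (1 * t\<^sup>2)) - \<xi>) = t\<^sup>2" using \<xi> by (simp only: norm_mult norm_of_real) simp
        hence "cmod (D (\<xi> * (1 + of_real (1 * t\<^sup>2)))) \<le> C * (t\<^sup>2) ^ (k + 1)"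
          using C[OF q_in[OF t, of 1]] by simp
        also have "\<dots> \<le> \<bar>C\<bar> * (t\<^sup>2) ^ (k + 1)" by (intro mult_right_mono) auto
        \<comment> \<open>Since q - \<xi> has size t^2, flatness in q is more than is asked for in
          t; t \<le> 1 discards the surplus.\<close>
        also have "\<dots> \<le> \<bar>C\<bar> * t ^ (k + 1)"
          using t T by (intro mult_left_mono power_mono) (auto simp: power2_eq_square mult_left_le)
        finally show ?thesis .
      qed
      have wt: "cmod (of_real t * w 1) = t" using wn[of 1] t by (simp add: norm_mult)
      have "cmod (K ?u - (\<Sum>n<k + 1. (?u - 1) ^ n * b n)) \<le> C' * cmod (?u - 1) ^ (k + 1)"
        unfolding C'_def by (rule Kb[OF u_in[OF t]]) simp
      hence 2: "cmod (K ?u - (\<Sum>n<k + 1. (?u - 1) ^ n * b n)) \<le> C' * t ^ (k + 1)" using wt by simp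
      have s: "(\<Sum>n<k + 1. (?u - 1) ^ n * b n) = (of_real t * w 1) ^ k * b k"
        using less by simp
      have "cmod ((of_real t * w 1) ^ k * b k) \<le> cmod (K ?u) + cmod (K ?u - (of_real t * w 1) ^ k * b k)"
        using norm_triangle_ineq4[of "K ?u" "K ?u - (of_real t * w 1) ^ k * b k"] by simp
      also have "\<dots> \<le> \<bar>C\<bar> * t ^ (k + 1) + C' * t ^ (k + 1)"
        using 1 2 KD[OF t, of 1] unfolding s by (intro add_mono) auto
      finally have "t ^ k * cmod (b k) \<le> t ^ k * ((\<bar>C\<bar> + C') * t)"
      proof -
        assume "cmod ((of_real t * w 1) ^ k * b k) \<le> \<bar>C\<bar> * t ^ (k + 1) + C' * t ^ (k + 1)"
        moreover have "cmod ((of_real t * w 1) ^ k * b k) = t ^ k * cmod (b k)"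
          by (simp only: norm_mult[of "_ ^ k"] norm_power wt)
        moreover have "\<bar>C\<bar> * t ^ (k + 1) + C' * t ^ (k + 1) = t ^ k * ((\<bar>C\<bar> + C') * t)"
          by (simp add: algebra_simps)
        ultimately show ?thesis by simp
      qed
      thus ?thesis using t(1) by (simp only: mult_le_cancel_left_pos zero_less_power)
    qed
    have "cmod (b k) \<le> 0"
    proof (rule tendsto_le[OF trivial_limit_at_right_real])
      show "((\<lambda>t. (\<bar>C\<bar> + C') * t) \<longlongrightarrow> 0) (at_right 0)" by (auto intro!: tendsto_eq_intros)
      show "\<forall>\<^sub>F t in at_right 0. cmod (b k) \<le> (\<bar>C\<bar> + C') * t"
        using eventually_at_right_less[of 0] eventually_at_right_field[of _ 0] le T(1) by (auto simp: eventually_at_right_field)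
    qed simp
    thus ?case by simp
  qed
  hence "b = (\<lambda>_. 0)" by auto
  \<comment> \<open>Here order 1 in u is decisive: Watson's lemma turns the zero expansion into K =
    0.\<close>
  hence K0: "K u = 0" if "u \<in> tangent_ball 1 \<rho> 1" for u
    using gevrey_on_zero_expansion[of 1 \<rho> 1 K u] K \<rho> that by auto
  show ?thesis
  \<comment> \<open>K vanishes on the rays of both signs \<eta>, so D vanishes on a radial segment
    of either disk, and the identity theorem extends this to the whole disk.\<close>
  proof (rule zero_on_ray_imp_zero[OF \<xi> \<eta> _ _ hol[OF \<eta>] _ q])
    show "0 < T\<^sup>2" using T by simp
    have "T\<^sup>2 \<le> T" using T by (simp add: power2_eq_square mult_left_le)
    thus "T\<^sup>2 < 2 * \<rho>1" using T \<rho> by linarith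
    fix s assume s: "0 < s" "s < T\<^sup>2"
    define t where "t = sqrt s"
    have "t < T" using s T by (simp add: t_def real_less_lsqrt)
    moreover have "0 < t" "t\<^sup>2 = s" using s by (auto simp: t_def)
    ultimately show "D (\<xi> * (1 + of_real (\<eta> * s))) = 0"
      using KD[of t \<eta>] K0[OF u_in[of t \<eta>]] \<eta> by auto
  qed
qed

section \<open>The two open arcs at \<xi> and their delta functions\<close>

lemma arc_lt_Im: "\<Lambda> \<in> arc_lt \<xi> \<Longrightarrow> Im (\<Lambda> / \<xi>) < 0"
proof -
  assume "\<Lambda> \<in> arc_lt \<xi>"
  then obtain x \<alpha> where x: "\<Lambda> = cis (2 * pi * x)" "\<xi> = cis (2 * pi * \<alpha>)" "\<alpha> - 1/2 < x" "x < \<alpha>"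
    unfolding arc_lt_def by blast
  have "\<Lambda> / \<xi> = cis (- (2 * pi * (\<alpha> - x)))" unfolding x(1,2) cis_divide by (simp add: algebra_simps)
  moreover have "0 < sin (2 * pi * (\<alpha> - x))"
    using x(3,4) pi_gt_zero by (intro sin_gt_zero) (auto simp: mult_less_cancel_left1)
  ultimately show ?thesis by simp
qed

lemma arc_gt_Im: "\<Lambda> \<in> arc_gt \<xi> \<Longrightarrow> Im (\<Lambda> / \<xi>) > 0"
proof -
  assume "\<Lambda> \<in> arc_gt \<xi>"
  then obtain x \<alpha> where x: "\<Lambda> = cis (2 * pi * x)" "\<xi> = cis (2 * pi * \<alpha>)" "\<alpha> < x" "x < \<alpha> + 1/2"
    unfolding arc_gt_def by blast
  have "\<Lambda> / \<xi> = cis (2 * pi * (x - \<alpha>))" unfolding x(1,2) cis_divide by (simp add: algebra_simps)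
  moreover have "0 < sin (2 * pi * (x - \<alpha>))"
    using x(3,4) pi_gt_zero by (intro sin_gt_zero) (auto simp: mult_less_cancel_left1)
  ultimately show ?thesis by simp
qed

lemma in_arcs:
  assumes "cmod \<xi> = 1" "cmod \<Lambda> = 1"
  shows "Im (\<Lambda> / \<xi>) < 0 \<Longrightarrow> \<Lambda> \<in> arc_lt \<xi>" "Im (\<Lambda> / \<xi>) > 0 \<Longrightarrow> \<Lambda> \<in> arc_gt \<xi>"
proof -
  have nz: "\<xi> \<noteq> 0" "\<Lambda> \<noteq> 0" using assms by auto
  define \<alpha> where "\<alpha> = Arg \<xi> / (2 * pi)"
  define \<theta> where "\<theta> = Arg (\<Lambda> / \<xi>) / (2 * pi)"
  have \<xi>: "\<xi> = cis (2 * pi * \<alpha>)" using cis_Arg[OF nz(1)] assms by (simp add: \<alpha>_def sgn_div_norm)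
  have quot: "\<Lambda> / \<xi> = cis (2 * pi * \<theta>)"
    using cis_Arg[of "\<Lambda> / \<xi>"] nz assms by (simp add: \<theta>_def sgn_div_norm norm_divide)
  have \<Lambda>: "\<Lambda> = cis (2 * pi * (\<alpha> + \<theta>))"
  proof -
    have "\<Lambda> = \<xi> * (\<Lambda> / \<xi>)" using nz by simp
    thus ?thesis unfolding quot using \<xi> by (simp add: cis_mult distrib_left)
  qed
  have b: "-pi < 2 * pi * \<theta>" "2 * pi * \<theta> \<le> pi" using Arg_bounded[of "\<Lambda> / \<xi>"] by (auto simp: \<theta>_def)
  have Im: "Im (\<Lambda> / \<xi>) = sin (2 * pi * \<theta>)" unfolding quot by simp
  have lo: "- 1 / 2 < \<theta>"
  proof -
    have "pi * (-1) < pi * (2 * \<theta>)" using b(1) by simp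
    thus ?thesis by (simp only: mult_less_cancel_left_pos[OF pi_gt_zero])
  qed
  have hi: "\<theta> \<le> 1 / 2"
  proof -
    have "pi * (2 * \<theta>) \<le> pi * 1" using b(2) by simp
    thus ?thesis by (simp only: mult_le_cancel_left_pos[OF pi_gt_zero])
  qed
  show "\<Lambda> \<in> arc_lt \<xi>" if "Im (\<Lambda> / \<xi>) < 0"
  proof -
    have "\<theta> < 0"
    proof (rule ccontr)
      assume "\<not> \<theta> < 0"
      hence "0 \<le> sin (2 * pi * \<theta>)" using b by (intro sin_ge_zero) auto
      thus False using that Im by simp
    qed
    thus ?thesis unfolding arc_lt_def using \<xi> \<Lambda> lo
      by (intro CollectI exI[of _ "\<alpha> + \<theta>"] exI[of _ \<alpha>]) auto
  qed
  show "\<Lambda> \<in> arc_gt \<xi>" if "Im (\<Lambda> / \<xi>) > 0"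
  proof -
    have "\<theta> > 0"
    proof (rule ccontr)
      assume "\<not> \<theta> > 0"
      hence "0 \<le> sin (2 * pi * (- \<theta>))" using b by (intro sin_ge_zero) (auto simp: mult_nonneg_nonpos)
      thus False using that Im by simp
    qed
    \<comment> \<open>Arg takes values in ]-pi, pi], so the antipode of \<xi> has to be excluded on
      this side only.\<close>
    moreover have "\<theta> \<noteq> 1 / 2"
    proof
      assume "\<theta> = 1 / 2"
      hence "2 * pi * \<theta> = pi" by simp
      hence "sin (2 * pi * \<theta>) = 0" by (simp only: sin_pi)
      thus False using that Im by simp
    qed
    ultimately show ?thesis unfolding arc_gt_def using \<xi> \<Lambda> hi
      by (intro CollectI exI[of _ "\<alpha> + \<theta>"] exI[of _ \<alpha>]) auto
  qed
qed

lemma DC2_not_root: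
  assumes "\<xi> \<in> DC2" "n \<ge> 1" shows "\<xi> ^ n \<noteq> 1"
proof
  assume "\<xi> ^ n = 1"
  hence "\<xi> \<in> roots_of_unity n" by (simp add: roots_of_unity_def)
  moreover obtain \<gamma> where "0 < \<gamma>"
    "\<And>n \<Lambda>. n \<ge> 1 \<Longrightarrow> \<Lambda> \<in> roots_of_unity n \<Longrightarrow> cmod (\<Lambda> - \<xi>) \<ge> \<gamma> / (real n)\<^sup>2"
    using DC2_dist_roots[OF assms(1)] by metis
  ultimately have "\<gamma> / (real n)\<^sup>2 \<le> 0" "0 < \<gamma> / (real n)\<^sup>2" using assms(2) by fastforce+
  thus False by simp
qed

lemma DC2_norm: "\<xi> \<in> DC2 \<Longrightarrow> cmod \<xi> = 1"
  using DC2_dist_roots by metis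

lemma delta_arcs_add:
  assumes "\<xi> \<in> DC2" "n \<ge> 1"
  shows "fps_nth (delta (arc_lt \<xi>) q) n + fps_nth (delta (arc_gt \<xi>) q) n = 1"
proof -
  have \<xi>: "cmod \<xi> = 1" by (rule DC2_norm[OF assms(1)])
  have cover: "\<Lambda> \<in> arc_lt \<xi> \<or> \<Lambda> \<in> arc_gt \<xi>" if \<Lambda>: "\<Lambda> \<in> roots_of_unity n" for \<Lambda>
  proof (rule ccontr)
    assume no: "\<not> (\<Lambda> \<in> arc_lt \<xi> \<or> \<Lambda> \<in> arc_gt \<xi>)"
    have n: "cmod \<Lambda> = 1" by (rule norm_root_of_unity[OF \<Lambda> assms(2)])
    define z where "z = \<Lambda> / \<xi>"
    \<comment> \<open>A root on neither arc satisfies (\<Lambda> / \<xi>)^2 = 1, and then \<xi>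
      would be a root of unity of order dividing 2 n.\<close>
    have im: "Im z = 0" unfolding z_def using in_arcs[OF \<xi> n] no by (meson linorder_neqE_linordered_idom)
    have "cmod z = 1" using \<xi> n by (simp add: z_def norm_divide)
    hence "(Re z)\<^sup>2 = 1" using cmod_power2[of z] im by simp
    hence "z\<^sup>2 = 1" using im by (simp add: complex_eq_iff power2_eq_square)
    hence "(\<Lambda> / \<xi>)\<^sup>2 = 1" by (simp only: z_def)
    hence "(\<Lambda> / \<xi>) ^ (2 * n) = 1" by (simp only: power_mult power_one)
    moreover have "\<Lambda> ^ (2 * n) = 1"
      using \<Lambda> unfolding mult.commute[of 2 n] roots_of_unity_def mem_Collect_eq by (simp only: power_mult power_one)
    ultimately have "1 / \<xi> ^ (2 * n) = 1" by (simp only: power_divide)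
    hence "\<xi> ^ (2 * n) = 1" by (cases "\<xi> ^ (2 * n) = 0") auto
    thus False using DC2_not_root[OF assms(1), of "2 * n"] assms(2) by simp
  qed
  have "roots_of_unity n = (roots_of_unity n \<inter> arc_lt \<xi>) \<union> (roots_of_unity n \<inter> arc_gt \<xi>)" using cover by blast
  moreover have "(roots_of_unity n \<inter> arc_lt \<xi>) \<inter> (roots_of_unity n \<inter> arc_gt \<xi>) = {}"
    using arc_lt_Im arc_gt_Im by fastforce
  ultimately have "sum F (roots_of_unity n) = sum F (roots_of_unity n \<inter> arc_lt \<xi>) + sum F (roots_of_unity n \<inter> arc_gt \<xi>)"
    for F :: "complex \<Rightarrow> complex"
    using finite_roots_of_unity[OF assms(2)] by (metis finite_Int sum.union_disjoint)
  hence "delta_coeff (arc_lt \<xi>) n l + delta_coeff (arc_gt \<xi>) n l = delta_coeff UNIV n l" for l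
    by (simp add: delta_coeff_def flip: distrib_left add_divide_distrib)
  hence "fps_nth (delta (arc_lt \<xi>) q) n + fps_nth (delta (arc_gt \<xi>) q) n = fps_nth (delta UNIV q) n"
    by (simp add: delta_def flip: sum.distrib distrib_right)
  thus ?thesis using delta_UNIV_nth[OF assms(2)] by simp
qed

text \<open>The sign \<eta> treats the inner and the outer disk in one statement, and every smaller
  radius is allowed so that several such conditions can be intersected.\<close>

lemma coincide_near_disks:
  assumes "cmod \<xi> = 1" "coincide_near \<xi> f h"
  obtains \<rho> where "0 < \<rho>" "\<And>\<eta> \<rho>' q. \<eta> = 1 \<or> \<eta> = -1 \<Longrightarrow> \<rho>' \<le> \<rho> \<Longrightarrow>
     q \<in> tangent_ball \<xi> \<rho>' (of_real \<eta> * \<xi>) \<Longrightarrow> f q = h q"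
proof -
  obtain \<rho>1 \<rho>2 where \<rho>: "0 < \<rho>1" "0 < \<rho>2"
    and eq: "\<And>q. q \<in> tangent_ball \<xi> \<rho>1 (- \<xi>) \<Longrightarrow> f q = h q"
            "\<And>q. q \<in> tangent_ball \<xi> \<rho>2 \<xi> \<Longrightarrow> f q = h q"
    using assms(2) unfolding coincide_near_def Bex_def inner_disks_iff outer_disks_iff by blast
  show ?thesis
  proof (rule that[of "min \<rho>1 \<rho>2"])
    fix \<eta> \<rho>' q assume *: "\<eta> = 1 \<or> \<eta> = (-1::real)" "\<rho>' \<le> min \<rho>1 \<rho>2"
      "q \<in> tangent_ball \<xi> \<rho>' (of_real \<eta> * \<xi>)"
    show "f q = h q"
    proof (cases "\<eta> = 1")
      case True
      thus ?thesis using * tangent_ball_mono[OF assms(1), of \<rho>' \<rho>2 \<xi>] by (intro eq(2)) auto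
    next
      case False
      thus ?thesis using * assms(1) tangent_ball_mono[of "- \<xi>" \<rho>' \<rho>1 \<xi>] by (intro eq(1)) auto
    qed
  qed (use \<rho> in auto)
qed

lemma gevrey_expansion_disks:
  assumes "cmod \<xi> = 1" "gevrey_expansion \<sigma> \<xi> B f a"
  obtains \<rho> where "0 < \<rho>" "\<And>\<eta> \<rho>'. \<eta> = 1 \<or> \<eta> = -1 \<Longrightarrow> \<rho>' \<le> \<rho> \<Longrightarrow>
     gevrey_on \<sigma> \<xi> B (tangent_ball \<xi> \<rho>' (of_real \<eta> * \<xi>)) f a"
proof -
  obtain \<rho>1 \<rho>2 where \<rho>: "0 < \<rho>1" "0 < \<rho>2"
    and g: "gevrey_on \<sigma> \<xi> B (tangent_ball \<xi> \<rho>1 (- \<xi>)) f a"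
           "gevrey_on \<sigma> \<xi> B (tangent_ball \<xi> \<rho>2 \<xi>) f a"
    using assms(2) unfolding gevrey_expansion_def Bex_def inner_disks_iff outer_disks_iff by blast
  show ?thesis
  proof (rule that[of "min \<rho>1 \<rho>2"])
    fix \<eta> \<rho>' assume *: "\<eta> = 1 \<or> \<eta> = (-1::real)" "\<rho>' \<le> min \<rho>1 \<rho>2"
    show "gevrey_on \<sigma> \<xi> B (tangent_ball \<xi> \<rho>' (of_real \<eta> * \<xi>)) f a"
    proof (cases "\<eta> = 1")
      case True
      have "tangent_ball \<xi> \<rho>' \<xi> \<subseteq> tangent_ball \<xi> \<rho>2 \<xi>"
        using * by (intro tangent_ball_mono assms(1)) auto
      thus ?thesis using True gevrey_on_subset[OF g(2)] by simp
    next
      case False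
      have "tangent_ball \<xi> \<rho>' (- \<xi>) \<subseteq> tangent_ball \<xi> \<rho>1 (- \<xi>)"
        using * assms(1) by (intro tangent_ball_mono) auto
      thus ?thesis using False * gevrey_on_subset[OF g(1)] by auto
    qed
  qed (use \<rho> in auto)
qed

text \<open>The sign \<epsilon> lets one argument serve both arcs.\<close>

definition gevrey_cardioid :: "real \<Rightarrow> complex \<Rightarrow> complex fps cspace \<Rightarrow> (complex \<Rightarrow> complex fps) set" where
  "gevrey_cardioid \<epsilon> \<xi> B = {f. (\<lambda>u. f (\<xi> * (1 + of_real \<epsilon> * \<i> * (u - 1)\<^sup>2))) \<in> gevrey_plus 1 1 B}"

lemma gevrey_cardioid_lt: "gevrey_lt 1 \<xi> B = gevrey_cardioid 1 \<xi> B"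
  by (simp add: gevrey_lt_def gevrey_cardioid_def)

lemma gevrey_cardioid_gt: "gevrey_gt 1 \<xi> B = gevrey_cardioid (-1) \<xi> B"
  by (simp add: gevrey_gt_def gevrey_cardioid_def)

lemma delta_nth_holomorphic: "(\<lambda>q. fps_nth (delta X q) n) holomorphic_on S"
  unfolding delta_def fps_nth_Abs_fps by (intro holomorphic_intros)

text \<open>For fixed n the difference of the n-th coefficients has zero expansion of order 2, which
  is flatness but does not yet imply vanishing. Its product with the n-th coefficient of
  \<open>delta\<close> agrees on the disks with the difference of h1 and h2, which has order 1 in u,
  so \<open>cardioid_flat_imp_zero\<close> applies. The expansions of h1 and h2 need not agree a
  priori.\<close>

lemma flat_times_arc_zero:
  assumes \<xi>: "cmod \<xi> = 1" and r: "r > 0" and \<epsilon>: "\<epsilon> = 1 \<or> \<epsilon> = -1"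
    and f: "gevrey_expansion 2 \<xi> (B_space r) f1 a" "gevrey_expansion 2 \<xi> (B_space r) f2 a"
    and h1: "h1 \<in> gevrey_cardioid \<epsilon> \<xi> (B_space r)" "coincide_near \<xi> h1 (\<lambda>q. f1 q \<odot> delta X q)"
    and h2: "h2 \<in> gevrey_cardioid \<epsilon> \<xi> (B_space r)" "coincide_near \<xi> h2 (\<lambda>q. f2 q \<odot> delta X q)"
  obtains \<rho> where "0 < \<rho>" "\<And>\<rho>' \<eta> q n. 0 < \<rho>' \<Longrightarrow> \<rho>' \<le> \<rho> \<Longrightarrow> \<eta> = 1 \<or> \<eta> = -1 \<Longrightarrow>
      q \<in> tangent_ball \<xi> \<rho>' (of_real \<eta> * \<xi>) \<Longrightarrow>
      (fps_nth (f1 q) n - fps_nth (f2 q) n) * fps_nth (delta X q) n = 0"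
proof -
  obtain \<rho>1 where \<rho>1: "0 < \<rho>1" "\<And>\<eta> \<rho>'. \<eta> = 1 \<or> \<eta> = -1 \<Longrightarrow> \<rho>' \<le> \<rho>1 \<Longrightarrow>
     gevrey_on 2 \<xi> (B_space r) (tangent_ball \<xi> \<rho>' (of_real \<eta> * \<xi>)) f1 a"
    using gevrey_expansion_disks[OF \<xi> f(1)] by blast
  obtain \<rho>2 where \<rho>2: "0 < \<rho>2" "\<And>\<eta> \<rho>'. \<eta> = 1 \<or> \<eta> = -1 \<Longrightarrow> \<rho>' \<le> \<rho>2 \<Longrightarrow>
     gevrey_on 2 \<xi> (B_space r) (tangent_ball \<xi> \<rho>' (of_real \<eta> * \<xi>)) f2 a"
    using gevrey_expansion_disks[OF \<xi> f(2)] by blast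
  obtain \<rho>3 where \<rho>3: "0 < \<rho>3" "\<And>\<eta> \<rho>' q. \<eta> = 1 \<or> \<eta> = -1 \<Longrightarrow> \<rho>' \<le> \<rho>3 \<Longrightarrow>
     q \<in> tangent_ball \<xi> \<rho>' (of_real \<eta> * \<xi>) \<Longrightarrow> h1 q = f1 q \<odot> delta X q"
    using coincide_near_disks[OF \<xi> h1(2)] by blast
  obtain \<rho>4 where \<rho>4: "0 < \<rho>4" "\<And>\<eta> \<rho>' q. \<eta> = 1 \<or> \<eta> = -1 \<Longrightarrow> \<rho>' \<le> \<rho>4 \<Longrightarrow>
     q \<in> tangent_ball \<xi> \<rho>' (of_real \<eta> * \<xi>) \<Longrightarrow> h2 q = f2 q \<odot> delta X q"
    using coincide_near_disks[OF \<xi> h2(2)] by blast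
  let ?q = "\<lambda>u. \<xi> * (1 + of_real \<epsilon> * \<i> * (u - 1)\<^sup>2)"
  obtain s1 b1 where s1: "s1 > 0" "gevrey_on 1 1 (B_space r) (tangent_ball 1 s1 1) (\<lambda>u. h1 (?q u)) b1"
    using h1(1) unfolding gevrey_cardioid_def gevrey_plus_def Bex_def outer_disks_iff by blast
  obtain s2 b2 where s2: "s2 > 0" "gevrey_on 1 1 (B_space r) (tangent_ball 1 s2 1) (\<lambda>u. h2 (?q u)) b2"
    using h2(1) unfolding gevrey_cardioid_def gevrey_plus_def Bex_def outer_disks_iff by blast
  define s where "s = min s1 s2"
  have s: "s > 0" using s1 s2 by (simp add: s_def)
  have g1: "gevrey_on 1 1 (B_space r) (tangent_ball 1 s 1) (\<lambda>u. h1 (?q u)) b1"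
    by (rule gevrey_on_subset[OF s1(2) tangent_ball_mono]) (auto simp: s_def)
  have g2: "gevrey_on 1 1 (B_space r) (tangent_ball 1 s 1) (\<lambda>u. h2 (?q u)) b2"
    by (rule gevrey_on_subset[OF s2(2) tangent_ball_mono]) (auto simp: s_def)
  note coeff = gevrey_on_functional[OF r disjI2[OF refl] bounded_functional_nth[OF r disjI2[OF refl]]]
  define \<rho> where "\<rho> = min (min \<rho>1 \<rho>2) (min \<rho>3 \<rho>4)"
  have \<rho>: "\<rho> > 0" using \<rho>1 \<rho>2 \<rho>3 \<rho>4 by (auto simp: \<rho>_def)
  have "(fps_nth (f1 q) n - fps_nth (f2 q) n) * fps_nth (delta X q) n = 0"
    if \<rho>': "0 < \<rho>'" "\<rho>' \<le> \<rho>" and \<eta>: "\<eta> = 1 \<or> \<eta> = -1"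
    and q: "q \<in> tangent_ball \<xi> \<rho>' (of_real \<eta> * \<xi>)" for \<rho>' \<eta> q n
  proof -
    have le: "\<rho>' \<le> \<rho>1" "\<rho>' \<le> \<rho>2" "\<rho>' \<le> \<rho>3" "\<rho>' \<le> \<rho>4" using \<rho>'(2) by (auto simp: \<rho>_def)
    let ?D = "\<lambda>q. (fps_nth (f1 q) n - fps_nth (f2 q) n) * fps_nth (delta X q) n"
    have d: "gevrey_on 2 \<xi> complex_space (tangent_ball \<xi> \<rho>' (of_real \<eta> * \<xi>))
        (\<lambda>q. fps_nth (f1 q) n - fps_nth (f2 q) n) (\<lambda>_. 0)" if "\<eta> = 1 \<or> \<eta> = -1" for \<eta>
      using gevrey_on_complex_diff[OF _ coeff[OF \<rho>1(2)[OF that le(1)], of n] coeff[OF \<rho>2(2)[OF that le(2)], of n]] by simp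
    have K: "gevrey_on 1 1 complex_space (tangent_ball 1 s 1)
        (\<lambda>u. fps_nth (h1 (?q u)) n - fps_nth (h2 (?q u)) n) (\<lambda>k. fps_nth (b1 k) n - fps_nth (b2 k) n)"
      by (rule gevrey_on_complex_diff[OF _ coeff[OF g1] coeff[OF g2]]) simp
    show ?thesis
    proof (rule cardioid_flat_imp_zero[of \<xi> \<epsilon> s \<rho>' _ _ ?D, OF \<xi> \<epsilon> s \<rho>'(1) K])
      show "?D holomorphic_on tangent_ball \<xi> \<rho>' (of_real \<eta> * \<xi>)" if "\<eta> = 1 \<or> \<eta> = -1" for \<eta>
        using d[OF that] delta_nth_holomorphic unfolding gevrey_on_complex by (intro holomorphic_on_mult) auto
    next
      fix N
      let ?S = "tangent_ball \<xi> \<rho>' (of_real 1 * \<xi>)"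
      have "gevrey_on 2 \<xi> complex_space ?S (\<lambda>q. fps_nth (f1 q) n - fps_nth (f2 q) n) (\<lambda>_. 0)"
        by (rule d) simp
      then obtain c0 c1 where "\<forall>N. \<forall>q\<in>?S. cmod (fps_nth (f1 q) n - fps_nth (f2 q) n - (\<Sum>k<N. (q - \<xi>) ^ k * 0))
          \<le> c0 * c1 ^ N * Gamma (1 + real N * 2) * cmod (q - \<xi>) ^ N"
        unfolding gevrey_on_complex by blast
      hence c: "cmod (fps_nth (f1 q) n - fps_nth (f2 q) n)
          \<le> c0 * c1 ^ N * Gamma (1 + real N * 2) * cmod (q - \<xi>) ^ N" if "q \<in> ?S" for N q
        using that by (simp only: mult_zero_right sum.neutral_const diff_zero)
      \<comment> \<open>The coefficient of \<open>delta\<close> is a polynomial in q, hence bounded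
        on the closed disk, and the product stays flat.\<close>
      have "compact ((\<lambda>q. fps_nth (delta X q) n) ` cball (\<xi> + of_real \<rho>' * (of_real 1 * \<xi>)) \<rho>')"
        by (intro compact_continuous_image holomorphic_on_imp_continuous_on delta_nth_holomorphic) auto
      then obtain M where M: "\<And>q. q \<in> cball (\<xi> + of_real \<rho>' * (of_real 1 * \<xi>)) \<rho>' \<Longrightarrow> cmod (fps_nth (delta X q) n) \<le> M"
        by (meson bounded_iff compact_imp_bounded image_eqI)
      have "cmod (?D q) \<le> (c0 * c1 ^ N * Gamma (1 + real N * 2) * M) * cmod (q - \<xi>) ^ N" if "q \<in> ?S" for q
      proof -
        have "cmod (?D q) \<le> (c0 * c1 ^ N * Gamma (1 + real N * 2) * cmod (q - \<xi>) ^ N) * M"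
          unfolding norm_mult
          by (intro mult_mono M c that) (use that ball_subset_cball c[OF that, of N] norm_ge_zero order_trans in \<open>blast+\<close>)
        thus ?thesis by (simp add: mult_ac)
      qed
      thus "\<exists>C. \<forall>q\<in>?S. cmod (?D q) \<le> C * cmod (q - \<xi>) ^ N" by blast
    next
      fix u \<eta> assume "\<eta> = 1 \<or> \<eta> = (-1::real)" "?q u \<in> tangent_ball \<xi> \<rho>' (of_real \<eta> * \<xi>)"
      thus "fps_nth (h1 (?q u)) n - fps_nth (h2 (?q u)) n = ?D (?q u)"
        using \<rho>3(2)[OF _ le(3)] \<rho>4(2)[OF _ le(4)] by (simp add: hadamard_def left_diff_distrib)
    qed (use \<eta> q in auto)
  qed
  thus ?thesis using that \<rho> by blast
qed

lemma gevrey_odot_iff: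
  "f \<in> gevrey_odot 1 \<xi> B \<longleftrightarrow> f \<in> gevrey 2 \<xi> B \<and>
     (\<exists>h\<in>gevrey_cardioid 1 \<xi> B. coincide_near \<xi> h (\<lambda>q. f q \<odot> delta (arc_lt \<xi>) q)) \<and>
     (\<exists>h\<in>gevrey_cardioid (-1) \<xi> B. coincide_near \<xi> h (\<lambda>q. f q \<odot> delta (arc_gt \<xi>) q))"
  by (simp add: gevrey_odot_def gevrey_cardioid_lt gevrey_cardioid_gt)

text \<open>
  Adding the two arcs: \<open>delta (arc_lt \<xi>) + delta (arc_gt \<xi>)\<close> is \<open>z / (1 - z)\<close>, the unit for \<open>\<odot>\<close>
  on series without constant term, because no root of unity equals \<open>\<plusminus>\<xi>\<close>.
\<close>

lemma quasianalytic_odot: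
  assumes "\<xi> \<in> DC2" "r > 0"
  shows "quasianalytic \<xi> (gevrey_odot 1 \<xi> (B_space r)) (gevrey_expansion 2 \<xi> (B_space r))"
  unfolding quasianalytic_def
proof (intro conjI ballI allI impI)
  fix f assume "f \<in> gevrey_odot 1 \<xi> (B_space r)"
  thus "\<exists>a. gevrey_expansion 2 \<xi> (B_space r) f a" by (simp add: gevrey_odot_iff gevrey_def)
next
  fix f1 f2 a
  assume f1: "f1 \<in> gevrey_odot 1 \<xi> (B_space r)" and f2: "f2 \<in> gevrey_odot 1 \<xi> (B_space r)"
    and a: "gevrey_expansion 2 \<xi> (B_space r) f1 a" "gevrey_expansion 2 \<xi> (B_space r) f2 a"
  have \<xi>: "cmod \<xi> = 1" by (rule DC2_norm[OF assms(1)])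
  obtain h1 k1 where h1: "h1 \<in> gevrey_cardioid 1 \<xi> (B_space r)" "coincide_near \<xi> h1 (\<lambda>q. f1 q \<odot> delta (arc_lt \<xi>) q)"
    "k1 \<in> gevrey_cardioid (-1) \<xi> (B_space r)" "coincide_near \<xi> k1 (\<lambda>q. f1 q \<odot> delta (arc_gt \<xi>) q)"
    using f1 unfolding gevrey_odot_iff by blast
  obtain h2 k2 where h2: "h2 \<in> gevrey_cardioid 1 \<xi> (B_space r)" "coincide_near \<xi> h2 (\<lambda>q. f2 q \<odot> delta (arc_lt \<xi>) q)"
    "k2 \<in> gevrey_cardioid (-1) \<xi> (B_space r)" "coincide_near \<xi> k2 (\<lambda>q. f2 q \<odot> delta (arc_gt \<xi>) q)"
    using f2 unfolding gevrey_odot_iff by blast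
  obtain \<rho>1 where \<rho>1: "0 < \<rho>1" "\<And>\<rho>' \<eta> q n. 0 < \<rho>' \<Longrightarrow> \<rho>' \<le> \<rho>1 \<Longrightarrow> \<eta> = 1 \<or> \<eta> = -1 \<Longrightarrow>
      q \<in> tangent_ball \<xi> \<rho>' (of_real \<eta> * \<xi>) \<Longrightarrow>
      (fps_nth (f1 q) n - fps_nth (f2 q) n) * fps_nth (delta (arc_lt \<xi>) q) n = 0"
    by (rule flat_times_arc_zero[OF \<xi> assms(2) disjI1[OF refl] a h1(1,2) h2(1,2)]) blast
  obtain \<rho>2 where \<rho>2: "0 < \<rho>2" "\<And>\<rho>' \<eta> q n. 0 < \<rho>' \<Longrightarrow> \<rho>' \<le> \<rho>2 \<Longrightarrow> \<eta> = 1 \<or> \<eta> = -1 \<Longrightarrow>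
      q \<in> tangent_ball \<xi> \<rho>' (of_real \<eta> * \<xi>) \<Longrightarrow>
      (fps_nth (f1 q) n - fps_nth (f2 q) n) * fps_nth (delta (arc_gt \<xi>) q) n = 0"
    by (rule flat_times_arc_zero[OF \<xi> assms(2) disjI2[OF refl] a h1(3,4) h2(3,4)]) blast
  obtain \<rho>3 where \<rho>3: "0 < \<rho>3" "\<And>\<eta> \<rho>'. \<eta> = 1 \<or> \<eta> = -1 \<Longrightarrow> \<rho>' \<le> \<rho>3 \<Longrightarrow>
     gevrey_on 2 \<xi> (B_space r) (tangent_ball \<xi> \<rho>' (of_real \<eta> * \<xi>)) f1 a"
    using gevrey_expansion_disks[OF \<xi> a(1)] by blast
  obtain \<rho>4 where \<rho>4: "0 < \<rho>4" "\<And>\<eta> \<rho>'. \<eta> = 1 \<or> \<eta> = -1 \<Longrightarrow> \<rho>' \<le> \<rho>4 \<Longrightarrow>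
     gevrey_on 2 \<xi> (B_space r) (tangent_ball \<xi> \<rho>' (of_real \<eta> * \<xi>)) f2 a"
    using gevrey_expansion_disks[OF \<xi> a(2)] by blast
  \<comment> \<open>The entry 1 / 2 ensures \<rho> < 1, as inner disks require.\<close>
  define \<rho> where "\<rho> = Min {\<rho>1, \<rho>2, \<rho>3, \<rho>4, 1 / 2}"
  have \<rho>: "0 < \<rho>" "\<rho> \<le> \<rho>1" "\<rho> \<le> \<rho>2" "\<rho> \<le> \<rho>3" "\<rho> \<le> \<rho>4" "\<rho> < 1"
    using \<rho>1(1) \<rho>2(1) \<rho>3(1) \<rho>4(1) by (auto simp: \<rho>_def)
  have eq: "f1 q = f2 q" if \<eta>: "\<eta> = 1 \<or> \<eta> = -1" and q: "q \<in> tangent_ball \<xi> \<rho> (of_real \<eta> * \<xi>)" for \<eta> q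
  proof (rule fps_ext)
    fix n
    show "fps_nth (f1 q) n = fps_nth (f2 q) n"
    proof (cases "n = 0")
      \<comment> \<open>The delta functions do not see the constant coefficient; it agrees because
        elements of \<open>B_space\<close> vanish at z = 0.\<close>
      case True
      have "f1 q \<in> vecs (B_space r)" "f2 q \<in> vecs (B_space r)"
        using \<rho>3(2)[OF \<eta> \<rho>(4)] \<rho>4(2)[OF \<eta> \<rho>(5)] q unfolding gevrey_on_def vholomorphic_on_def by blast+
      thus ?thesis using True by (simp add: vecs_B_space_iff)
    next
      case False
      let ?d = "fps_nth (f1 q) n - fps_nth (f2 q) n"
      have "?d = ?d * (fps_nth (delta (arc_lt \<xi>) q) n + fps_nth (delta (arc_gt \<xi>) q) n)"
        using delta_arcs_add[OF assms(1), of n q] False by simp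
      also have "\<dots> = 0"
        using \<rho>1(2)[OF \<rho>(1,2) \<eta> q] \<rho>2(2)[OF \<rho>(1,3) \<eta> q] by (simp only: distrib_left add_0)
      finally show ?thesis by simp
    qed
  qed
  have "tangent_ball \<xi> \<rho> (- \<xi>) \<in> inner_disks \<xi>" "tangent_ball \<xi> \<rho> \<xi> \<in> outer_disks \<xi>"
    using \<rho> unfolding inner_disks_iff outer_disks_iff by blast+
  moreover have "f1 q = f2 q" if "q \<in> tangent_ball \<xi> \<rho> (- \<xi>) \<union> tangent_ball \<xi> \<rho> \<xi>" for q
    using eq[of 1 q] eq[of "-1" q] that by auto
  ultimately show "coincide_near \<xi> f1 f2" unfolding coincide_near_def by blast
qed

section \<open>Membership of chi\<close>

lemma coincide_near_tangent_disks:
  assumes "\<And>q. q \<in> tangent_disks \<xi> \<xi> \<Longrightarrow> f q = h q"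
  shows "coincide_near \<xi> f h"
proof -
  have "ball (\<xi> - \<xi> / 4) (1 / 4) \<in> inner_disks \<xi>" "ball (\<xi> + \<xi> / 4) (1 / 4) \<in> outer_disks \<xi>"
    unfolding inner_disks_def outer_disks_def by (auto intro!: exI[of _ "1 / 4"] simp: algebra_simps)
  thus ?thesis using assms unfolding coincide_near_def tangent_disks_def by blast
qed

text \<open>The extension h is the sum over the selected poles, written without
  \<open>delta\<close>. This formula remains meaningful on the cardioid, which need not stay in the
  tangent disks, and by \<open>chi_hadamard_delta_nth\<close> it agrees with the Hadamard product on
  them. As f is only compared with chi in degrees n \<ge> 1, the lemma covers chi with and without
  its constant term.\<close>

lemma chi_hadamard_delta_extends:
  assumes "\<xi> \<in> DC2" "\<epsilon> = 1 \<or> \<epsilon> = -1" and X: "\<And>\<Lambda>. \<Lambda> \<in> X \<Longrightarrow> \<epsilon> * Im (\<Lambda> / \<xi>) \<le> 0"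
    and r: "0 < r" "r \<le> 2" "B = H_space r \<or> B = B_space r"
    and f: "\<And>q n. n \<ge> 1 \<Longrightarrow> fps_nth (f q) n = fps_nth (chi g_series q) n"
  shows "\<exists>h\<in>gevrey_cardioid \<epsilon> \<xi> B. coincide_near \<xi> h (\<lambda>q. f q \<odot> delta X q)"
proof -
  have \<xi>: "cmod \<xi> = 1" by (rule DC2_norm[OF assms(1)])
  obtain K where K: "\<And>n. cmod (coeff_a n) * r ^ n \<le> K * (2 * exp (-1)) ^ n"
    using coeff_a_bound r by metis
  define h where "h = (\<lambda>q. Abs_fps (\<lambda>n. coeff_a n *
      (if n = 0 then 0 else \<Sum>\<Lambda>\<in>roots_of_unity n \<inter> X. 1 / (q - \<Lambda>) - 1 / q)))"
  define \<phi> where "\<phi> = (\<lambda>n u. if n = 0 then 0 else \<Sum>\<Lambda>\<in>roots_of_unity n \<inter> X.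
       1 / (\<xi> * (1 + of_real \<epsilon> * \<i> * (u - 1)\<^sup>2) - \<Lambda>) - 1 / (\<xi> * (1 + of_real \<epsilon> * \<i> * (u - 1)\<^sup>2)))"
  obtain A C where AC: "A \<ge> 0" "C \<ge> 0"
    "\<And>n. taylor_bounded (tangent_disks 1 1) 1 (\<phi> n) (A * real (n + 1) ^ 4) (C * real (n + 1) ^ 1)"
    using taylor_bounded_cardioid[OF assms(1,2) X] unfolding \<phi>_def by blast
  have "\<exists>b. gevrey_on (real 1) 1 B (tangent_disks 1 1) (\<lambda>u. h (\<xi> * (1 + of_real \<epsilon> * \<i> * (u - 1)\<^sup>2))) b"
    by (rule series_gevrey_on[OF r(1) _ open_tangent_disks tangent_disks_nonempty base_notin_tangent_disks K _ two_less_e AC(3,1,2)])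
       (use r(3) coeff_a_0 in \<open>auto simp: h_def \<phi>_def\<close>)
  then obtain b where "gevrey_on 1 1 B (tangent_disks 1 1) (\<lambda>u. h (\<xi> * (1 + of_real \<epsilon> * \<i> * (u - 1)\<^sup>2))) b" by auto
  moreover have "ball (1 + 1 / 4) (1 / 4) \<subseteq> tangent_disks 1 1" by (auto simp: tangent_disks_def)
  moreover have "ball (1 + 1 / 4) (1 / 4) \<in> outer_disks 1"
    unfolding outer_disks_def by (auto intro!: exI[of _ "1 / 4"])
  ultimately have "h \<in> gevrey_cardioid \<epsilon> \<xi> B"
    unfolding gevrey_cardioid_def gevrey_plus_def using gevrey_on_subset by blast
  moreover have "coincide_near \<xi> h (\<lambda>q. f q \<odot> delta X q)"
  proof (rule coincide_near_tangent_disks)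
    fix q assume "q \<in> tangent_disks \<xi> \<xi>"
    note q = tangent_disks_norm[OF \<xi> this]
    show "h q = f q \<odot> delta X q"
    proof (rule fps_ext)
      fix n
      show "fps_nth (h q) n = fps_nth (f q \<odot> delta X q) n"
      proof (cases "n = 0")
        case True
        thus ?thesis using chi_hadamard_delta_0 by (simp add: h_def)
      next
        case False
        hence n: "n \<ge> 1" by simp
        have "fps_nth (f q \<odot> delta X q) n = fps_nth (chi g_series q \<odot> delta X q) n"
          using f[OF n] by (simp add: hadamard_def)
        thus ?thesis using chi_hadamard_delta_nth[OF n q, of g_series "coeff_a n" X] False
          by (simp add: h_def g_series_def)
      qed
    qed
  qed
  ultimately show ?thesis by blast
qed

text \<open>Two cases in one: c0 = g(1) is chi itself in \<open>H_space\<close>, the constant term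
  being carried by the weight c0 and the function 1 / q; c0 = 0 is chi without its constant term,
  which lies in \<open>B_space\<close>.\<close>

lemma chi_in_gevrey_odot:
  assumes "\<xi> \<in> DC2" and r: "0 < r" "r \<le> 2" and B: "B = H_space r \<or> B = B_space r \<and> c0 = 0"
    and f: "\<And>q n. n \<ge> 1 \<Longrightarrow> fps_nth (f q) n = fps_nth (chi g_series q) n" "\<And>q. fps_nth (f q) 0 = inverse q * c0"
  shows "f \<in> gevrey_odot 1 \<xi> B"
proof -
  have \<xi>: "cmod \<xi> = 1" by (rule DC2_norm[OF assms(1)])
  obtain K where K: "\<And>n. cmod (coeff_a n) * r ^ n \<le> K * (2 * exp (-1)) ^ n"
    using coeff_a_bound r by metis
  define w where "w = (\<lambda>n. if n = 0 then c0 else coeff_a n)"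
  have wK: "cmod (w n) * r ^ n \<le> (\<bar>K\<bar> + cmod c0) * (2 * exp (-1)) ^ n" for n
  proof (cases "n = 0")
    case False
    have "K * (2 * exp (-1)) ^ n \<le> (\<bar>K\<bar> + cmod c0) * (2 * exp (-1)) ^ n"
      using norm_ge_zero[of c0] abs_ge_self[of K] by (intro mult_right_mono) (linarith, simp)
    hence "cmod (coeff_a n) * r ^ n \<le> (\<bar>K\<bar> + cmod c0) * (2 * exp (-1)) ^ n" using K[of n] by linarith
    thus ?thesis using False by (simp only: w_def if_False)
  qed (simp add: w_def)
  define \<phi> where "\<phi> = (\<lambda>n q. if n = 0 then 1 / q else \<Sum>\<Lambda>\<in>roots_of_unity n. 1 / (q - \<Lambda>) - 1 / q)"
  obtain A C where AC: "A \<ge> 0" "C \<ge> 0"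
    "\<And>n. taylor_bounded (tangent_disks \<xi> \<xi>) \<xi> (\<phi> n) (A * real (n + 1) ^ 5) (C * real (n + 1) ^ 2)"
    using taylor_bounded_diophantine[OF assms(1)] unfolding \<phi>_def by blast
  have "\<exists>b. gevrey_on (real 2) \<xi> B (tangent_disks \<xi> \<xi>) f b"
  proof (rule series_gevrey_on[OF r(1) _ open_tangent_disks tangent_disks_nonempty base_notin_tangent_disks[OF \<xi>] wK _ two_less_e AC(3,1,2)])
    show "B = H_space r \<or> B = B_space r \<and> w 0 = 0" using B by (auto simp: w_def)
    fix q assume "q \<in> tangent_disks \<xi> \<xi>"
    note q = tangent_disks_norm[OF \<xi> this]
    show "f q = Abs_fps (\<lambda>n. w n * \<phi> n q)"
    proof (rule fps_ext)
      fix n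
      show "fps_nth (f q) n = fps_nth (Abs_fps (\<lambda>n. w n * \<phi> n q)) n"
      proof (cases "n = 0")
        case False
        hence n: "n \<ge> 1" by simp
        show ?thesis using chi_nth[OF n q, of g_series "coeff_a n"] False f(1)[OF n]
          by (simp add: w_def \<phi>_def g_series_def)
      qed (simp add: f(2) w_def \<phi>_def divide_inverse mult.commute)
    qed
  qed auto
  then obtain b where "gevrey_on 2 \<xi> B (tangent_disks \<xi> \<xi>) f b" by auto
  hence "f \<in> gevrey 2 \<xi> B" unfolding gevrey_def using gevrey_expansionI by blast
  moreover have B': "B = H_space r \<or> B = B_space r" using B by blast
  have "\<exists>h\<in>gevrey_cardioid 1 \<xi> B. coincide_near \<xi> h (\<lambda>q. f q \<odot> delta (arc_lt \<xi>) q)"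
    by (rule chi_hadamard_delta_extends[OF assms(1) _ _ r B' f(1)]) (use arc_lt_Im in \<open>auto intro: less_imp_le\<close>)
  moreover have "\<exists>h\<in>gevrey_cardioid (-1) \<xi> B. coincide_near \<xi> h (\<lambda>q. f q \<odot> delta (arc_gt \<xi>) q)"
    by (rule chi_hadamard_delta_extends[OF assms(1) _ _ r B' f(1)]) (use arc_gt_Im in \<open>auto intro: less_imp_le\<close>)
  ultimately show ?thesis unfolding gevrey_odot_iff by blast
qed

theorem theorem5p1:
  shows "\<exists>r::real. \<exists>g::complex fps. r > 1 \<and> g \<in> vecs (B_space r) \<and>
    (\<forall>q. cmod q \<noteq> 1 \<and> q \<noteq> 0 \<longrightarrow> eval_fps (chi g q) 1 = G q) \<and>
    ((\<lambda>q. eval_fps (chi g q) 1) \<longlongrightarrow> G 0) (at 0) \<and>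
    (\<forall>\<Lambda>\<^sub>0\<in>all_roots_of_unity.
       G \<in> polar_gevrey 1 \<Lambda>\<^sub>0 \<and>
       quasianalytic \<Lambda>\<^sub>0 (polar_gevrey 1 \<Lambda>\<^sub>0) (polar_gevrey_expansion 1 \<Lambda>\<^sub>0)) \<and>
    (\<forall>\<xi>\<in>DC2. \<forall>r'. 1 < r' \<and> r' < r \<longrightarrow>
       chi g \<in> gevrey_odot 1 \<xi> (H_space r') \<and>
       (\<lambda>q. chi g q - fps_const (fps_nth (chi g q) 0)) \<in> gevrey_odot 1 \<xi> (B_space r') \<and>
       quasianalytic \<xi> (gevrey_odot 1 \<xi> (B_space r')) (gevrey_expansion 2 \<xi> (B_space r')))"
proof (rule exI[of _ 2], rule exI[of _ g_series], intro conjI ballI allI impI)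
  show "g_series \<in> vecs (B_space 2)" by (rule g_series_in_B_space)
  show "eval_fps (chi g_series q) 1 = G q" if "cmod q \<noteq> 1 \<and> q \<noteq> 0" for q
    using that by (intro chi_eval) auto
  \<comment> \<open>Near 0 but not at 0, chi at z = 1 equals G, so the limit is inherited from the
    continuity of G.\<close>
  have "(G \<longlongrightarrow> G 0) (at 0)" using isCont_G_0 by (simp add: isCont_def)
  moreover have "\<forall>\<^sub>F q in at 0. G q = eval_fps (chi g_series q) 1"
    unfolding eventually_at by (rule exI[of _ 1]) (auto intro!: chi_eval[symmetric])
  ultimately show "((\<lambda>q. eval_fps (chi g_series q) 1) \<longlongrightarrow> G 0) (at 0)"
    by (rule Lim_transform_eventually)
next
  fix \<xi> assume \<xi>: "\<xi> \<in> all_roots_of_unity"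
  show "G \<in> polar_gevrey 1 \<xi>" by (rule G_in_polar_gevrey[OF \<xi>])
  have "cmod \<xi> = 1" using \<xi> norm_root_of_unity by (auto simp: all_roots_of_unity_def)
  thus "quasianalytic \<xi> (polar_gevrey 1 \<xi>) (polar_gevrey_expansion 1 \<xi>)" by (rule quasianalytic_polar)
next
  fix \<xi> r' :: _ assume \<xi>: "\<xi> \<in> DC2" and "1 < r' \<and> r' < (2::real)"
  hence r': "0 < r'" "r' \<le> 2" by auto
  have "fps_nth (chi g_series q) 0 = inverse q * eval_fps g_series 1" for q
    using chi_nth_0[OF _ g_series_conv_radius] by (simp add: g_series_def)
  thus "chi g_series \<in> gevrey_odot 1 \<xi> (H_space r')"
    by (intro chi_in_gevrey_odot[OF \<xi> r', of _ "eval_fps g_series 1"]) auto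
  show "(\<lambda>q. chi g_series q - fps_const (fps_nth (chi g_series q) 0)) \<in> gevrey_odot 1 \<xi> (B_space r')"
    by (rule chi_in_gevrey_odot[OF \<xi> r', of _ 0]) auto
  show "quasianalytic \<xi> (gevrey_odot 1 \<xi> (B_space r')) (gevrey_expansion 2 \<xi> (B_space r'))"
    by (rule quasianalytic_odot[OF \<xi> r'(1)])
qed auto

end
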